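(* Let $r\ge 4$ and $k$ be integers with $0\le k<\lfloor \frac{r}{2}\rfloor$. Let $\mathfrak{g}$ be the complex simple Lie algebra of type $D_r$ and let $e\in\mathfrak{g}$ be a nilpotent element of type $D_r(a_k)$. Then the weight partition $\mathcal{W}_{k,r}$ of $e$ is the sum (union counted with multiplicities) of the three multisets $$[1,3,5,\dots,2r-2k-3],\qquad [1,3,5,\dots,2k-1],\qquad [r-1,r-2,r-3,\dots,r-2k,r-2k-1].$$ Here the first two multisets consist of all odd positive integers up to the indicated bound, each with multiplicity one (the second one is empty if $k=0$), and the third consists of all $2k+1$ integers from $r-2k-1$ to $r-1$, each with multiplicity one.
   Context: Weight partition. Let $\mathfrak{g}$ be a complex simple Lie algebra and $e\in\mathfrak{g}$ a nonzero nilpotent element. By Jacobson–Morozov choose $h,f\in\mathfrak{g}$ with $[h,e]=2e$, $[h,f]=-2f$, $[e,f]=h$. Under the adjoint action of the subalgebra spanned by $e,h,f$, $\mathfrak{g}$ decomposes into irreducible submodules $\mathfrak{g}=\bigoplus_{i=1}^n V^i$ with $n=\dim\ker \mathrm{ad}_e$ and $\dim V^i=2\eta_i+1$, where each $\eta_i$ is an integer or a half-integer. The weight partition of $e$ is the multiset $[\eta_1,\eta_2,\dots,\eta_n]$; it depends only on the orbit of $e$ under the adjoint group. Type $D_r(a_k)$. The simple roots $\alpha_1,\dots,\alpha_r$ of $D_r$ are ordered so that the edges of the Dynkin diagram are $\alpha_1-\alpha_3$, $\alpha_2-\alpha_3$ and $\alpha_i-\alpha_{i+1}$ for $3\le i\le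 r-1$. A nilpotent element $e$ of the Lie algebra of type $D_r$ is of type $D_r(a_k)$ if its weighted Dynkin diagram has weight $0$ at the nodes $\alpha_{2m+1}$, $0<m\le k$, and weight $2$ at all other nodes. That is, for an $\mathfrak{sl}_2$-triple $\{e,h,f\}$, a Cartan subalgebra containing $h$ and a choice of positive roots such that $\alpha(h)\ge 0$ for every positive root $\alpha$, one has (with the simple roots $\alpha_1,\dots,\alpha_r$ labelled so that the edges of the Dynkin diagram are $\alpha_1-\alpha_3$, $\alpha_2-\alpha_3$ and $\alpha_i-\alpha_{i+1}$ for $3\le i\le r-1$) $\alpha_{2m+1}(h)=0$ for $0<m\le k$ and $\alpha_i(h)=2$ for all other $i$. In the realization $\mathfrak{g}=\mathfrak{so}_{2r}$ this is the nilpotent orbit with Jordan type $[2r-2k-1,2k+1]$. Sum of multisets: multiplicities are added, e.g. the sum of $[4,2,2,2,1,1]$ and $[5,4,2,2]$ is $[5,4,4,2,2,2,2,2,1,1]$. *)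

theory Defs
  imports Complex_Main "HOL-Library.Multiset" "HOL-Library.Nonpos_Ints"
begin

locale complex_lie_algebra = vector_space scale
  for scale :: "complex \<Rightarrow> 'g::ab_group_add \<Rightarrow> 'g" (infixr "*\<^sub>C" 75) +
  fixes bracket :: "'g \<Rightarrow> 'g \<Rightarrow> 'g"
  assumes finite_dimensional: "\<exists>B. finite B \<and> span B = UNIV"
    and bracket_add_left: "bracket (x + y) z = bracket x z + bracket y z"
    and bracket_add_right: "bracket x (y + z) = bracket x y + bracket x z"
    and bracket_scale_left: "bracket (c *\<^sub>C x) y = c *\<^sub>C bracket x y"
    and bracket_scale_right: "bracket x (c *\<^sub>C y) = c *\<^sub>C bracket x y"
    and bracket_self: "bracket x x = 0"
    and jacobi: "bracket x (bracket y z) + bracket y (bracket z x) + bracket z (bracket x y) = 0"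
begin

definition lie_ideal :: "'g set \<Rightarrow> bool" where
  "lie_ideal I \<longleftrightarrow> subspace I \<and> (\<forall>x. \<forall>y\<in>I. bracket x y \<in> I)"

definition ad_nilpotent :: "'g \<Rightarrow> bool" where
  "ad_nilpotent x \<longleftrightarrow> (\<exists>m. \<forall>y. (bracket x ^^ m) y = 0)"

definition ad_diagonalizable :: "'g \<Rightarrow> bool" where
  "ad_diagonalizable x \<longleftrightarrow> span {v. \<exists>c. bracket x v = c *\<^sub>C v} = UNIV"

definition centralizer :: "'g set \<Rightarrow> 'g set" where
  "centralizer H = {x. \<forall>t\<in>H. bracket t x = 0}"

text \<open>Cartan subalgebras of a semisimple complex Lie algebra: commutative subalgebras of
  semisimple elements that coincide with their own centralizer (commutativity is part of
  the last condition).\<close>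

definition cartan_subalgebra :: "'g set \<Rightarrow> bool" where
  "cartan_subalgebra H \<longleftrightarrow>
     subspace H \<and> (\<forall>t\<in>H. ad_diagonalizable t) \<and> centralizer H = H"

text \<open>Linear forms on \<open>H\<close> are represented by functions on the whole type that vanish off
  \<open>H\<close>, so that equality and pointwise linear combinations have their usual meaning.\<close>

definition dual :: "'g set \<Rightarrow> ('g \<Rightarrow> complex) set" where
  "dual H = {\<phi>. (\<forall>s\<in>H. \<forall>t\<in>H. \<phi> (s + t) = \<phi> s + \<phi> t) \<and>
                 (\<forall>c. \<forall>t\<in>H. \<phi> (c *\<^sub>C t) = c * \<phi> t) \<and> (\<forall>x. x \<notin> H \<longrightarrow> \<phi> x = 0)}"

definition root_space :: "'g set \<Rightarrow> ('g \<Rightarrow> complex) \<Rightarrow> 'g set" where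
  "root_space H \<phi> = {x. \<forall>t\<in>H. bracket t x = \<phi> t *\<^sub>C x}"

definition roots :: "'g set \<Rightarrow> ('g \<Rightarrow> complex) set" where
  "roots H = {\<phi> \<in> dual H. \<phi> \<noteq> (\<lambda>_. 0) \<and> root_space H \<phi> \<noteq> {0}}"

text \<open>The coroot of \<open>\<phi>\<close> is the unique element of \<open>[\<gg>\<^sub>\<phi>, \<gg>\<^sub>-\<^sub>\<phi>]\<close> on which \<open>\<phi>\<close> takes the
  value 2.\<close>

definition coroot :: "'g set \<Rightarrow> ('g \<Rightarrow> complex) \<Rightarrow> 'g" where
  "coroot H \<phi> = (THE t. t \<in> span {bracket x y | x y. x \<in> root_space H \<phi> \<and>
                              y \<in> root_space H (\<lambda>s. - \<phi> s)} \<and> \<phi> t = 2)"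

definition cartan_integer :: "'g set \<Rightarrow> ('g \<Rightarrow> complex) \<Rightarrow> ('g \<Rightarrow> complex) \<Rightarrow> complex" where
  "cartan_integer H \<phi> \<psi> = \<phi> (coroot H \<psi>)"

definition nonneg_combination :: "nat \<Rightarrow> (nat \<Rightarrow> 'g \<Rightarrow> complex) \<Rightarrow> ('g \<Rightarrow> complex) \<Rightarrow> bool" where
  "nonneg_combination r \<alpha> \<phi> \<longleftrightarrow>
     (\<exists>c :: nat \<Rightarrow> nat. \<phi> = (\<lambda>t. \<Sum>i = 1..r. of_nat (c i) * \<alpha> i t))"

text \<open>\<open>\<alpha> 1, \<dots>, \<alpha> r\<close> are the simple roots for a choice of positive roots.\<close>

definition simple_roots :: "'g set \<Rightarrow> nat \<Rightarrow> (nat \<Rightarrow> 'g \<Rightarrow> complex) \<Rightarrow> bool" where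
  "simple_roots H r \<alpha> \<longleftrightarrow>
     (\<forall>i\<in>{1..r}. \<alpha> i \<in> roots H) \<and>
     (\<forall>c. (\<lambda>t. \<Sum>i = 1..r. c i * \<alpha> i t) = (\<lambda>_. 0) \<longrightarrow> (\<forall>i\<in>{1..r}. c i = 0)) \<and>
     (\<forall>\<phi>\<in>roots H. nonneg_combination r \<alpha> \<phi> \<or> nonneg_combination r \<alpha> (\<lambda>t. - \<phi> t))"

definition positive_roots :: "'g set \<Rightarrow> nat \<Rightarrow> (nat \<Rightarrow> 'g \<Rightarrow> complex) \<Rightarrow> ('g \<Rightarrow> complex) set" where
  "positive_roots H r \<alpha> = {\<phi> \<in> roots H. nonneg_combination r \<alpha> \<phi>}"

text \<open>In a Dynkin diagram the nodes \<open>i \<noteq> j\<close> are joined by \<open>a\<^sub>i\<^sub>j a\<^sub>j\<^sub>i\<close> edges, where \<open>a\<close> is the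
  Cartan matrix.  The diagram \<open>D\<^sub>r\<close> has the single edges \<open>1 - 3\<close>, \<open>2 - 3\<close> and \<open>i - (i+1)\<close>
  for \<open>3 \<le> i < r\<close>.\<close>

definition D_edge :: "nat \<Rightarrow> nat \<Rightarrow> bool" where
  "D_edge i j \<longleftrightarrow> (i = 1 \<and> j = 3) \<or> (i = 2 \<and> j = 3) \<or> (3 \<le> i \<and> j = i + 1)"

definition D_labelled :: "'g set \<Rightarrow> nat \<Rightarrow> (nat \<Rightarrow> 'g \<Rightarrow> complex) \<Rightarrow> bool" where
  "D_labelled H r \<alpha> \<longleftrightarrow>
     (\<forall>i\<in>{1..r}. \<forall>j\<in>{1..r}. i \<noteq> j \<longrightarrow>
        cartan_integer H (\<alpha> i) (\<alpha> j) * cartan_integer H (\<alpha> j) (\<alpha> i) =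
          (if D_edge i j \<or> D_edge j i then 1 else 0))"

definition of_type_D :: "nat \<Rightarrow> bool" where
  "of_type_D r \<longleftrightarrow>
     (\<exists>H \<alpha>. cartan_subalgebra H \<and> simple_roots H r \<alpha> \<and> D_labelled H r \<alpha>)"

definition sl2_triple :: "'g \<Rightarrow> 'g \<Rightarrow> 'g \<Rightarrow> bool" where
  "sl2_triple e h f \<longleftrightarrow>
     bracket h e = 2 *\<^sub>C e \<and> bracket h f = (-2) *\<^sub>C f \<and> bracket e f = h"

definition nilpotent_of_type_D_a :: "nat \<Rightarrow> nat \<Rightarrow> 'g \<Rightarrow> bool" where
  "nilpotent_of_type_D_a r k e \<longleftrightarrow>
     ad_nilpotent e \<and>
     (\<exists>h f H \<alpha>. sl2_triple e h f \<and> cartan_subalgebra H \<and> h \<in> H \<and>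
        simple_roots H r \<alpha> \<and> (\<forall>\<phi>\<in>positive_roots H r \<alpha>. \<phi> h \<in> \<real>\<^sub>\<ge>\<^sub>0) \<and>
        D_labelled H r \<alpha> \<and>
        (\<forall>i\<in>{1..r}. \<alpha> i h = (if \<exists>m. 0 < m \<and> m \<le> k \<and> i = 2 * m + 1 then 0 else 2)))"

definition sl2_submodule :: "'g \<Rightarrow> 'g \<Rightarrow> 'g \<Rightarrow> 'g set \<Rightarrow> bool" where
  "sl2_submodule e h f V \<longleftrightarrow>
     subspace V \<and> (\<forall>v\<in>V. bracket e v \<in> V \<and> bracket h v \<in> V \<and> bracket f v \<in> V)"

definition sl2_irreducible :: "'g \<Rightarrow> 'g \<Rightarrow> 'g \<Rightarrow> 'g set \<Rightarrow> bool" where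
  "sl2_irreducible e h f V \<longleftrightarrow>
     sl2_submodule e h f V \<and> V \<noteq> {0} \<and>
     (\<forall>U. sl2_submodule e h f U \<and> U \<subseteq> V \<longrightarrow> U = {0} \<or> U = V)"

text \<open>The whole space is the internal direct sum of \<open>V 1, \<dots>, V n\<close>.\<close>

definition direct_decomposition :: "nat \<Rightarrow> (nat \<Rightarrow> 'g set) \<Rightarrow> bool" where
  "direct_decomposition n V \<longleftrightarrow>
     (\<forall>x. \<exists>v. (\<forall>i\<in>{1..n}. v i \<in> V i) \<and> x = (\<Sum>i = 1..n. v i)) \<and>
     (\<forall>v. (\<forall>i\<in>{1..n}. v i \<in> V i) \<and> (\<Sum>i = 1..n. v i) = 0 \<longrightarrow> (\<forall>i\<in>{1..n}. v i = 0))"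

text \<open>\<open>W\<close> is the multiset \<open>[\<eta>\<^sub>1, \<dots>, \<eta>\<^sub>n]\<close>, with \<open>dim (V i) = 2 \<eta>\<^sub>i + 1\<close>, arising from some
  \<open>sl\<^sub>2\<close>-triple through \<open>e\<close> and some decomposition into irreducible submodules.  (Then \<open>n\<close> is
  the dimension of the kernel of \<open>bracket e\<close>, which need not be imposed.)  That there is exactly
  one such \<open>W\<close> is not built into the definition.\<close>

definition is_weight_partition :: "'g \<Rightarrow> rat multiset \<Rightarrow> bool" where
  "is_weight_partition e W \<longleftrightarrow>
     (\<exists>h f n V. sl2_triple e h f \<and> direct_decomposition n V \<and>
        (\<forall>i\<in>{1..n}. sl2_irreducible e h f (V i)) \<and>
        W = image_mset (\<lambda>i. (of_nat (dim (V i)) - 1) / 2) (mset_set {1..n}))"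

end

locale complex_simple_lie_algebra = complex_lie_algebra scale bracket
  for scale :: "complex \<Rightarrow> 'g::ab_group_add \<Rightarrow> 'g" and bracket :: "'g \<Rightarrow> 'g \<Rightarrow> 'g" +
  assumes nonabelian: "\<exists>x y. bracket x y \<noteq> 0"
    and no_proper_ideals: "lie_ideal I \<Longrightarrow> I = {0} \<or> I = UNIV"

text \<open>In natural numbers \<open>2 * k - 1\<close> is \<open>0\<close> for \<open>k = 0\<close>, so the second multiset below is then
  empty, as it should be; the other bounds are positive whenever \<open>k < r div 2\<close>.\<close>

definition weights_D_a :: "nat \<Rightarrow> nat \<Rightarrow> rat multiset" where
  "weights_D_a r k = image_mset of_nat
     (mset_set {j. odd j \<and> j \<le> 2 * r - 2 * k - 3} +
      mset_set {j. odd j \<and> j \<le> 2 * k - 1} +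
      mset_set {r - 2 * k - 1..r - 1})"

end

theory Submission
  imports Defs
begin

text \<open>The proof has three parts.

  \<^bold>\<open>The weight partition is read off from the multiplicities of the weights of \<open>h\<close>.\<close>  In an
  \<open>sl\<^sub>2\<close>-module the number of irreducible summands of highest weight at least \<open>m\<close> is the dimension of
  \<open>ker E \<inter> im E\<^sup>m\<close> (\<open>card_long_strings\<close>).  This does not mention \<open>H\<close> and \<open>F\<close>, so all
  \<open>sl\<^sub>2\<close>-triples through \<open>e\<close> and all decompositions give the same multiset.  When \<open>H\<close> is
  diagonalizable, a decomposition exists (\<open>string_decomposition_exists\<close>), and if all weights are even,
  the number of summands with \<open>\<eta> \<ge> m\<close> is the multiplicity of the weight \<open>2 m\<close>.  So it suffices to
  know the eigenvalue multiplicities of \<open>ad h\<close> for the one \<open>h\<close> that lies in the Cartan subalgebra.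

  \<^bold>\<open>The roots are those of \<open>so\<^sub>2\<^sub>r\<close>.\<close>  The trace form \<open>\<kappa>\<close> is nondegenerate: its
  radical is an ideal, and \<open>\<kappa>(h, h)\<close> is the sum of the squares of the weights of \<open>h\<close>, which are
  integers and not all zero (\<open>nondegenerate_form_exists\<close>).  As usual this gives coroots with their
  \<open>sl\<^sub>2\<close>-triples, one-dimensional root spaces, reflections, and the Cartan matrix.  With coordinates
  \<open>\<epsilon>\<^sub>1, \<dots>, \<epsilon>\<^sub>r\<close> and \<open>\<epsilon>\<^sub>-\<^sub>s = - \<epsilon>\<^sub>s\<close> the simple reflections permute the forms \<open>\<epsilon>\<^sub>s\<close>.  Descent
  by height shows that every root is some \<open>\<epsilon>\<^sub>s + \<epsilon>\<^sub>t\<close> with \<open>s \<noteq> \<plusminus>t\<close> (\<open>root_wt\<close>), and reflecting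
  simple roots shows that all these are roots (\<open>wt_root\<close>).  The pairs \<open>{-i, i}\<close> have weight zero and
  serve to index a basis of the Cartan subalgebra, so that the algebra has a basis of weight vectors
  indexed by all two-element sets \<open>{s, t}\<close>, with weights \<open>\<epsilon>\<^sub>s + \<epsilon>\<^sub>t\<close>.  This is the decomposition
  of the exterior square of the vector representation, without the representation itself.

  \<^bold>\<open>Counting.\<close>  Let \<open>a = r - k - 1\<close> and \<open>b = k\<close>.  The weighted diagram forces the numbers
  \<open>\<epsilon>\<^sub>s(h) / 2\<close> to be \<open>-a, \<dots>, a\<close> together with \<open>-b, \<dots>, b\<close>: two strings, of lengths \<open>2 r - 2 k - 1\<close>
  and \<open>2 k + 1\<close>.  Pairs inside the first string contribute the weights \<open>1, 3, \<dots>, 2 a - 1\<close> to the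
  partition, pairs inside the second \<open>1, 3, \<dots>, 2 b - 1\<close>, and pairs with one member in each
  \<open>a - b, \<dots>, a + b\<close> (\<open>card_pairs_by_multiplicity\<close>).\<close>

section \<open>Eigenvectors and families of vectors\<close>

locale complex_vector_space = vector_space scale
  for scale :: "complex \<Rightarrow> 'g::ab_group_add \<Rightarrow> 'g" (infixr "*\<^sub>C" 75) +
  assumes finite_spanning: "\<exists>B. finite B \<and> span B = UNIV"
begin

text \<open>The dimension theory of vector spaces is developed relative to a fixed finite basis; an arbitrary
  choice makes it available.\<close>

definition some_basis :: "'g set" where
  "some_basis = (SOME B. finite B \<and> independent B \<and> span B = UNIV)"

lemma some_basis: "finite some_basis \<and> independent some_basis \<and> span some_basis = UNIV"
proof -
  obtain S where S: "finite S" "span S = UNIV"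
    using finite_spanning by blast
  obtain B where B: "B \<subseteq> S" "independent B" "S \<subseteq> span B"
    using maximal_independent_subset by blast
  have "finite B" using B(1) S(1) finite_subset by blast
  moreover have "span B = UNIV"
    using B(3) S(2) span_mono[of S "span B"] span_span[of B] by auto
  ultimately show ?thesis
    unfolding some_basis_def using B(2) by (intro someI) blast
qed

sublocale finite_dimensional_vector_space scale some_basis
  by unfold_locales (use some_basis in auto)

sublocale endo: finite_dimensional_vector_space_pair scale some_basis scale some_basis
  ..

abbreviation linear_op :: "('g \<Rightarrow> 'g) \<Rightarrow> bool" where
  "linear_op \<equiv> Vector_Spaces.linear scale scale"

lemma linear_opI:
  assumes "\<And>x y. T (x + y) = T x + T y" and "\<And>c x. T (c *\<^sub>C x) = c *\<^sub>C T x"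
  shows "linear_op T"
  using assms by unfold_locales auto

lemma linear_op_funpow: "linear_op T \<Longrightarrow> linear_op (T ^^ n)"
proof (induction n)
  case 0
  show ?case by (rule linear_opI) auto
next
  case (Suc n)
  then show ?case
    by (intro linear_opI) (auto simp: endo.linear_add endo.linear_scale)
qed

text \<open>The operator \<open>T s - w k s\<close> removes the summand \<open>v k\<close> and rescales the others, but \<open>s\<close> has to be
  chosen anew for each summand that is to be separated from \<open>v k\<close>.  Eigenvectors of one operator and
  simultaneous eigenvectors of a commuting family are both instances.\<close>

lemma weight_vectors_sum_zero:
  fixes T :: "'s \<Rightarrow> 'g \<Rightarrow> 'g" and w :: "'i \<Rightarrow> 's \<Rightarrow> complex"
  assumes lin: "\<And>s. s \<in> S \<Longrightarrow> linear_op (T s)"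
    and "finite I"
    and "\<And>i s. i \<in> I \<Longrightarrow> s \<in> S \<Longrightarrow> T s (v i) = w i s *\<^sub>C v i"
    and "\<And>i j. i \<in> I \<Longrightarrow> j \<in> I \<Longrightarrow> i \<noteq> j \<Longrightarrow> \<exists>s\<in>S. w i s \<noteq> w j s"
    and "(\<Sum>i\<in>I. v i) = 0"
  shows "\<forall>i\<in>I. v i = 0"
  using assms(2-)
proof (induction I arbitrary: v rule: finite_induct)
  case empty
  then show ?case by simp
next
  case (insert k I)
  have zero: "v i = 0" if i: "i \<in> I" for i
  proof -
    obtain s where s: "s \<in> S" "w i s \<noteq> w k s"
      using insert.prems(2)[of i k] i insert.hyps by auto
    define u where "u j = (w j s - w k s) *\<^sub>C v j" for j
    have "(\<Sum>j\<in>insert k I. u j) = T s (\<Sum>j\<in>insert k I. v j) - w k s *\<^sub>C (\<Sum>j\<in>insert k I. v j)"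
      unfolding endo.linear_sum[OF lin[OF s(1)]] scale_sum_right sum_subtractf[symmetric]
      by (rule sum.cong) (use insert.prems(1) s(1) in \<open>auto simp: u_def scale_left_diff_distrib\<close>)
    then have "(\<Sum>j\<in>insert k I. u j) = 0"
      using insert.prems(3) endo.linear_0[OF lin[OF s(1)]] by simp
    moreover have "u k = 0" by (simp add: u_def)
    ultimately have sum0: "(\<Sum>j\<in>I. u j) = 0"
      using insert.hyps by simp
    have "\<forall>j\<in>I. u j = 0"
    proof (rule insert.IH)
      fix j t assume "j \<in> I" "t \<in> S"
      then show "T t (u j) = w j t *\<^sub>C u j"
        using insert.prems(1)[of j t]
        by (simp add: u_def endo.linear_scale[OF lin] mult.commute)
    qed (use insert.prems(2) sum0 in auto)
    then show ?thesis using i s(2) by (auto simp: u_def)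
  qed
  then have "v k = 0" using insert.prems(3) insert.hyps by simp
  then show ?case using zero by auto
qed

text \<open>Independence of a family, rather than of a set, so that bases can be given by formulas in their
  indices, without first showing that different indices give different vectors.\<close>

definition indep_family :: "'i set \<Rightarrow> ('i \<Rightarrow> 'g) \<Rightarrow> bool" where
  "indep_family I b \<longleftrightarrow> (\<forall>a. (\<Sum>i\<in>I. a i *\<^sub>C b i) = 0 \<longrightarrow> (\<forall>i\<in>I. a i = 0))"

lemma indep_familyD:
  assumes "indep_family I b" "(\<Sum>i\<in>I. a i *\<^sub>C b i) = 0" "i \<in> I"
  shows "a i = 0"
  using assms unfolding indep_family_def by blast

lemma indep_family_subset:
  assumes "indep_family I b" "J \<subseteq> I" "finite I"
  shows "indep_family J b"
  unfolding indep_family_def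
proof (intro allI impI ballI)
  fix a i assume a: "(\<Sum>i\<in>J. a i *\<^sub>C b i) = 0" and i: "i \<in> J"
  have "(\<Sum>i\<in>I. (if i \<in> J then a i else 0) *\<^sub>C b i) = (\<Sum>i\<in>J. a i *\<^sub>C b i)"
    by (rule sum.mono_neutral_cong_right) (use assms in auto)
  with a have "(if i \<in> J then a i else 0) = 0"
    using indep_familyD[OF assms(1), of "\<lambda>i. if i \<in> J then a i else 0" i] i assms(2) by auto
  then show "a i = 0" using i by simp
qed

lemma indep_family_imp:
  assumes "finite I" "indep_family I b"
  shows "inj_on b I" "independent (b ` I)"
proof -
  show inj: "inj_on b I"
  proof (rule inj_onI, rule ccontr)
    fix i j assume ij: "i \<in> I" "j \<in> I" "b i = b j" "i \<noteq> j"
    have "(\<Sum>k\<in>I. (if k = i then 1 else if k = j then -1 else 0) *\<^sub>C b k)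
        = (\<Sum>k\<in>{i, j}. (if k = i then 1 else if k = j then -1 else 0) *\<^sub>C b k)"
      by (rule sum.mono_neutral_right) (use ij assms in auto)
    also have "\<dots> = 0" using ij by simp
    finally show False
      using indep_familyD[OF assms(2), of "\<lambda>k. if k = i then 1 else if k = j then -1 else 0" i] ij
      by simp
  qed
  show "independent (b ` I)"
    unfolding independent_explicit
  proof (intro conjI allI impI ballI)
    fix c v assume "(\<Sum>v\<in>b ` I. c v *\<^sub>C v) = 0" "v \<in> b ` I"
    moreover have "(\<Sum>v\<in>b ` I. c v *\<^sub>C v) = (\<Sum>i\<in>I. c (b i) *\<^sub>C b i)"
      using inj by (simp add: sum.reindex)
    ultimately show "c v = 0"
      using indep_familyD[OF assms(2), of "\<lambda>i. c (b i)"] by auto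
  qed (use assms in auto)
qed

lemma indep_family_if_independent:
  assumes "inj_on b I" "independent (b ` I)"
  shows "indep_family I b"
  unfolding indep_family_def
proof (intro allI impI ballI)
  fix a i assume a: "(\<Sum>i\<in>I. a i *\<^sub>C b i) = 0" and i: "i \<in> I"
  have "(\<Sum>v\<in>b ` I. a (inv_into I b v) *\<^sub>C v) = (\<Sum>i\<in>I. a i *\<^sub>C b i)"
    by (subst sum.reindex[OF assms(1)]) (simp add: inv_into_f_f[OF assms(1)])
  with a have "a (inv_into I b v) = 0" if "v \<in> b ` I" for v
    using assms(2) that unfolding independent_explicit by auto
  from this[of "b i"] i show "a i = 0" by (simp add: inv_into_f_f[OF assms(1)])
qed

lemma span_image_finite:
  assumes "finite I"
  shows "v \<in> span (b ` I) \<longleftrightarrow> (\<exists>a. v = (\<Sum>i\<in>I. a i *\<^sub>C b i))"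
proof
  assume "v \<in> span (b ` I)"
  then show "\<exists>a. v = (\<Sum>i\<in>I. a i *\<^sub>C b i)"
  proof (induction rule: span_induct_alt)
    case base
    show ?case by (rule exI[of _ "\<lambda>_. 0"]) simp
  next
    case (step c x y)
    obtain a i where a: "y = (\<Sum>i\<in>I. a i *\<^sub>C b i)" and i: "i \<in> I" "x = b i"
      using step by auto
    have "(\<Sum>j\<in>I. (if j = i then c else 0) *\<^sub>C b j) = (\<Sum>j\<in>{i}. c *\<^sub>C b j)"
      by (rule sum.mono_neutral_cong_right) (use assms i in auto)
    then have "c *\<^sub>C x + y = (\<Sum>j\<in>I. ((if j = i then c else 0) + a j) *\<^sub>C b j)"
      using i a by (simp add: scale_left_distrib sum.distrib)
    then show ?case by (rule exI[of _ "\<lambda>j. (if j = i then c else 0) + a j"])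
  qed
qed (auto intro!: span_sum span_scale intro: span_base)

lemma indep_family_of_weights:
  assumes "linear_op T" "finite I" "inj_on c I"
    and "\<And>i. i \<in> I \<Longrightarrow> T (v i) = c i *\<^sub>C v i" "\<And>i. i \<in> I \<Longrightarrow> v i \<noteq> 0"
  shows "indep_family I v"
  unfolding indep_family_def
proof (intro allI impI ballI)
  fix a i assume a: "(\<Sum>i\<in>I. a i *\<^sub>C v i) = 0" and i: "i \<in> I"
  have "\<forall>i\<in>I. a i *\<^sub>C v i = 0"
    by (rule weight_vectors_sum_zero[where T = "\<lambda>_::unit. T" and S = UNIV and w = "\<lambda>i _. c i"])
      (use assms a in \<open>auto simp: endo.linear_scale inj_on_def mult.commute\<close>)
  then show "a i = 0" using i assms(5) by auto
qed

lemma indep_family_card_le: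
  assumes "finite I" "indep_family I b" shows "card I \<le> dim UNIV"
  using indep_family_imp[OF assms] card_image[of b I] independent_card_le_dim[of "b ` I" UNIV]
  by simp

text \<open>In this form finite dimensionality makes raising and lowering operators terminate on weight
  vectors.\<close>

lemma weight_sequence_vanishes:
  fixes v :: "nat \<Rightarrow> 'g"
  assumes "linear_op T" "inj c" "\<And>n. T (v n) = c n *\<^sub>C v n"
  shows "\<exists>n. v n = 0"
proof (rule ccontr)
  assume "\<nexists>n. v n = 0"
  then have "indep_family {..dim (UNIV :: 'g set)} v"
    by (intro indep_family_of_weights[where T = T and c = c])
      (use assms in \<open>auto intro: inj_on_subset\<close>)
  from indep_family_card_le[OF _ this] show False by simp
qed

text \<open>In coordinates with respect to an eigenbasis, \<open>T v = \<mu> v\<close> says that all coefficients vanish at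
  eigenvalues other than \<open>\<mu>\<close>.\<close>

lemma dim_eigenspace:
  assumes T: "linear_op T" and fin: "finite I" and ind: "indep_family I b"
    and span: "span (b ` I) = UNIV" and eig: "\<And>i. i \<in> I \<Longrightarrow> T (b i) = c i *\<^sub>C b i"
  shows "dim {v. T v = \<mu> *\<^sub>C v} = card {i\<in>I. c i = \<mu>}"
proof -
  let ?J = "{i\<in>I. c i = \<mu>}"
  have finJ: "finite ?J" using fin by simp
  have indJ: "indep_family ?J b" by (rule indep_family_subset[OF ind _ fin]) auto
  show ?thesis
  proof (rule dim_unique)
    show "b ` ?J \<subseteq> {v. T v = \<mu> *\<^sub>C v}" using eig by auto
    show "independent (b ` ?J)" using indep_family_imp(2)[OF finJ indJ] .
    show "card (b ` ?J) = card ?J" using indep_family_imp(1)[OF finJ indJ] by (rule card_image)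
    show "{v. T v = \<mu> *\<^sub>C v} \<subseteq> span (b ` ?J)"
    proof
      fix v assume "v \<in> {v. T v = \<mu> *\<^sub>C v}"
      then have v: "T v = \<mu> *\<^sub>C v" by simp
      obtain a where a: "v = (\<Sum>i\<in>I. a i *\<^sub>C b i)"
        using span span_image_finite[OF fin, of v b] by auto
      have "T v - \<mu> *\<^sub>C v = (\<Sum>i\<in>I. (a i * (c i - \<mu>)) *\<^sub>C b i)"
        unfolding a endo.linear_sum[OF T] scale_sum_right sum_subtractf[symmetric]
        by (rule sum.cong)
          (auto simp: endo.linear_scale[OF T] eig scale_left_diff_distrib algebra_simps)
      with v have "(\<Sum>i\<in>I. (a i * (c i - \<mu>)) *\<^sub>C b i) = 0" by simp
      from indep_familyD[OF ind this] have "a i = 0 \<or> c i = \<mu>" if "i \<in> I" for i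
        using that by auto
      then have "v = (\<Sum>i\<in>?J. a i *\<^sub>C b i)"
        unfolding a by (intro sum.mono_neutral_right) (use fin in auto)
      then show "v \<in> span (b ` ?J)" using span_image_finite[OF finJ] by blast
    qed
  qed
qed

lemma injective_on_subspace_imp_surjective:
  assumes T: "linear_op T" and X: "subspace X" and TX: "\<And>x. x \<in> X \<Longrightarrow> T x \<in> X"
    and inj: "\<And>x. x \<in> X \<Longrightarrow> T x = 0 \<Longrightarrow> x = 0" and y: "y \<in> X"
  shows "\<exists>x\<in>X. T x = y"
proof -
  have sp: "span X = X" using X by (rule span_eq_iff[THEN iffD2])
  have "inj_on T (span X)"
    unfolding sp
  proof (rule inj_onI)
    fix a b assume ab: "a \<in> X" "b \<in> X" "T a = T b"
    then have "T (a - b) = 0" by (simp add: endo.linear_diff[OF T])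
    then show "a = b" using inj[of "a - b"] subspace_diff[OF X ab(1,2)] by simp
  qed
  then have "dim (T ` X) = dim X" by (rule endo.dim_image_eq[OF T])
  moreover have "subspace (T ` X)"
    using endo.linear_subspace_image[OF T X] .
  ultimately have "T ` X = X"
    using X TX by (intro subspace_dim_equal) auto
  then show ?thesis using y by (metis imageE)
qed

end

section \<open>Modules over sl(2)\<close>

lemma least_vanishing:
  fixes T :: "'a::zero \<Rightarrow> 'a"
  assumes "\<exists>n. (T ^^ n) v = 0" "v \<noteq> 0"
  obtains n where "(T ^^ n) v \<noteq> 0" "(T ^^ Suc n) v = 0"
proof -
  define n where "n = (LEAST n. (T ^^ n) v = 0)"
  have n: "(T ^^ n) v = 0" unfolding n_def using assms(1) by (rule LeastI_ex)
  then obtain k where k: "n = Suc k" using assms(2) by (cases n) auto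
  then have "(T ^^ k) v \<noteq> 0" using not_less_Least[of k "\<lambda>n. (T ^^ n) v = 0"] by (auto simp: n_def)
  with n k show ?thesis using that by blast
qed

lemma funpow_zero_mono:
  fixes T :: "'a::zero \<Rightarrow> 'a"
  assumes "(T ^^ m) x = 0" "T 0 = 0" "m \<le> n"
  shows "(T ^^ n) x = 0"
proof -
  have z: "(T ^^ k) 0 = (0::'a)" for k
    by (induction k) (simp_all add: assms(2))
  have "(T ^^ n) x = (T ^^ (n - m)) ((T ^^ m) x)"
    using assms(3) by (metis comp_apply funpow_add le_add_diff_inverse2)
  then show ?thesis using assms(1) z by simp
qed

text \<open>With operators instead of Lie algebra elements, everything below also applies to the module
  \<open>(F, - H, E)\<close>, which exchanges highest and lowest weights (\<open>swapped\<close>).\<close>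

locale sl2_module = complex_vector_space scale
  for scale :: "complex \<Rightarrow> 'g::ab_group_add \<Rightarrow> 'g" (infixr "*\<^sub>C" 75) +
  fixes E H F :: "'g \<Rightarrow> 'g"
  assumes linear_E: "linear_op E" and linear_H: "linear_op H" and linear_F: "linear_op F"
    and HE: "H (E v) = E (H v) + 2 *\<^sub>C E v"
    and HF: "H (F v) = F (H v) - 2 *\<^sub>C F v"
    and EF: "E (F v) = F (E v) + H v"
begin

lemmas op_simps =
  endo.linear_0[OF linear_E] endo.linear_0[OF linear_H] endo.linear_0[OF linear_F]
  endo.linear_add[OF linear_E] endo.linear_add[OF linear_H] endo.linear_add[OF linear_F]
  endo.linear_diff[OF linear_E] endo.linear_diff[OF linear_H] endo.linear_diff[OF linear_F]
  endo.linear_neg[OF linear_E] endo.linear_neg[OF linear_H] endo.linear_neg[OF linear_F]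
  endo.linear_scale[OF linear_E] endo.linear_scale[OF linear_H] endo.linear_scale[OF linear_F]

lemmas E_pow_simps = endo.linear_0[OF linear_op_funpow[OF linear_E]]
  endo.linear_add[OF linear_op_funpow[OF linear_E]] endo.linear_scale[OF linear_op_funpow[OF linear_E]]
  endo.linear_sum[OF linear_op_funpow[OF linear_E]]

lemmas F_pow_simps = endo.linear_0[OF linear_op_funpow[OF linear_F]]
  endo.linear_add[OF linear_op_funpow[OF linear_F]] endo.linear_scale[OF linear_op_funpow[OF linear_F]]

lemma swapped: "sl2_module scale F (\<lambda>v. - H v) E"
proof unfold_locales
  show "- H (x + y) = - H x + - H y" for x y by (simp add: op_simps)
  show "- H (c *\<^sub>C x) = c *\<^sub>C - H x" for c x by (simp add: op_simps)
qed (simp_all add: op_simps HE HF EF)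

lemma E_weight:
  assumes "H v = c *\<^sub>C v" shows "H ((E ^^ n) v) = (c + 2 * of_nat n) *\<^sub>C (E ^^ n) v"
  by (induction n) (simp_all add: assms HE op_simps scale_left_distrib algebra_simps)

lemma F_weight:
  assumes "H v = c *\<^sub>C v" shows "H ((F ^^ n) v) = (c - 2 * of_nat n) *\<^sub>C (F ^^ n) v"
proof (induction n)
  case (Suc n)
  have "H (F ((F ^^ n) v)) = (c - 2 * of_nat n) *\<^sub>C F ((F ^^ n) v) - 2 *\<^sub>C F ((F ^^ n) v)"
    by (simp add: HF Suc op_simps)
  also have "\<dots> = (c - 2 * of_nat n - 2) *\<^sub>C F ((F ^^ n) v)"
    by (simp only: scale_left_diff_distrib)
  finally show ?case by (simp add: algebra_simps)
qed (simp add: assms)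

lemma E_F_pow:
  assumes v: "H v = c *\<^sub>C v"
  shows "E ((F ^^ Suc n) v) = (F ^^ Suc n) (E v) + (of_nat (Suc n) * (c - of_nat n)) *\<^sub>C (F ^^ n) v"
proof (induction n)
  case 0
  show ?case by (simp add: EF v)
next
  case (Suc n)
  have "E ((F ^^ Suc (Suc n)) v) = F (E ((F ^^ Suc n) v)) + H ((F ^^ Suc n) v)"
    by (simp add: EF)
  also have "\<dots> = (F ^^ Suc (Suc n)) (E v)
      + (of_nat (Suc n) * (c - of_nat n) + (c - 2 * of_nat (Suc n))) *\<^sub>C (F ^^ Suc n) v"
    unfolding Suc F_weight[OF v] by (simp add: op_simps scale_left_distrib add.assoc)
  also have "of_nat (Suc n) * (c - of_nat n) + (c - 2 * of_nat (Suc n))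
      = of_nat (Suc (Suc n)) * (c - of_nat (Suc n))"
    by (simp add: algebra_simps)
  finally show ?case .
qed

lemma E_pow_H: "H ((E ^^ n) v) = (E ^^ n) (H v) + (2 * of_nat n) *\<^sub>C (E ^^ n) v"
proof (induction n)
  case (Suc n)
  have "H (E ((E ^^ n) v)) = E ((E ^^ n) (H v)) + ((2 * of_nat n) *\<^sub>C E ((E ^^ n) v) + 2 *\<^sub>C E ((E ^^ n) v))"
    by (simp add: HE Suc op_simps add.assoc)
  also have "(2 * of_nat n) *\<^sub>C E ((E ^^ n) v) + 2 *\<^sub>C E ((E ^^ n) v) = (2 * of_nat n + 2) *\<^sub>C E ((E ^^ n) v)"
    by (simp only: scale_left_distrib)
  finally show ?case by (simp add: algebra_simps)
qed simp

text \<open>Here \<open>v\<close> is arbitrary.  This is the identity that produces a highest weight vector when \<open>H\<close> is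
  not known to have any eigenvector.\<close>

lemma E_pow_F:
  "(E ^^ Suc n) (F v) = F ((E ^^ Suc n) v) + of_nat (Suc n) *\<^sub>C (E ^^ n) (H v + of_nat n *\<^sub>C v)"
proof (induction n)
  case 0
  show ?case by (simp add: EF)
next
  case (Suc n)
  have combine: "f + (x + a *\<^sub>C y) + b *\<^sub>C (x + m *\<^sub>C y) = f + ((1 + b) *\<^sub>C x + (a + b * m) *\<^sub>C y)"
    for f x y :: 'g and a b m :: complex
    by (simp add: scale_left_distrib scale_right_distrib algebra_simps)
  let ?x = "(E ^^ Suc n) (H v)" and ?y = "(E ^^ Suc n) v"
  have "(E ^^ Suc (Suc n)) (F v) = E ((E ^^ Suc n) (F v))" by simp
  also have "\<dots> = F (E ?y) + H ?y + of_nat (Suc n) *\<^sub>C (?x + of_nat n *\<^sub>C ?y)"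
    unfolding Suc
    by (simp add: op_simps EF E_pow_simps)
  also have "H ?y = ?x + (2 * of_nat (Suc n)) *\<^sub>C ?y" by (rule E_pow_H)
  also have "F (E ?y) + (?x + (2 * of_nat (Suc n)) *\<^sub>C ?y) + of_nat (Suc n) *\<^sub>C (?x + of_nat n *\<^sub>C ?y)
     = F (E ?y) + ((1 + of_nat (Suc n)) *\<^sub>C ?x + (2 * of_nat (Suc n) + of_nat (Suc n) * of_nat n) *\<^sub>C ?y)"
    by (rule combine)
  also have "(1 + of_nat (Suc n)) *\<^sub>C ?x + (2 * of_nat (Suc n) + of_nat (Suc n) * of_nat n) *\<^sub>C ?y
     = of_nat (Suc (Suc n)) *\<^sub>C (E ^^ Suc n) (H v + of_nat (Suc n) *\<^sub>C v)"
  proof -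
    have c: "1 + of_nat (Suc n) = (of_nat (Suc (Suc n)) :: complex)"
      "2 * of_nat (Suc n) + of_nat (Suc n) * of_nat n = of_nat (Suc (Suc n)) * (of_nat (Suc n) :: complex)"
      by (simp_all add: algebra_simps)
    show ?thesis
      unfolding c E_pow_simps
        scale_right_distrib scale_scale ..
  qed
  finally show ?case by simp
qed

lemma E_pow_vanishes:
  assumes v: "H v = c *\<^sub>C v" shows "\<exists>n. (E ^^ n) v = 0"
proof (rule weight_sequence_vanishes[OF linear_H])
  show "inj (\<lambda>n. c + 2 * of_nat n)" by (auto simp: inj_def)
qed (rule E_weight[OF v])

lemma F_pow_vanishes:
  assumes v: "H v = c *\<^sub>C v" shows "\<exists>n. (F ^^ n) v = 0"
proof (rule weight_sequence_vanishes[OF linear_H])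
  show "inj (\<lambda>n. c - 2 * of_nat n)" by (auto simp: inj_def)
qed (rule F_weight[OF v])

text \<open>If \<open>v \<noteq> 0\<close>, then \<open>E v \<noteq> 0\<close> is again an eigenvector of \<open>FE\<close>, with an eigenvalue that is smaller
  still, because \<open>FE = EF - H\<close> and the weight of \<open>E v\<close> is positive.  So \<open>E\<^sup>n v\<close> would never vanish.
  The injectivity statements below all rest on this fact.\<close>

lemma FE_eigenvalue_not_negative:
  assumes v: "H v = of_nat m *\<^sub>C v" "F (E v) = - of_nat c *\<^sub>C v" "0 < c"
  shows "v = 0"
proof -
  have key: "\<exists>c>0. F (E ((E ^^ n) v)) = - of_nat c *\<^sub>C (E ^^ n) v" for n
  proof (induction n)
    case 0
    show ?case using v by auto
  next
    case (Suc n)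
    then obtain c where c: "c > 0" "F (E ((E ^^ n) v)) = - of_nat c *\<^sub>C (E ^^ n) v" by blast
    let ?z = "(E ^^ Suc n) v"
    have "F (E ?z) = E (F ?z) - H ?z" by (simp add: EF)
    also have "E (F ?z) = - of_nat c *\<^sub>C ?z" using c(2) by (simp add: op_simps)
    also have "H ?z = (of_nat m + 2 * of_nat (Suc n)) *\<^sub>C ?z" by (rule E_weight[OF v(1)])
    also have "- of_nat c *\<^sub>C ?z - (of_nat m + 2 * of_nat (Suc n)) *\<^sub>C ?z
        = - of_nat (c + (m + 2 * Suc n)) *\<^sub>C ?z"
      by (simp only: scale_left_diff_distrib[symmetric]) (simp add: algebra_simps)
    finally show ?case using c(1) by (intro exI[of _ "c + (m + 2 * Suc n)"]) simp
  qed
  obtain n where "(E ^^ n) v = 0" using E_pow_vanishes[OF v(1)] by blast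
  then show "v = 0"
  proof (induction n)
    case (Suc n)
    obtain c where "c > 0" "F (E ((E ^^ n) v)) = - of_nat c *\<^sub>C (E ^^ n) v"
      using key[of n] by blast
    moreover have "F (E ((E ^^ n) v)) = 0" using Suc.prems by (simp add: op_simps)
    ultimately have "(E ^^ n) v = 0" by simp
    then show ?case by (rule Suc.IH)
  qed simp
qed

text \<open>\<open>E F\<^sup>j\<^sup>+\<^sup>1 v = F\<^sup>j (FE + c) v\<close> with \<open>c = (j + 1)(m - j) > 0\<close>, and \<open>FE + c\<close> is injective on the weight
  space, so induction on \<open>j\<close> applies to \<open>(FE + c) v\<close>.\<close>

lemma F_pow_injective:
  assumes "H v = of_nat m *\<^sub>C v" "j \<le> m" "(F ^^ j) v = 0"
  shows "v = 0"
  using assms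
proof (induction j arbitrary: v)
  case (Suc j)
  define c where "c = Suc j * (m - j)"
  define u where "u = F (E v) + of_nat c *\<^sub>C v"
  have c: "0 < c" "(of_nat c :: complex) = of_nat (Suc j) * (of_nat m - of_nat j)"
    using Suc.prems(2) by (auto simp: c_def of_nat_diff of_nat_mult simp del: of_nat_Suc mult_Suc)
  have "0 = E ((F ^^ Suc j) v)" using Suc.prems(3) by (simp add: op_simps)
  also have "\<dots> = (F ^^ Suc j) (E v) + of_nat c *\<^sub>C (F ^^ j) v"
    unfolding E_F_pow[OF Suc.prems(1)] c(2) ..
  also have "\<dots> = (F ^^ j) u"
    unfolding u_def F_pow_simps
    by (simp add: funpow_swap1)
  finally have "(F ^^ j) u = 0" by simp
  moreover have "H u = of_nat m *\<^sub>C u"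
    unfolding u_def by (simp add: op_simps HF HE Suc.prems(1) scale_right_distrib algebra_simps)
  ultimately have "u = 0" using Suc.IH[of u] Suc.prems(2) by simp
  then have "F (E v) = - of_nat c *\<^sub>C v" by (simp add: u_def eq_neg_iff_add_eq_0)
  then show ?case by (rule FE_eigenvalue_not_negative[OF Suc.prems(1) _ c(1)])
qed simp

lemma EF_injective:
  assumes "H v = of_nat m *\<^sub>C v" "0 < m" "E (F v) = 0"
  shows "v = 0"
proof (rule FE_eigenvalue_not_negative[OF assms(1) _ assms(2)])
  show "F (E v) = - of_nat m *\<^sub>C v"
    using assms EF[of v] by (simp add: eq_neg_iff_add_eq_0)
qed

definition highest_weight :: "'g \<Rightarrow> nat \<Rightarrow> bool" where
  "highest_weight p l \<longleftrightarrow> p \<noteq> 0 \<and> E p = 0 \<and> H p = of_nat l *\<^sub>C p"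

text \<open>If \<open>k + 1\<close> is the first power of \<open>F\<close> that kills \<open>p\<close>, then \<open>0 = E F\<^sup>k\<^sup>+\<^sup>1 p = (k + 1)(c - k) F\<^sup>k p\<close>
  forces \<open>c = k\<close>.\<close>

lemma highest_weight_natural:
  assumes p: "p \<noteq> 0" "E p = 0" "H p = c *\<^sub>C p"
  obtains l where "c = of_nat l" "highest_weight p l" "(F ^^ Suc l) p = 0"
proof -
  obtain k where nz: "(F ^^ k) p \<noteq> 0" and k: "(F ^^ Suc k) p = 0"
    using least_vanishing[OF F_pow_vanishes[OF p(3)] p(1)] .
  have "0 = E ((F ^^ Suc k) p)" unfolding k by (simp add: op_simps)
  also have "\<dots> = (of_nat (Suc k) * (c - of_nat k)) *\<^sub>C (F ^^ k) p"
    unfolding E_F_pow[OF p(3)] by (simp add: p(2) F_pow_simps op_simps)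
  finally have "c = of_nat k" using nz by (simp del: of_nat_Suc)
  with that[of k] show ?thesis using p k by (auto simp: highest_weight_def)
qed

lemma highest_weight_F_pow:
  assumes "highest_weight p l" shows "(F ^^ Suc l) p = 0"
proof -
  from assms have "p \<noteq> 0" "E p = 0" "H p = of_nat l *\<^sub>C p" by (auto simp: highest_weight_def)
  then show ?thesis by (rule highest_weight_natural) simp
qed

lemma weight_vector_top:
  assumes v: "v \<noteq> 0" "H v = c *\<^sub>C v"
  obtains n l where "highest_weight ((E ^^ n) v) l" "c + 2 * of_nat n = of_nat l"
proof -
  obtain n where n: "(E ^^ n) v \<noteq> 0" "(E ^^ Suc n) v = 0"
    using least_vanishing[OF E_pow_vanishes[OF v(2)] v(1)] .
  then have "E ((E ^^ n) v) = 0" by simp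
  then show ?thesis
    using highest_weight_natural[OF n(1) _ E_weight[OF v(2)]] that by blast
qed

lemma weight_integral:
  assumes "v \<noteq> 0" "H v = c *\<^sub>C v" shows "\<exists>z. c = of_int z"
proof -
  obtain n l where "c + 2 * of_nat n = of_nat l" using weight_vector_top[OF assms] by blast
  then have "c = of_int (int l - 2 * int n)" by (simp add: algebra_simps)
  then show ?thesis ..
qed

text \<open>For a highest weight vector \<open>p\<close> of weight \<open>l\<close> this is the irreducible module generated by \<open>p\<close>.\<close>

definition string :: "'g \<Rightarrow> nat \<Rightarrow> 'g set" where
  "string p l = span ((\<lambda>j. (F ^^ j) p) ` {..l})"

lemma subspace_string: "subspace (string p l)"
  by (simp add: string_def)

lemma in_string: "v \<in> string p l \<longleftrightarrow> (\<exists>a. v = (\<Sum>j\<le>l. a j *\<^sub>C (F ^^ j) p))"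
  unfolding string_def by (rule span_image_finite) simp

lemma F_pow_in_string: "j \<le> l \<Longrightarrow> (F ^^ j) p \<in> string p l"
  unfolding string_def by (intro span_base) auto

lemma string_subset:
  assumes "subspace U" "p \<in> U" "\<And>v. v \<in> U \<Longrightarrow> F v \<in> U"
  shows "string p l \<subseteq> U"
proof -
  have "(F ^^ j) p \<in> U" for j by (induction j) (use assms in auto)
  then show ?thesis
    unfolding string_def by (intro span_minimal) (use assms in auto)
qed

context
  fixes p :: 'g and l :: nat
  assumes hw: "highest_weight p l"
begin

lemma hw_simps: "p \<noteq> 0" "E p = 0" "H p = of_nat l *\<^sub>C p"
  using hw by (auto simp: highest_weight_def)

lemma E_F_pow_hw: "E ((F ^^ Suc j) p) = (of_nat (Suc j) * (of_nat l - of_nat j)) *\<^sub>C (F ^^ j) p"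
  unfolding E_F_pow[OF hw_simps(3)] by (simp add: hw_simps F_pow_simps op_simps)

lemma string_invariant:
  assumes "v \<in> string p l"
  shows "E v \<in> string p l" "H v \<in> string p l" "F v \<in> string p l"
proof -
  have sp: "T v \<in> string p l"
    if T: "linear_op T" and b: "\<And>j. j \<le> l \<Longrightarrow> T ((F ^^ j) p) \<in> string p l" for T
  proof -
    obtain a where "v = (\<Sum>j\<le>l. a j *\<^sub>C (F ^^ j) p)" using assms in_string by auto
    then have "T v = (\<Sum>j\<le>l. a j *\<^sub>C T ((F ^^ j) p))"
      by (simp add: endo.linear_sum[OF T] endo.linear_scale[OF T])
    then show ?thesis
      using b by (auto intro!: subspace_sum subspace_scale subspace_string)
  qed
  show "E v \<in> string p l"
  proof (rule sp[OF linear_E])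
    fix j assume "j \<le> l"
    then show "E ((F ^^ j) p) \<in> string p l"
      by (cases j) (auto simp: hw_simps E_F_pow_hw subspace_0[OF subspace_string] simp del: funpow.simps
          intro!: subspace_scale[OF subspace_string] F_pow_in_string)
  qed
  show "H v \<in> string p l"
    by (rule sp[OF linear_H])
      (auto simp: F_weight[OF hw_simps(3)] intro!: subspace_scale[OF subspace_string] F_pow_in_string)
  show "F v \<in> string p l"
  proof (rule sp[OF linear_F])
    fix j assume "j \<le> l"
    then show "F ((F ^^ j) p) \<in> string p l"
      using F_pow_in_string[of "Suc j" l p] highest_weight_F_pow[OF hw]
      by (cases "j = l") (auto simp: subspace_0[OF subspace_string])
  qed
qed

lemma E_pow_F_pow_same: "j \<le> l \<Longrightarrow> \<exists>c. c \<noteq> 0 \<and> (E ^^ j) ((F ^^ j) p) = c *\<^sub>C p"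
proof (induction j)
  case 0
  show ?case by (rule exI[of _ 1]) simp
next
  case (Suc j)
  then obtain c where c: "c \<noteq> 0" "(E ^^ j) ((F ^^ j) p) = c *\<^sub>C p" by auto
  have "(E ^^ Suc j) ((F ^^ Suc j) p) = (E ^^ j) (E ((F ^^ Suc j) p))"
    by (simp only: funpow_Suc_right comp_apply)
  also have "\<dots> = (of_nat (Suc j) * (of_nat l - of_nat j) * c) *\<^sub>C p"
    by (simp only: E_F_pow_hw E_pow_simps c scale_scale)
  finally show ?case
    using c(1) Suc.prems
    by (intro exI[of _ "of_nat (Suc j) * (of_nat l - of_nat j) * c"]) (auto simp del: of_nat_Suc)
qed

lemma E_pow_F_pow_less: "i < j \<Longrightarrow> (E ^^ j) ((F ^^ i) p) = 0"
proof (induction i arbitrary: j)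
  case 0
  then show ?case
    by (cases j) (simp_all add: funpow_swap1 hw_simps E_pow_simps)
next
  case (Suc i)
  then obtain k where k: "j = Suc k" "i < k" by (cases j) auto
  have "(E ^^ Suc k) ((F ^^ Suc i) p) = (E ^^ k) (E ((F ^^ Suc i) p))"
    by (simp only: funpow_Suc_right comp_apply)
  also have "\<dots> = 0"
    by (simp only: E_F_pow_hw E_pow_simps Suc.IH[OF k(2)] scale_zero_right)
  finally show ?case using k by simp
qed

text \<open>If \<open>J\<close> is the largest index with a nonzero coefficient, then \<open>E\<^sup>J\<close> kills all terms of smaller index
  and maps the term of index \<open>J\<close> to a multiple of \<open>p\<close>.  Independence, irreducibility and the kernel
  of \<open>E\<close> follow.\<close>

lemma string_leading_term:
  assumes "v = (\<Sum>j\<le>l. a j *\<^sub>C (F ^^ j) p)" "j0 \<le> l" "a j0 \<noteq> 0"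
  obtains J c where "J \<le> l" "j0 \<le> J" "c \<noteq> 0" "(E ^^ J) v = c *\<^sub>C p"
proof -
  define J where "J = Max {j. j \<le> l \<and> a j \<noteq> 0}"
  have fin: "finite {j. j \<le> l \<and> a j \<noteq> 0}" by simp
  have "J \<in> {j. j \<le> l \<and> a j \<noteq> 0}"
    unfolding J_def using assms(2,3) by (intro Max_in[OF fin]) auto
  then have J: "J \<le> l" "a J \<noteq> 0" by auto
  have J0: "j0 \<le> J" unfolding J_def by (rule Max_ge[OF fin]) (use assms in auto)
  have above: "a j = 0" if "J < j" "j \<le> l" for j
    using Max_ge[OF fin, of j] that unfolding J_def[symmetric] by force
  obtain c where c: "c \<noteq> 0" "(E ^^ J) ((F ^^ J) p) = c *\<^sub>C p" using E_pow_F_pow_same[OF J(1)] by auto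
  have "(E ^^ J) v = (\<Sum>j\<le>l. a j *\<^sub>C (E ^^ J) ((F ^^ j) p))"
    by (simp add: assms(1) E_pow_simps)
  also have "\<dots> = (\<Sum>j\<in>{J}. a j *\<^sub>C (E ^^ J) ((F ^^ j) p))"
  proof (rule sum.mono_neutral_right)
    show "\<forall>i\<in>{..l} - {J}. a i *\<^sub>C (E ^^ J) ((F ^^ i) p) = 0"
    proof
      fix i assume "i \<in> {..l} - {J}"
      then consider "i < J" | "J < i" "i \<le> l" by fastforce
      then show "a i *\<^sub>C (E ^^ J) ((F ^^ i) p) = 0"
        by cases (auto simp: E_pow_F_pow_less above)
    qed
  qed (use J in auto)
  also have "\<dots> = (a J * c) *\<^sub>C p" by (simp add: c)
  finally have "(E ^^ J) v = (a J * c) *\<^sub>C p" .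
  with J(2) c(1) show ?thesis by (intro that[of J "a J * c"] J(1) J0) simp_all
qed

lemma indep_family_string: "indep_family {..l} (\<lambda>j. (F ^^ j) p)"
  unfolding indep_family_def
proof (intro allI impI ballI, rule ccontr)
  fix a j assume a: "(\<Sum>j\<le>l. a j *\<^sub>C (F ^^ j) p) = 0" "j \<in> {..l}" "a j \<noteq> 0"
  then obtain J c where "c \<noteq> 0" "(E ^^ J) 0 = c *\<^sub>C p"
    using string_leading_term[of 0 a j] by (metis atMost_iff)
  then show False using hw_simps(1) E_pow_simps by simp
qed

lemma dim_string: "dim (string p l) = l + 1"
  using indep_family_imp[OF _ indep_family_string]
  by (simp add: string_def card_image dim_eq_card_independent)

lemma E_pow_string:
  assumes "v \<in> string p l" "l < m" shows "(E ^^ m) v = 0"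
proof -
  obtain a where "v = (\<Sum>j\<le>l. a j *\<^sub>C (F ^^ j) p)" using assms in_string by auto
  then show ?thesis
    using assms(2)
    by (simp add: E_pow_simps E_pow_F_pow_less)
qed

lemma string_reaches_top:
  assumes "v \<in> string p l" "v \<noteq> 0"
  obtains J c where "J \<le> l" "c \<noteq> 0" "(E ^^ J) v = c *\<^sub>C p"
proof -
  obtain a where a: "v = (\<Sum>j\<le>l. a j *\<^sub>C (F ^^ j) p)" using assms in_string by auto
  have "\<exists>j\<le>l. a j \<noteq> 0"
  proof (rule ccontr)
    assume "\<not> ?thesis"
    then have "v = 0" unfolding a by (intro sum.neutral) auto
    with assms(2) show False ..
  qed
  then obtain j where "j \<le> l" "a j \<noteq> 0" by blast
  from string_leading_term[OF a this] show ?thesis using that by blast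
qed

lemma kernel_E_string:
  assumes "v \<in> string p l" "E v = 0" shows "\<exists>c. v = c *\<^sub>C p"
proof (cases "v = 0")
  case True
  then show ?thesis by (intro exI[of _ 0]) simp
next
  case False
  obtain J c where J: "J \<le> l" "c \<noteq> 0" "(E ^^ J) v = c *\<^sub>C p"
    using string_reaches_top[OF assms(1) False] .
  have "J = 0"
  proof (rule ccontr)
    assume "J \<noteq> 0"
    then have "(E ^^ J) v = 0"
      using funpow_zero_mono[where T = E and m = 1 and x = v and n = J] assms(2) by (simp add: op_simps)
    with J hw_simps(1) show False by simp
  qed
  with J show ?thesis by auto
qed

lemma string_irreducible:
  assumes U: "subspace U" "U \<subseteq> string p l" "U \<noteq> {0}"
    and inv: "\<And>v. v \<in> U \<Longrightarrow> E v \<in> U" "\<And>v. v \<in> U \<Longrightarrow> F v \<in> U"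
  shows "U = string p l"
proof
  obtain v where v: "v \<in> U" "v \<noteq> 0" using U subspace_0[OF U(1)] by auto
  then obtain J c where J: "c \<noteq> 0" "(E ^^ J) v = c *\<^sub>C p"
    using string_reaches_top U(2) by (metis subsetD)
  have "(E ^^ j) v \<in> U" for j by (induction j) (use v inv in auto)
  then have "inverse c *\<^sub>C (E ^^ J) v \<in> U" using subspace_scale[OF U(1)] by blast
  then have "p \<in> U" using J by simp
  then show "string p l \<subseteq> U" using string_subset[OF U(1) _ inv(2)] by blast
qed (use U in auto)

end

text \<open>The partition is defined through arbitrary triples, so \<open>H\<close> may not be assumed diagonalizable.
  If \<open>n\<close> is the largest power with \<open>E\<^sup>n \<noteq> 0\<close> on \<open>V\<close>, then \<open>E_pow_F\<close> shows that \<open>H\<close> acts as the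
  scalar \<open>n\<close> on \<open>E\<^sup>n V\<close>, which consists of vectors killed by \<open>E\<close>.\<close>

lemma irreducible_nilpotent_is_string:
  assumes V: "subspace V" "V \<noteq> {0}"
    and inv: "\<And>v. v \<in> V \<Longrightarrow> E v \<in> V" "\<And>v. v \<in> V \<Longrightarrow> H v \<in> V" "\<And>v. v \<in> V \<Longrightarrow> F v \<in> V"
    and irr: "\<And>U. subspace U \<Longrightarrow> U \<subseteq> V \<Longrightarrow> U \<noteq> {0} \<Longrightarrow>
       (\<And>v. v \<in> U \<Longrightarrow> E v \<in> U \<and> H v \<in> U \<and> F v \<in> U) \<Longrightarrow> U = V"
    and nil: "\<exists>m. \<forall>v. (E ^^ m) v = 0"
  obtains p l where "highest_weight p l" "V = string p l"
proof -
  define N where "N = (LEAST n. \<forall>v\<in>V. (E ^^ n) v = 0)"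
  have "\<exists>n. \<forall>v\<in>V. (E ^^ n) v = 0" using nil by auto
  then have N: "\<forall>v\<in>V. (E ^^ N) v = 0" unfolding N_def by (rule LeastI_ex)
  obtain v0 where "v0 \<in> V" "v0 \<noteq> 0" using V subspace_0 by fastforce
  with N have "N \<noteq> 0" by (cases N) auto
  then obtain n where n: "N = Suc n" by (cases N) auto
  then obtain v where v: "v \<in> V" "(E ^^ n) v \<noteq> 0"
    using not_less_Least[of n "\<lambda>n. \<forall>v\<in>V. (E ^^ n) v = 0"] by (auto simp: N_def)
  define p where "p = (E ^^ n) v"
  have pV: "p \<in> V" unfolding p_def using v(1) by (induction n) (auto intro: inv)
  have Ep: "E p = 0" using N n v by (auto simp: p_def)
  have "of_nat (Suc n) *\<^sub>C (E ^^ n) (H v + of_nat n *\<^sub>C v)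
      = (E ^^ N) (F v) - F ((E ^^ N) v)"
    using E_pow_F[of n v] n by simp
  also have "\<dots> = 0" using N v(1) inv by (simp add: op_simps)
  finally have "(E ^^ n) (H v + of_nat n *\<^sub>C v) = 0" by (simp del: of_nat_Suc)
  then have "(E ^^ n) (H v) = - (of_nat n *\<^sub>C p)"
    by (simp add: p_def E_pow_simps eq_neg_iff_add_eq_0)
  then have "H p = (2 * of_nat n) *\<^sub>C p - of_nat n *\<^sub>C p"
    unfolding p_def E_pow_H by simp
  also have "\<dots> = of_nat n *\<^sub>C p" by (simp only: scale_left_diff_distrib[symmetric]) simp
  finally have hw: "highest_weight p n" using v Ep by (simp add: highest_weight_def p_def)
  have "string p n = V"
  proof (rule irr)
    show "subspace (string p n)" by (rule subspace_string)
    show "string p n \<subseteq> V" by (rule string_subset) (use V pV inv in auto)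
    have "p \<in> string p n" using F_pow_in_string[of 0 n p] by simp
    then show "string p n \<noteq> {0}" using v by (auto simp: p_def)
    show "E v \<in> string p n \<and> H v \<in> string p n \<and> F v \<in> string p n" if "v \<in> string p n" for v
      using string_invariant[OF hw that] by blast
  qed
  from that[OF hw this[symmetric]] show ?thesis .
qed

text \<open>Complete reducibility, for diagonalizable \<open>H\<close>.  On positive weight spaces \<open>EF\<close> is
  injective, hence surjective; so for \<open>v\<close> of weight \<open>m \<ge> 0\<close> there is \<open>w\<close> with \<open>E F w = E v\<close>, and
  \<open>v = (v - F w) + F w\<close> where \<open>v - F w\<close> is killed by \<open>E\<close> and \<open>w\<close> has larger weight.  Negative
  weights follow, because \<open>F\<^sup>m E\<^sup>m\<close> is bijective on the space of weight \<open>- m\<close>.\<close>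

lemma spanned_by_highest_weight_vectors:
  assumes diag: "span {v. \<exists>c. H v = c *\<^sub>C v} = UNIV"
    and M: "subspace M" "\<And>v. v \<in> M \<Longrightarrow> F v \<in> M" "\<And>p c. E p = 0 \<Longrightarrow> H p = c *\<^sub>C p \<Longrightarrow> p \<in> M"
  shows "M = UNIV"
proof -
  have nonneg: "v \<in> M" if "H v = of_nat m *\<^sub>C v" "(E ^^ n) v = 0" for n m v
    using that
  proof (induction n arbitrary: v m)
    case 0
    then show ?case using subspace_0[OF M(1)] by simp
  next
    case (Suc n)
    \<comment> \<open>Restricting to \<open>ker E\<^sup>n\<close> makes the induction hypothesis applicable to \<open>w\<close>.\<close>
    define X where "X = {w. H w = of_nat (m + 2) *\<^sub>C w \<and> (E ^^ n) w = 0}"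
    have linEF: "linear_op (\<lambda>w. E (F w))"
      by (intro linear_opI) (simp_all add: op_simps)
    have weight: "H (E x) = (c + 2) *\<^sub>C E x" "H (F x) = (c - 2) *\<^sub>C F x" if "H x = c *\<^sub>C x" for x c
      using E_weight[OF that, of 1] F_weight[OF that, of 1] by simp_all
    have "\<exists>w\<in>X. E (F w) = E v"
    proof (rule injective_on_subspace_imp_surjective[OF linEF])
      show "subspace X"
        unfolding X_def
        by (intro subspaceI)
          (simp_all add: op_simps E_pow_simps scale_right_distrib mult.commute)
      show "E (F x) \<in> X" if "x \<in> X" for x
      proof -
        have x: "H x = of_nat (m + 2) *\<^sub>C x" "(E ^^ n) x = 0" using that by (auto simp: X_def)
        have "(E ^^ n) (E (F x)) = (E ^^ Suc n) (F x)" by (simp add: funpow_swap1)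
        also have "\<dots> = 0"
          unfolding E_pow_F x(1)
          by (simp add: E_pow_simps x(2) op_simps)
        finally show ?thesis
          using weight(1)[OF weight(2)[OF x(1)]] by (simp add: X_def)
      qed
      show "x = 0" if "x \<in> X" "E (F x) = 0" for x
        using EF_injective[of x "m + 2"] that by (auto simp: X_def)
      show "E v \<in> X"
        using Suc.prems weight(1)[OF Suc.prems(1)] by (simp add: X_def funpow_swap1 add.commute)
    qed
    then obtain w where w: "w \<in> X" "E (F w) = E v" by blast
    have wM: "w \<in> M" using Suc.IH[of w "m + 2"] w(1) by (auto simp: X_def)
    have Hw: "H w = of_nat (m + 2) *\<^sub>C w" using w(1) by (auto simp: X_def)
    have "v - F w \<in> M"
    proof (rule M(3))
      show "E (v - F w) = 0" using w by (simp add: op_simps)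
      show "H (v - F w) = of_nat m *\<^sub>C (v - F w)"
        using weight(2)[OF Hw] Suc.prems(1) by (simp add: op_simps scale_right_diff_distrib)
    qed
    from subspace_add[OF M(1) this M(2)[OF wM]] show ?case by simp
  qed
  have M_F_pow: "(F ^^ j) v \<in> M" if "v \<in> M" for v j
    by (induction j) (use that M(2) in auto)
  have weight_in: "v \<in> M" if v: "H v = c *\<^sub>C v" for v c
  proof (cases "v = 0")
    case True
    then show ?thesis using subspace_0[OF M(1)] by simp
  next
    case False
    then obtain z where z: "c = of_int z" using weight_integral[OF _ v] by blast
    show ?thesis
    proof (cases "0 \<le> z")
      case True
      then have "H v = of_nat (nat z) *\<^sub>C v" using v z by simp
      then show ?thesis using nonneg E_pow_vanishes[OF v] by blast
    next
      case False
      define m where "m = nat (- z)"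
      have c: "c = - of_nat m" using False z by (simp add: m_def)
      define X where "X = {w. H w = c *\<^sub>C w}"
      have up: "H ((E ^^ m) w) = of_nat m *\<^sub>C (E ^^ m) w" if "w \<in> X" for w
        using E_weight[of w c m] that by (simp add: X_def c)
      have "\<exists>w\<in>X. (F ^^ m) ((E ^^ m) w) = v"
      proof (rule injective_on_subspace_imp_surjective)
        show "linear_op (\<lambda>w. (F ^^ m) ((E ^^ m) w))"
          using E_pow_simps
            F_pow_simps
          by (intro linear_opI) simp_all
        show "subspace X"
          unfolding X_def by (intro subspaceI) (simp_all add: op_simps scale_right_distrib mult.commute)
        show "(F ^^ m) ((E ^^ m) w) \<in> X" if "w \<in> X" for w
          using F_weight[OF up[OF that], of m] by (simp add: X_def c)
        show "w = 0" if "w \<in> X" "(F ^^ m) ((E ^^ m) w) = 0" for w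
        proof -
          have "(E ^^ m) w = 0" using F_pow_injective[OF up[OF that(1)] order_refl] that(2) .
          then show ?thesis
            using sl2_module.F_pow_injective[OF swapped, of w m m] that(1) by (simp add: X_def c)
        qed
        show "v \<in> X" using v by (simp add: X_def)
      qed
      then obtain w where w: "w \<in> X" "(F ^^ m) ((E ^^ m) w) = v" by blast
      obtain n where "(E ^^ n) w = 0" using E_pow_vanishes[of w c] w(1) by (auto simp: X_def)
      then have "(E ^^ (n + m)) w = 0"
        by (rule funpow_zero_mono) (simp_all add: op_simps)
      then have "(E ^^ n) ((E ^^ m) w) = 0" by (simp add: funpow_add)
      then have "(E ^^ m) w \<in> M" using nonneg up[OF w(1)] by blast
      then show ?thesis using M_F_pow w(2) by blast
    qed
  qed
  have "span {v. \<exists>c. H v = c *\<^sub>C v} \<subseteq> M"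
    by (rule span_minimal) (use weight_in M(1) in auto)
  then show ?thesis using diag by auto
qed

definition string_decomposition :: "nat \<Rightarrow> (nat \<Rightarrow> 'g) \<Rightarrow> (nat \<Rightarrow> nat) \<Rightarrow> bool" where
  "string_decomposition n p l \<longleftrightarrow>
     (\<forall>i\<in>{1..n}. highest_weight (p i) (l i)) \<and>
     (\<forall>x. \<exists>v. (\<forall>i\<in>{1..n}. v i \<in> string (p i) (l i)) \<and> x = (\<Sum>i = 1..n. v i)) \<and>
     (\<forall>v. (\<forall>i\<in>{1..n}. v i \<in> string (p i) (l i)) \<and> (\<Sum>i = 1..n. v i) = 0 \<longrightarrow>
        (\<forall>i\<in>{1..n}. v i = 0))"

text \<open>The operator \<open>E\<close> maps relations \<open>\<Sum> v i = 0\<close> to relations, so by induction every \<open>v i\<close> is killed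
  by \<open>E\<close> and is therefore a multiple of \<open>p i\<close>; the relation is one between the \<open>p i\<close>.\<close>

lemma strings_sum_zero:
  assumes hw: "\<And>i. i \<in> I \<Longrightarrow> highest_weight (p i) (l i)" and fin: "finite I"
    and ind: "indep_family I p"
    and v: "\<And>i. i \<in> I \<Longrightarrow> v i \<in> string (p i) (l i)" "(\<Sum>i\<in>I. v i) = 0"
  shows "\<forall>i\<in>I. v i = 0"
proof -
  have key: "\<forall>i\<in>I. v i = 0"
    if "\<forall>i\<in>I. v i \<in> string (p i) (l i)" "(\<Sum>i\<in>I. v i) = 0" "\<forall>i\<in>I. (E ^^ N) (v i) = 0" for N v
    using that
  proof (induction N arbitrary: v)
    case (Suc N)
    have "(\<Sum>i\<in>I. E (v i)) = 0"
      using Suc.prems(2) by (simp add: endo.linear_sum[OF linear_E, symmetric] op_simps)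
    then have "\<forall>i\<in>I. E (v i) = 0"
      using Suc.IH[of "\<lambda>i. E (v i)"] Suc.prems(1,3) string_invariant(1)[OF hw]
      by (simp add: funpow_swap1)
    then have "\<forall>i\<in>I. \<exists>c. v i = c *\<^sub>C p i"
      using kernel_E_string[OF hw] Suc.prems(1) by blast
    then obtain c where c: "\<forall>i\<in>I. v i = c i *\<^sub>C p i" by metis
    then have "(\<Sum>i\<in>I. c i *\<^sub>C p i) = 0" using Suc.prems(2) by simp
    then show ?case using indep_familyD[OF ind] c by auto
  qed simp
  have "(E ^^ Suc (Max (l ` I))) (v i) = 0" if "i \<in> I" for i
    by (rule E_pow_string[OF hw[OF that] v(1)[OF that]])
      (use fin that in \<open>simp add: less_Suc_eq_le\<close>)
  then show ?thesis
    using v by (intro key[of v "Suc (Max (l ` I))"]) auto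
qed

theorem string_decomposition_exists:
  assumes diag: "span {v. \<exists>c. H v = c *\<^sub>C v} = UNIV"
  obtains n p l where "string_decomposition n p l"
proof -
  define HW where "HW = {p. E p = 0 \<and> (\<exists>c. H p = c *\<^sub>C p)}"
  obtain B where B: "B \<subseteq> HW" "independent B" "HW \<subseteq> span B"
    using maximal_independent_subset .
  have finB: "finite B" using B(2) by (rule finiteI_independent)
  have "\<exists>l. highest_weight b l" if b: "b \<in> B" for b
  proof -
    have "b \<noteq> 0" using b B(2) dependent_zero by blast
    moreover obtain c where "E b = 0" "H b = c *\<^sub>C b" using subsetD[OF B(1) b] by (auto simp: HW_def)
    ultimately show ?thesis by (rule highest_weight_natural) blast
  qed
  then obtain L where L: "\<And>b. b \<in> B \<Longrightarrow> highest_weight b (L b)" by metis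
  obtain p where p: "bij_betw p {1..card B} B"
    using ex_bij_betw_nat_finite_1[OF finB] by blast
  define n where "n = card B"
  define l where "l i = L (p i)" for i
  have pB: "p i \<in> B" if "i \<in> {1..n}" for i
    using p that unfolding n_def by (auto simp: bij_betw_def)
  have hw: "highest_weight (p i) (l i)" if "i \<in> {1..n}" for i
    using L[OF pB[OF that]] by (simp add: l_def)
  have ind: "indep_family {1..n} p"
    using p B(2) by (intro indep_family_if_independent) (simp_all add: n_def bij_betw_def)
  define M where "M = {x. \<exists>v. (\<forall>i\<in>{1..n}. v i \<in> string (p i) (l i)) \<and> x = (\<Sum>i = 1..n. v i)}"
  have subM: "subspace M"
  proof (rule subspaceI)
    show "0 \<in> M"
      unfolding M_def by (auto intro!: exI[of _ "\<lambda>_. 0"] simp: subspace_0[OF subspace_string])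
    show "x + y \<in> M" if "x \<in> M" "y \<in> M" for x y
    proof -
      obtain v w where "\<forall>i\<in>{1..n}. v i \<in> string (p i) (l i)" "x = (\<Sum>i = 1..n. v i)"
        "\<forall>i\<in>{1..n}. w i \<in> string (p i) (l i)" "y = (\<Sum>i = 1..n. w i)"
        using \<open>x \<in> M\<close> \<open>y \<in> M\<close> by (auto simp: M_def)
      then show ?thesis
        unfolding M_def
        by (auto intro!: exI[of _ "\<lambda>i. v i + w i"] subspace_add[OF subspace_string] simp: sum.distrib)
    qed
    show "c *\<^sub>C x \<in> M" if "x \<in> M" for c x
    proof -
      obtain v where "\<forall>i\<in>{1..n}. v i \<in> string (p i) (l i)" "x = (\<Sum>i = 1..n. v i)"
        using \<open>x \<in> M\<close> by (auto simp: M_def)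
      then show ?thesis
        unfolding M_def
        by (auto intro!: exI[of _ "\<lambda>i. c *\<^sub>C v i"] subspace_scale[OF subspace_string] simp: scale_sum_right)
    qed
  qed
  have BM: "B \<subseteq> M"
  proof
    fix b assume "b \<in> B"
    then have "b \<in> p ` {1..n}" using p by (simp add: n_def bij_betw_def)
    then obtain i where i: "i \<in> {1..n}" "b = p i" by blast
    have "b = (\<Sum>j = 1..n. if j = i then b else 0)" using i by simp
    moreover have "\<forall>j\<in>{1..n}. (if j = i then b else 0) \<in> string (p j) (l j)"
      using i F_pow_in_string[of 0 "l i" "p i"] by (auto simp: subspace_0[OF subspace_string])
    ultimately show "b \<in> M"
      unfolding M_def by (intro CollectI exI[of _ "\<lambda>j. if j = i then b else 0"]) simp
  qed
  have "M = UNIV"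
  proof (rule spanned_by_highest_weight_vectors[OF diag subM])
    fix x assume "x \<in> M"
    then obtain v where "\<forall>i\<in>{1..n}. v i \<in> string (p i) (l i)" "x = (\<Sum>i = 1..n. v i)"
      by (auto simp: M_def)
    then show "F x \<in> M"
      unfolding M_def using string_invariant(3)[OF hw]
      by (intro CollectI exI[of _ "\<lambda>i. F (v i)"]) (auto simp: endo.linear_sum[OF linear_F])
  next
    fix q c assume "E q = 0" "H q = c *\<^sub>C q"
    then have "q \<in> span B" using B(3) by (auto simp: HW_def)
    then show "q \<in> M" using span_minimal[OF BM subM] by blast
  qed
  then have "string_decomposition n p l"
    unfolding string_decomposition_def
    using hw strings_sum_zero[OF hw _ ind] unfolding M_def by blast
  then show ?thesis by (rule that)
qed

lemma string_decompositionD: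
  assumes "string_decomposition n p l"
  shows "i \<in> {1..n} \<Longrightarrow> highest_weight (p i) (l i)"
    and "\<exists>v. (\<forall>i\<in>{1..n}. v i \<in> string (p i) (l i)) \<and> x = (\<Sum>i = 1..n. v i)"
    and "(\<And>i. i \<in> {1..n} \<Longrightarrow> v i \<in> string (p i) (l i)) \<Longrightarrow> (\<Sum>i = 1..n. v i) = 0 \<Longrightarrow>
      i \<in> {1..n} \<Longrightarrow> v i = 0"
  using assms unfolding string_decomposition_def by blast+

lemma top_in_string: "p \<in> string p l"
  using F_pow_in_string[of 0 l p] by simp

text \<open>A string of highest weight \<open>l i\<close> contributes to \<open>ker E\<close> only the line of \<open>p i\<close>, and \<open>p i\<close> lies in
  the image of \<open>E\<^sup>m\<close> exactly when \<open>m \<le> l i\<close>.  The right-hand side depends on \<open>E\<close> alone.\<close>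

theorem card_long_strings:
  assumes dec: "string_decomposition n p l"
  shows "card {i\<in>{1..n}. m \<le> l i} = dim {x. E x = 0 \<and> (\<exists>y. x = (E ^^ m) y)}"
proof -
  note hw = string_decompositionD(1)[OF dec]
  let ?I = "{i\<in>{1..n}. m \<le> l i}" and ?K = "{x. E x = 0 \<and> (\<exists>y. x = (E ^^ m) y)}"
  have "indep_family {1..n} p"
    unfolding indep_family_def
  proof (intro allI impI ballI)
    fix a i assume a: "(\<Sum>i = 1..n. a i *\<^sub>C p i) = 0" and i: "i \<in> {1..n}"
    have "a i *\<^sub>C p i = 0"
      by (rule string_decompositionD(3)[OF dec _ a i])
        (auto intro: subspace_scale[OF subspace_string] top_in_string)
    then show "a i = 0" using hw[OF i] by (simp add: highest_weight_def)
  qed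
  then have ind: "indep_family ?I p"
    by (rule indep_family_subset) auto
  have "dim ?K = card ?I"
  proof (rule dim_unique)
    show "independent (p ` ?I)" using indep_family_imp(2)[OF _ ind] by simp
    show "card (p ` ?I) = card ?I" using indep_family_imp(1)[OF _ ind] by (simp add: card_image)
    show "p ` ?I \<subseteq> ?K"
    proof clarify
      fix i assume i: "i \<in> {1..n}" "m \<le> l i"
      obtain c where c: "c \<noteq> 0" "(E ^^ l i) ((F ^^ l i) (p i)) = c *\<^sub>C p i"
        using E_pow_F_pow_same[OF hw[OF i(1)] order_refl] by auto
      have "p i = inverse c *\<^sub>C (E ^^ (m + (l i - m))) ((F ^^ l i) (p i))"
        using c i by simp
      also have "\<dots> = (E ^^ m) (inverse c *\<^sub>C (E ^^ (l i - m)) ((F ^^ l i) (p i)))"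
        by (simp only: funpow_add comp_apply E_pow_simps)
      finally show "E (p i) = 0 \<and> (\<exists>y. p i = (E ^^ m) y)"
        using hw[OF i(1)] by (auto simp: highest_weight_def)
    qed
    show "?K \<subseteq> span (p ` ?I)"
    proof clarify
      fix y assume Ey: "E ((E ^^ m) y) = 0"
      obtain v where v: "\<And>i. i \<in> {1..n} \<Longrightarrow> v i \<in> string (p i) (l i)" "y = (\<Sum>i = 1..n. v i)"
        using string_decompositionD(2)[OF dec] by blast
      have pow: "(E ^^ j) (v i) \<in> string (p i) (l i)" if "i \<in> {1..n}" for i j
        by (induction j) (use v(1)[OF that] string_invariant(1)[OF hw[OF that]] in auto)
      have Em: "(E ^^ m) y = (\<Sum>i = 1..n. (E ^^ m) (v i))"
        by (simp add: v(2) E_pow_simps)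
      have sum0: "(\<Sum>i = 1..n. (E ^^ Suc m) (v i)) = 0"
        using Ey unfolding Em by (simp add: endo.linear_sum[OF linear_E])
      have "(E ^^ m) (v i) \<in> span (p ` ?I)" if i: "i \<in> {1..n}" for i
      proof (cases "m \<le> l i")
        case True
        have "(E ^^ Suc m) (v i) = 0"
          by (rule string_decompositionD(3)[OF dec pow sum0 i])
        then have "E ((E ^^ m) (v i)) = 0" by simp
        from kernel_E_string[OF hw[OF i] pow[OF i] this] obtain c where "(E ^^ m) (v i) = c *\<^sub>C p i" ..
        then show ?thesis using True i by (auto intro!: span_scale intro: span_base)
      next
        case False
        then have "(E ^^ m) (v i) = 0" using E_pow_string[OF hw[OF i] v(1)[OF i]] by simp
        then show ?thesis by (simp add: span_zero)
      qed
      then show "(E ^^ m) y \<in> span (p ` ?I)" unfolding Em by (rule span_sum)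
    qed
  qed
  then show ?thesis ..
qed

text \<open>In the basis \<open>F\<^sup>j (p i)\<close> a vector has weight \<open>m\<close> iff \<open>l i = m + 2 j\<close>, so each string with \<open>m \<le> l i\<close>
  and \<open>l i - m\<close> even contributes one.\<close>

theorem dim_weight_space:
  assumes dec: "string_decomposition n p l"
  shows "dim {v. H v = of_nat m *\<^sub>C v} = card {i\<in>{1..n}. m \<le> l i \<and> even (l i - m)}"
proof -
  note hw = string_decompositionD(1)[OF dec]
  let ?I = "Sigma {1..n} (\<lambda>i. {..l i})"
  define b where "b = (\<lambda>(i, j). (F ^^ j) (p i))"
  define c where "c = (\<lambda>(i, j). of_nat (l i) - 2 * of_nat j :: complex)"
  have fin: "finite ?I" by simp
  have "dim {v. H v = of_nat m *\<^sub>C v} = card {q\<in>?I. c q = of_nat m}"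
  proof (rule dim_eigenspace[OF linear_H fin])
    show "indep_family ?I b"
      unfolding indep_family_def
    proof (intro allI impI ballI)
      fix a q assume a: "(\<Sum>q\<in>?I. a q *\<^sub>C b q) = 0" and q: "q \<in> ?I"
      obtain i j where ij: "q = (i, j)" "i \<in> {1..n}" "j \<in> {..l i}" using q by auto
      have "(\<Sum>i = 1..n. \<Sum>j\<le>l i. a (i, j) *\<^sub>C (F ^^ j) (p i)) = 0"
        using a by (simp add: sum.Sigma b_def split_def)
      moreover have "(\<Sum>j\<le>l i. a (i, j) *\<^sub>C (F ^^ j) (p i)) \<in> string (p i) (l i)" for i
        unfolding in_string by (rule exI[of _ "\<lambda>j. a (i, j)"]) simp
      ultimately have "(\<Sum>j\<le>l i. a (i, j) *\<^sub>C (F ^^ j) (p i)) = 0"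
        using string_decompositionD(3)[OF dec, of "\<lambda>i. \<Sum>j\<le>l i. a (i, j) *\<^sub>C (F ^^ j) (p i)" i] ij(2)
        by simp
      then show "a q = 0"
        using indep_familyD[OF indep_family_string[OF hw[OF ij(2)]], of "\<lambda>j. a (i, j)" j] ij by simp
    qed
    show "span (b ` ?I) = UNIV"
    proof (intro equalityI subset_UNIV subsetI)
      fix x
      obtain v where v: "\<And>i. i \<in> {1..n} \<Longrightarrow> v i \<in> string (p i) (l i)" "x = (\<Sum>i = 1..n. v i)"
        using string_decompositionD(2)[OF dec] by blast
      have "string (p i) (l i) \<subseteq> span (b ` ?I)" if "i \<in> {1..n}" for i
        unfolding string_def
      proof (rule span_mono, clarify)
        fix j assume "j \<le> l i"
        then show "(F ^^ j) (p i) \<in> b ` ?I"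
          using that by (intro image_eqI[of _ _ "(i, j)"]) (auto simp: b_def)
      qed
      then show "x \<in> span (b ` ?I)"
        unfolding v(2) using v(1) by (intro span_sum) blast
    qed
    show "H (b q) = c q *\<^sub>C b q" if "q \<in> ?I" for q
      using that F_weight[OF hw_simps(3)[OF hw]] by (auto simp: b_def c_def)
  qed
  also have "\<dots> = card {i\<in>{1..n}. m \<le> l i \<and> even (l i - m)}"
  proof (rule sym, rule bij_betw_same_card[of "\<lambda>i. (i, (l i - m) div 2)"])
    have ceq: "c (i, j) = of_nat m \<longleftrightarrow> l i = m + 2 * j" for i j
    proof -
      have "c (i, j) = of_nat m \<longleftrightarrow> (of_nat (l i) :: complex) = of_nat (m + 2 * j)"
        by (auto simp: c_def algebra_simps)
      then show ?thesis by (simp only: of_nat_eq_iff)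
    qed
    show "bij_betw (\<lambda>i. (i, (l i - m) div 2)) {i\<in>{1..n}. m \<le> l i \<and> even (l i - m)}
       {q\<in>?I. c q = of_nat m}"
      by (rule bij_betw_byWitness[where f' = fst]) (auto simp: ceq)
  qed
  finally show ?thesis .
qed

end

section \<open>Weight partitions and multiplicities of weights\<close>

lemma multiset_eq_if_tails_eq:
  fixes M N :: "nat multiset"
  assumes "\<And>m. size {#x \<in># M. m \<le> x#} = size {#x \<in># N. m \<le> x#}"
  shows "M = N"
proof (rule multiset_eqI)
  fix x
  have split: "size {#y \<in># K. x \<le> y#} = count K x + size {#y \<in># K. Suc x \<le> y#}" for K :: "nat multiset"
  proof -
    have "{#y \<in># K. x \<le> y#} = {#y \<in># K. y = x#} + {#y \<in># K. Suc x \<le> y#}"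
      by (rule multiset_eqI) auto
    then show ?thesis by (simp add: filter_eq_replicate_mset)
  qed
  show "count M x = count N x"
    using split[of M] split[of N] assms[of x] assms[of "Suc x"] by simp
qed

lemma size_filter_image_mset_set:
  "finite A \<Longrightarrow> size {#x \<in># image_mset f (mset_set A). P x#} = card {i\<in>A. P (f i)}"
  by (simp add: filter_mset_image_mset)

sublocale complex_lie_algebra \<subseteq> complex_vector_space scale
  by unfold_locales (rule finite_dimensional)

context complex_lie_algebra
begin

lemma linear_bracket: "linear_op (bracket x)"
  by (rule linear_opI) (simp_all add: bracket_add_right bracket_scale_right)

lemma linear_bracket_left: "linear_op (\<lambda>x. bracket x y)"
  by (rule linear_opI) (simp_all add: bracket_add_left bracket_scale_left)

lemmas bracket_simps =
  bracket_add_left bracket_add_right bracket_scale_left bracket_scale_right bracket_self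
  endo.linear_0[OF linear_bracket] endo.linear_0[OF linear_bracket_left]
  endo.linear_neg[OF linear_bracket] endo.linear_neg[OF linear_bracket_left]
  endo.linear_diff[OF linear_bracket] endo.linear_diff[OF linear_bracket_left]

lemma bracket_anticommute: "bracket y x = - bracket x y"
proof -
  have "bracket x y + bracket y x = bracket (x + y) (x + y)"
    by (simp only: bracket_add_left bracket_add_right) (simp add: bracket_self)
  also have "\<dots> = 0" by (rule bracket_self)
  finally have "bracket x y + bracket y x = 0" .
  then show ?thesis by (simp add: eq_neg_iff_add_eq_0 add.commute)
qed

lemma bracket_derivation: "bracket x (bracket y z) = bracket (bracket x y) z + bracket y (bracket x z)"
  using jacobi[of x y z] bracket_anticommute[of z x] bracket_anticommute[of z "bracket x y"]
  by (simp add: bracket_simps algebra_simps)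

lemma sl2_triple_module:
  assumes "sl2_triple e h f"
  shows "sl2_module scale (bracket e) (bracket h) (bracket f)"
proof unfold_locales
  from assms have t: "bracket h e = 2 *\<^sub>C e" "bracket h f = (-2) *\<^sub>C f" "bracket e f = h"
    by (auto simp: sl2_triple_def)
  show "bracket h (bracket e v) = bracket e (bracket h v) + 2 *\<^sub>C bracket e v" for v
    using bracket_derivation[of h e v] by (simp add: t bracket_simps add.commute)
  show "bracket h (bracket f v) = bracket f (bracket h v) - 2 *\<^sub>C bracket f v" for v
    using bracket_derivation[of h f v] by (simp add: t bracket_simps)
  show "bracket e (bracket f v) = bracket f (bracket e v) + bracket h v" for v
    using bracket_derivation[of e f v] by (simp add: t)
qed (simp_all add: bracket_simps)

lemma string_decomposition_of_irreducibles:
  assumes nil: "ad_nilpotent e" and triple: "sl2_triple e h f"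
    and dec: "direct_decomposition n V" and irr: "\<And>i. i \<in> {1..n} \<Longrightarrow> sl2_irreducible e h f (V i)"
  obtains p l where "sl2_module.string_decomposition scale (bracket e) (bracket h) (bracket f) n p l"
    "\<And>i. i \<in> {1..n} \<Longrightarrow> dim (V i) = l i + 1"
proof -
  interpret sl2_module scale "bracket e" "bracket h" "bracket f"
    by (rule sl2_triple_module[OF triple])
  have "\<exists>p l. highest_weight p l \<and> V i = string p l" if i: "i \<in> {1..n}" for i
  proof -
    from irr[OF i] have V: "subspace (V i)" "V i \<noteq> {0}"
      "\<And>v. v \<in> V i \<Longrightarrow> bracket e v \<in> V i" "\<And>v. v \<in> V i \<Longrightarrow> bracket h v \<in> V i"
      "\<And>v. v \<in> V i \<Longrightarrow> bracket f v \<in> V i"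
      and min: "\<And>U. sl2_submodule e h f U \<Longrightarrow> U \<subseteq> V i \<Longrightarrow> U = {0} \<or> U = V i"
      unfolding sl2_irreducible_def sl2_submodule_def by blast+
    have min': "U = V i" if "subspace U" "U \<subseteq> V i" "U \<noteq> {0}"
      "\<And>v. v \<in> U \<Longrightarrow> bracket e v \<in> U \<and> bracket h v \<in> U \<and> bracket f v \<in> U" for U
      using min[of U] that unfolding sl2_submodule_def by blast
    show ?thesis
      by (rule irreducible_nilpotent_is_string[OF V min' nil[unfolded ad_nilpotent_def]]) blast+
  qed
  then obtain p l where pl: "\<And>i. i \<in> {1..n} \<Longrightarrow> highest_weight (p i) (l i) \<and> V i = string (p i) (l i)"
    by metis
  have mem: "(\<forall>i\<in>{1..n}. v i \<in> V i) \<longleftrightarrow> (\<forall>i\<in>{1..n}. v i \<in> string (p i) (l i))" for v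
    using pl by auto
  have "string_decomposition n p l"
    using dec pl unfolding string_decomposition_def direct_decomposition_def mem by blast
  moreover have "dim (V i) = l i + 1" if "i \<in> {1..n}" for i
    using pl[OF that] dim_string by auto
  ultimately show ?thesis by (rule that)
qed

text \<open>The diagonalizable \<open>h\<close> gives one decomposition, whose highest weights are determined by \<open>dims\<close>;
  \<open>card_long_strings\<close> carries the result over to every other triple through \<open>e\<close>.\<close>

theorem weight_partition_from_weight_multiplicities:
  assumes nil: "ad_nilpotent e" and triple: "sl2_triple e h f" and diag: "ad_diagonalizable h"
    and even: "\<And>v l. v \<noteq> 0 \<Longrightarrow> bracket h v = of_nat l *\<^sub>C v \<Longrightarrow> even l"
    and dims: "\<And>m. dim {v. bracket h v = of_nat (2 * m) *\<^sub>C v} = size {#x \<in># T. m \<le> x#}"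
  shows "is_weight_partition e W \<longleftrightarrow> W = image_mset of_nat T"
proof -
  interpret S: sl2_module scale "bracket e" "bracket h" "bracket f"
    by (rule sl2_triple_module[OF triple])
  obtain n p l where dec: "S.string_decomposition n p l"
    using S.string_decomposition_exists diag unfolding ad_diagonalizable_def by blast
  note hw = S.string_decompositionD(1)[OF dec]
  have lev: "even (l i)" if "i \<in> {1..n}" for i
    using hw[OF that] even unfolding S.highest_weight_def by blast
  have T: "image_mset (\<lambda>i. l i div 2) (mset_set {1..n}) = T"
  proof (rule multiset_eq_if_tails_eq)
    fix m
    have "{i\<in>{1..n}. 2 * m \<le> l i \<and> even (l i - 2 * m)} = {i\<in>{1..n}. m \<le> l i div 2}"
      using lev by auto
    then show "size {#x \<in># image_mset (\<lambda>i. l i div 2) (mset_set {1..n}). m \<le> x#} = size {#x \<in># T. m \<le> x#}"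
      using S.dim_weight_space[OF dec, of "2 * m"] dims[of m] by (simp add: size_filter_image_mset_set)
  qed
  have half: "image_mset of_nat T = image_mset (\<lambda>i. of_nat (l i) / 2 :: rat) (mset_set {1..n})"
    unfolding T[symmetric] image_mset.compositionality
  proof (rule image_mset_cong)
    fix i assume "i \<in># mset_set {1..n}"
    then have "even (l i)" using lev by simp
    then have "(of_nat (l i) :: rat) = of_nat (2 * (l i div 2))" by simp
    then show "(of_nat \<circ> (\<lambda>i. l i div 2)) i = of_nat (l i) / (2 :: rat)"
      by (simp only: of_nat_mult comp_apply)
  qed
  show ?thesis
  proof
    assume "is_weight_partition e W"
    then obtain h' f' n' V where W: "sl2_triple e h' f'" "direct_decomposition n' V"
      "\<And>i. i \<in> {1..n'} \<Longrightarrow> sl2_irreducible e h' f' (V i)"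
      "W = image_mset (\<lambda>i. (of_nat (dim (V i)) - 1) / 2) (mset_set {1..n'})"
      unfolding is_weight_partition_def by blast
    interpret S': sl2_module scale "bracket e" "bracket h'" "bracket f'"
      by (rule sl2_triple_module[OF W(1)])
    obtain p' l' where dec': "S'.string_decomposition n' p' l'"
      and dimV: "\<And>i. i \<in> {1..n'} \<Longrightarrow> dim (V i) = l' i + 1"
      using string_decomposition_of_irreducibles[OF nil W(1-3)] by blast
    have l'l: "image_mset l' (mset_set {1..n'}) = image_mset l (mset_set {1..n})"
      by (rule multiset_eq_if_tails_eq)
        (simp add: size_filter_image_mset_set S'.card_long_strings[OF dec', simplified]
          S.card_long_strings[OF dec, simplified])
    have "W = image_mset (\<lambda>i. of_nat (l' i) / 2) (mset_set {1..n'})"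
      unfolding W(4) by (rule image_mset_cong) (simp add: dimV)
    also have "\<dots> = image_mset (\<lambda>x. of_nat x / 2) (image_mset l' (mset_set {1..n'}))"
      by (simp add: image_mset.compositionality comp_def)
    also have "\<dots> = image_mset of_nat T"
      unfolding l'l half by (simp add: image_mset.compositionality comp_def)
    finally show "W = image_mset of_nat T" .
  next
    assume "W = image_mset of_nat T"
    then have W: "W = image_mset (\<lambda>i. (of_nat (dim (S.string (p i) (l i))) - 1) / 2) (mset_set {1..n})"
      unfolding half by (auto intro!: image_mset_cong simp: S.dim_string[OF hw])
    have irr: "sl2_irreducible e h f (S.string (p i) (l i))" if i: "i \<in> {1..n}" for i
      unfolding sl2_irreducible_def sl2_submodule_def
    proof (intro conjI ballI allI impI)
      show "S.string (p i) (l i) \<noteq> {0}"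
        using S.top_in_string[of "p i" "l i"] hw[OF i] by (auto simp: S.highest_weight_def)
      fix U assume "(subspace U \<and> (\<forall>v\<in>U. bracket e v \<in> U \<and> bracket h v \<in> U \<and> bracket f v \<in> U)) \<and>
        U \<subseteq> S.string (p i) (l i)"
      then show "U = {0} \<or> U = S.string (p i) (l i)"
        using S.string_irreducible[OF hw[OF i], of U] by blast
    qed (use S.string_invariant[OF hw[OF i]] S.subspace_string in auto)
    have "direct_decomposition n (\<lambda>i. S.string (p i) (l i))"
      using dec unfolding direct_decomposition_def S.string_decomposition_def by blast
    with triple irr W show "is_weight_partition e W"
      unfolding is_weight_partition_def by blast
  qed
qed

end

section \<open>A nondegenerate invariant form\<close>

context complex_vector_space
begin

text \<open>The basis is a parameter because the trace form is evaluated in an eigenbasis of \<open>h\<close>.\<close>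

definition trace :: "'g set \<Rightarrow> ('g \<Rightarrow> 'g) \<Rightarrow> complex" where
  "trace B T = (\<Sum>b\<in>B. representation B (T b) b)"

context
  fixes B :: "'g set"
  assumes B: "finite B" "independent B" "span B = UNIV"
begin

lemma expand: "(\<Sum>b\<in>B. representation B v b *\<^sub>C b) = v"
  using B by (intro sum_representation_eq) auto

lemma trace_add: "trace B (\<lambda>z. S z + T z) = trace B S + trace B T"
  using B by (simp add: trace_def representation_add sum.distrib)

lemma trace_diff: "trace B (\<lambda>z. S z - T z) = trace B S - trace B T"
  using B by (simp add: trace_def representation_diff sum_subtractf)

lemma trace_scale: "trace B (\<lambda>z. c *\<^sub>C T z) = c * trace B T"
  using B by (simp add: trace_def representation_scale sum_distrib_left)

lemma trace_commute:
  assumes S: "linear_op S" and T: "linear_op T"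
  shows "trace B (\<lambda>z. S (T z)) = trace B (\<lambda>z. T (S z))"
proof -
  have entry: "representation B (S (T b)) b
      = (\<Sum>a\<in>B. representation B (T b) a * representation B (S a) b)"
    if S: "linear_op S" for S T b
  proof -
    have "S (T b) = (\<Sum>a\<in>B. representation B (T b) a *\<^sub>C S a)"
      by (subst expand[of "T b", symmetric])
        (simp add: endo.linear_sum[OF S] endo.linear_scale[OF S])
    then show ?thesis
      using B by (simp add: representation_sum representation_scale)
  qed
  show ?thesis
    unfolding trace_def entry[OF S, of T] entry[OF T, of S]
    by (subst sum.swap) (simp add: mult.commute)
qed

end

text \<open>One summand for each eigenvalue, so that the summands are uniquely determined.\<close>

lemma eigenvector_expansion:
  assumes T: "linear_op T" and v: "v \<in> span {v. \<exists>c. T v = c *\<^sub>C v}"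
  obtains C u where "finite C" "\<And>c. c \<in> C \<Longrightarrow> T (u c) = c *\<^sub>C u c" "v = (\<Sum>c\<in>C. u c)"
proof -
  have "\<exists>C u. finite C \<and> (\<forall>c\<in>C. T (u c) = c *\<^sub>C u c) \<and> v = (\<Sum>c\<in>C. u c)"
    using v
  proof (induction rule: span_induct_alt)
    case base
    show ?case by (intro exI[of _ "{}"]) auto
  next
    case (step k x y)
    then obtain C u c where C: "finite C" "\<forall>c\<in>C. T (u c) = c *\<^sub>C u c" "y = (\<Sum>c\<in>C. u c)"
      and c: "T x = c *\<^sub>C x" by auto
    define w where "w d = (if d \<in> C then u d else 0)" for d
    define u' where "u' d = (if d = c then k *\<^sub>C x else 0) + w d" for d
    have "(\<Sum>d\<in>insert c C. u' d)
        = (\<Sum>d\<in>insert c C. if d = c then k *\<^sub>C x else 0) + (\<Sum>d\<in>insert c C. w d)"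
      by (simp only: u'_def sum.distrib)
    also have "(\<Sum>d\<in>insert c C. if d = c then k *\<^sub>C x else 0) = k *\<^sub>C x"
      by (subst sum.delta) (use C in auto)
    also have "(\<Sum>d\<in>insert c C. w d) = (\<Sum>d\<in>C. u d)"
      by (rule sum.mono_neutral_cong_right) (use C in \<open>auto simp: w_def\<close>)
    finally have "k *\<^sub>C x + y = (\<Sum>d\<in>insert c C. u' d)" using C(3) by simp
    moreover have "T (u' d) = d *\<^sub>C u' d" for d
      using C(2) c by (simp add: u'_def w_def endo.linear_add[OF T] endo.linear_scale[OF T]
          endo.linear_0[OF T] scale_right_distrib mult.commute)
    ultimately show ?case using C(1) by (intro exI[of _ "insert c C"] exI[of _ u']) auto
  qed
  then show ?thesis using that by blast
qed

end

context complex_lie_algebra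
begin

definition nondegenerate_form :: "('g \<Rightarrow> 'g \<Rightarrow> complex) \<Rightarrow> bool" where
  "nondegenerate_form \<kappa> \<longleftrightarrow>
     (\<forall>x y z. \<kappa> (x + y) z = \<kappa> x z + \<kappa> y z) \<and> (\<forall>c x z. \<kappa> (c *\<^sub>C x) z = c * \<kappa> x z) \<and>
     (\<forall>x y. \<kappa> x y = \<kappa> y x) \<and> (\<forall>x y z. \<kappa> (bracket x y) z = \<kappa> x (bracket y z)) \<and>
     (\<forall>x. (\<forall>y. \<kappa> x y = 0) \<longrightarrow> x = 0)"

text \<open>The radical of the trace form of the adjoint representation is an ideal.  It is not everything: in
  an eigenbasis of \<open>h\<close>, the value at \<open>(h, h)\<close> is a sum of squares of integers, namely of the weights
  of the \<open>sl\<^sub>2\<close>-module, and these are not all zero since \<open>[h, e] = 2 e \<noteq> 0\<close>.\<close>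

theorem nondegenerate_form_exists:
  assumes simple: "\<And>I. lie_ideal I \<Longrightarrow> I = {0} \<or> I = UNIV"
    and triple: "sl2_triple e h f" and diag: "ad_diagonalizable h" and e: "e \<noteq> 0"
  shows "\<exists>\<kappa>. nondegenerate_form \<kappa>"
proof -
  interpret S: sl2_module scale "bracket e" "bracket h" "bracket f"
    by (rule sl2_triple_module[OF triple])
  obtain B where B0: "B \<subseteq> {v. \<exists>c. bracket h v = c *\<^sub>C v}" "independent B"
    "{v. \<exists>c. bracket h v = c *\<^sub>C v} \<subseteq> span B"
    using maximal_independent_subset .
  have spB: "span B = UNIV"
    using span_mono[OF B0(3)] diag by (auto simp: ad_diagonalizable_def span_span)
  have finB: "finite B" using B0(2) by (rule finiteI_independent)
  note B = finB B0(2) spB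
  have "\<exists>z. bracket h b = of_int z *\<^sub>C b" if b: "b \<in> B" for b
  proof -
    obtain c where c: "bracket h b = c *\<^sub>C b" using b B0(1) by auto
    have "b \<noteq> 0" using b B0(2) dependent_zero by blast
    then show ?thesis using S.weight_integral[OF _ c] c by auto
  qed
  then obtain z where z: "\<And>b. b \<in> B \<Longrightarrow> bracket h b = of_int (z b) *\<^sub>C b" by metis
  define \<kappa> where "\<kappa> x y = trace B (\<lambda>v. bracket x (bracket y v))" for x y
  note tr = trace_add[OF B] trace_diff[OF B] trace_scale[OF B]
  have add: "\<kappa> (x + y) v = \<kappa> x v + \<kappa> y v" for x y v
    by (simp add: \<kappa>_def tr bracket_simps)
  have scale: "\<kappa> (c *\<^sub>C x) v = c * \<kappa> x v" for c x v
    by (simp add: \<kappa>_def tr bracket_simps)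
  have sym: "\<kappa> x y = \<kappa> y x" for x y
    unfolding \<kappa>_def by (rule trace_commute[OF B linear_bracket linear_bracket])
  have inv: "\<kappa> (bracket x y) w = \<kappa> x (bracket y w)" for x y w
  proof -
    have der: "bracket (bracket a b) c = bracket a (bracket b c) - bracket b (bracket a c)" for a b c
      using bracket_derivation[of a b c] by (simp add: algebra_simps)
    have lin: "linear_op (\<lambda>v. bracket x (bracket w v))"
      by (rule linear_opI) (simp_all add: bracket_simps)
    have "trace B (\<lambda>v. bracket y (bracket x (bracket w v))) = trace B (\<lambda>v. bracket x (bracket w (bracket y v)))"
      by (rule trace_commute[OF B linear_bracket lin])
    then show ?thesis
      by (simp add: \<kappa>_def der bracket_simps tr)
  qed
  define R where "R = {x. \<forall>y. \<kappa> x y = 0}"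
  have "lie_ideal R"
    unfolding lie_ideal_def
  proof (intro conjI allI ballI)
    have "\<kappa> 0 y = 0" for y using scale[of 0 0 y] by simp
    then show "subspace R" by (intro subspaceI) (auto simp: R_def add scale)
    show "bracket x y \<in> R" if "y \<in> R" for x y
    proof -
      have "\<kappa> (bracket x y) w = 0" for w
      proof -
        have "\<kappa> (bracket x y) w = - \<kappa> (bracket y x) w"
          using scale[of "-1" "bracket y x" w] bracket_anticommute[of x y] by simp
        also have "\<kappa> (bracket y x) w = 0" using that inv by (simp add: R_def)
        finally show ?thesis by simp
      qed
      then show ?thesis by (simp add: R_def)
    qed
  qed
  then have "R = {0} \<or> R = UNIV" by (rule simple)
  moreover have "R \<noteq> UNIV"
  proof
    assume "R = UNIV"
    then have "\<kappa> h h = 0" by (auto simp: R_def)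
    moreover have "\<kappa> h h = of_int (\<Sum>b\<in>B. (z b)\<^sup>2)"
    proof -
      have "representation B (bracket h (bracket h b)) b = of_int ((z b)\<^sup>2)" if b: "b \<in> B" for b
      proof -
        have "representation B (bracket h (bracket h b)) b
            = of_int (z b) * (of_int (z b) * representation B b b)"
          using z[OF b] B by (simp add: bracket_simps representation_scale)
        also have "representation B b b = 1" using representation_basis[OF B(2) b] by simp
        finally show ?thesis by (simp add: power2_eq_square)
      qed
      then show ?thesis by (simp add: \<kappa>_def trace_def)
    qed
    ultimately have "(\<Sum>b\<in>B. (z b)\<^sup>2) = 0" by (simp only: of_int_eq_0_iff)
    then have "\<forall>b\<in>B. z b = 0" using finB by (simp add: sum_nonneg_eq_0_iff)
    then have hB: "bracket h b = 0" if "b \<in> B" for b using z[OF that] that by simp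
    have "bracket h v = 0" if "v \<in> span B" for v
      using that by (induction rule: span_induct_alt) (simp_all add: bracket_simps hB)
    then have "bracket h e = 0" using spB by auto
    then show False using triple e by (simp add: sl2_triple_def)
  qed
  ultimately have "R = {0}" by simp
  then have "\<forall>x. (\<forall>y. \<kappa> x y = 0) \<longrightarrow> x = 0" by (auto simp: R_def)
  then show ?thesis
    unfolding nondegenerate_form_def using add scale sym inv by (intro exI[of _ \<kappa>]) blast
qed

end

section \<open>Root spaces and coroots\<close>

locale lie_algebra_with_cartan = complex_lie_algebra scale bracket
  for scale :: "complex \<Rightarrow> 'g::ab_group_add \<Rightarrow> 'g" (infixr "*\<^sub>C" 75) and bracket +
  fixes H :: "'g set" and \<kappa> :: "'g \<Rightarrow> 'g \<Rightarrow> complex"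
  assumes cartan: "cartan_subalgebra H" and form: "nondegenerate_form \<kappa>"
begin

lemma subspace_H: "subspace H" and H_diag: "t \<in> H \<Longrightarrow> ad_diagonalizable t"
  and centralizer_H: "centralizer H = H"
  using cartan by (auto simp: cartan_subalgebra_def)

lemma H_abelian: "s \<in> H \<Longrightarrow> t \<in> H \<Longrightarrow> bracket s t = 0"
  using centralizer_H unfolding centralizer_def by blast

lemma form_simps: "\<kappa> (x + y) z = \<kappa> x z + \<kappa> y z" "\<kappa> (c *\<^sub>C x) z = c * \<kappa> x z"
  "\<kappa> z (x + y) = \<kappa> z x + \<kappa> z y" "\<kappa> z (c *\<^sub>C x) = c * \<kappa> z x"
  using form unfolding nondegenerate_form_def by metis+

lemma form_symmetric: "\<kappa> x y = \<kappa> y x"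
  and form_invariant: "\<kappa> (bracket x y) z = \<kappa> x (bracket y z)"
  and form_nondegenerate: "(\<And>y. \<kappa> x y = 0) \<Longrightarrow> x = 0"
  using form unfolding nondegenerate_form_def by blast+

lemma form_zero: "\<kappa> 0 y = 0" "\<kappa> y 0 = 0"
  using form_simps(2)[of 0 0 y] form_simps(4)[of y 0 0] by simp_all

lemma form_minus: "\<kappa> (- x) y = - \<kappa> x y"
  using form_simps(2)[of "-1" x y] by simp

lemma root_spaceD: "x \<in> root_space H \<phi> \<Longrightarrow> t \<in> H \<Longrightarrow> bracket t x = \<phi> t *\<^sub>C x"
  by (simp add: root_space_def)

lemma subspace_root_space: "subspace (root_space H \<phi>)"
  by (rule subspaceI) (auto simp: root_space_def bracket_simps scale_right_distrib mult.commute)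

lemma root_space_zero_eq: "(\<And>t. t \<in> H \<Longrightarrow> \<phi> t = 0) \<Longrightarrow> root_space H \<phi> = H"
  using centralizer_H unfolding root_space_def centralizer_def by simp

lemma root_space_cong: "(\<And>t. t \<in> H \<Longrightarrow> \<phi> t = \<psi> t) \<Longrightarrow> root_space H \<phi> = root_space H \<psi>"
  by (auto simp: root_space_def)

lemma bracket_root_space:
  assumes "x \<in> root_space H \<phi>" "y \<in> root_space H \<psi>" "\<And>t. t \<in> H \<Longrightarrow> \<chi> t = \<phi> t + \<psi> t"
  shows "bracket x y \<in> root_space H \<chi>"
  using assms bracket_derivation
  by (simp add: root_space_def bracket_simps scale_left_distrib)

text \<open>Expand a common eigenvector of \<open>S\<close> into eigenvectors of a further element \<open>s\<close>.  Since \<open>s\<close> commutes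
  with \<open>t \<in> S\<close>, the components of \<open>[t, v] - a v = 0\<close> are eigenvectors for the same eigenvalues of
  \<open>s\<close>, hence vanish separately.\<close>

lemma common_eigenvectors_span:
  assumes "finite S" "S \<subseteq> H"
  shows "span {v. \<forall>t\<in>S. \<exists>c. bracket t v = c *\<^sub>C v} = UNIV"
  using assms
proof (induction S rule: finite_induct)
  case empty
  show ?case by simp
next
  case (insert s S)
  let ?X = "{v. \<forall>t\<in>S. \<exists>c. bracket t v = c *\<^sub>C v}"
  let ?Y = "{v. \<forall>t\<in>insert s S. \<exists>c. bracket t v = c *\<^sub>C v}"
  have "?X \<subseteq> span ?Y"
  proof
    fix v assume v: "v \<in> ?X"
    have "v \<in> span {v. \<exists>c. bracket s v = c *\<^sub>C v}"
      using H_diag[of s] insert.prems by (simp add: ad_diagonalizable_def)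
    from eigenvector_expansion[OF linear_bracket this] obtain C u where C: "finite C"
      "\<And>c. c \<in> C \<Longrightarrow> bracket s (u c) = c *\<^sub>C u c" "v = (\<Sum>c\<in>C. u c)" by blast
    have "u c \<in> ?Y" if c: "c \<in> C" for c
    proof -
      have "\<exists>a. bracket t (u c) = a *\<^sub>C u c" if t: "t \<in> S" for t
      proof -
        obtain a where a: "bracket t v = a *\<^sub>C v" using v t by auto
        have st: "bracket s t = 0" using insert.prems t by (intro H_abelian) auto
        have "\<forall>c\<in>C. bracket t (u c) - a *\<^sub>C u c = 0"
        proof (rule weight_vectors_sum_zero[where T = "\<lambda>_::unit. bracket s" and S = UNIV
              and w = "\<lambda>c _. c"])
          show "bracket s (bracket t (u d) - a *\<^sub>C u d) = d *\<^sub>C (bracket t (u d) - a *\<^sub>C u d)"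
            if "d \<in> C" for d
            using C(2)[OF that] bracket_derivation[of s t "u d"] st
            by (simp add: bracket_simps scale_right_diff_distrib mult.commute)
          show "(\<Sum>c\<in>C. bracket t (u c) - a *\<^sub>C u c) = 0"
            using a unfolding C(3)
            by (simp add: sum_subtractf scale_sum_right endo.linear_sum[OF linear_bracket])
        qed (use C(1) linear_bracket in auto)
        then show ?thesis using c by auto
      qed
      then show ?thesis using C(2)[OF c] by auto
    qed
    then show "v \<in> span ?Y" unfolding C(3) by (intro span_sum span_base)
  qed
  then have "span ?X \<subseteq> span ?Y" using span_mono[of ?X "span ?Y"] span_span by simp
  then show ?case using insert by auto
qed

text \<open>It is enough to diagonalize a finite basis of \<open>H\<close>; the eigenvalues on a common eigenvector then
  depend linearly on the element of \<open>H\<close>.\<close>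

theorem root_spaces_span: "span (\<Union>\<phi>\<in>dual H. root_space H \<phi>) = UNIV"
proof -
  obtain B where B: "B \<subseteq> H" "independent B" "H \<subseteq> span B"
    using maximal_independent_subset .
  have finB: "finite B" using B(2) by (rule finiteI_independent)
  have "{v. \<forall>t\<in>B. \<exists>c. bracket t v = c *\<^sub>C v} \<subseteq> span (\<Union>\<phi>\<in>dual H. root_space H \<phi>)"
  proof clarify
    fix v assume v: "\<forall>t\<in>B. \<exists>c. bracket t v = c *\<^sub>C v"
    show "v \<in> span (\<Union>\<phi>\<in>dual H. root_space H \<phi>)"
    proof (cases "v = 0")
      case False
      have "subspace {t. \<exists>c. bracket t v = c *\<^sub>C v}"
      proof (rule subspaceI)
        show "0 \<in> {t. \<exists>c. bracket t v = c *\<^sub>C v}" by (auto simp: bracket_simps intro: exI[of _ 0])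
        show "s + t \<in> {t. \<exists>c. bracket t v = c *\<^sub>C v}"
          if "s \<in> {t. \<exists>c. bracket t v = c *\<^sub>C v}" "t \<in> {t. \<exists>c. bracket t v = c *\<^sub>C v}" for s t
          using that by (auto simp: bracket_simps scale_left_distrib[symmetric])
        show "k *\<^sub>C t \<in> {t. \<exists>c. bracket t v = c *\<^sub>C v}" if "t \<in> {t. \<exists>c. bracket t v = c *\<^sub>C v}" for k t
          using that by (auto simp: bracket_simps)
      qed
      then have "span B \<subseteq> {t. \<exists>c. bracket t v = c *\<^sub>C v}"
        by (intro span_minimal) (use v in auto)
      then have "\<forall>t\<in>H. \<exists>c. bracket t v = c *\<^sub>C v" using B(3) by blast
      then obtain \<psi> where \<psi>: "\<And>t. t \<in> H \<Longrightarrow> bracket t v = \<psi> t *\<^sub>C v" by metis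
      define \<phi> where "\<phi> t = (if t \<in> H then \<psi> t else 0)" for t
      have \<phi>: "bracket t v = \<phi> t *\<^sub>C v" if "t \<in> H" for t using \<psi> that by (simp add: \<phi>_def)
      have "\<phi> \<in> dual H"
        unfolding dual_def
      proof (intro CollectI conjI ballI allI impI)
        fix s t assume st: "s \<in> H" "t \<in> H"
        have "\<phi> (s + t) *\<^sub>C v = (\<phi> s + \<phi> t) *\<^sub>C v"
          by (simp only: \<phi>[OF subspace_add[OF subspace_H st], symmetric])
            (simp add: bracket_simps scale_left_distrib \<phi> st)
        then show "\<phi> (s + t) = \<phi> s + \<phi> t" using False by (metis scale_cancel_right)
      next
        fix c t assume t: "t \<in> H"
        have "\<phi> (c *\<^sub>C t) *\<^sub>C v = (c * \<phi> t) *\<^sub>C v"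
          by (simp only: \<phi>[OF subspace_scale[OF subspace_H t], symmetric])
            (simp add: bracket_simps \<phi>[OF t])
        then show "\<phi> (c *\<^sub>C t) = c * \<phi> t" using False by (metis scale_cancel_right)
      qed (simp add: \<phi>_def)
      moreover have "v \<in> root_space H \<phi>" using \<phi> by (simp add: root_space_def)
      ultimately show ?thesis by (intro span_base) auto
    qed (simp add: span_zero)
  qed
  then have "span {v. \<forall>t\<in>B. \<exists>c. bracket t v = c *\<^sub>C v} \<subseteq> span (\<Union>\<phi>\<in>dual H. root_space H \<phi>)"
    by (rule span_minimal) (rule subspace_span)
  then show ?thesis using common_eigenvectors_span[OF finB B(1)] by auto
qed

lemma form_orthogonal:
  assumes "x \<in> root_space H \<phi>" "y \<in> root_space H \<psi>" "s \<in> H" "\<phi> s + \<psi> s \<noteq> 0"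
  shows "\<kappa> x y = 0"
proof -
  have "\<phi> s * \<kappa> x y = \<kappa> (bracket s x) y" using root_spaceD[OF assms(1,3)] by (simp add: form_simps)
  also have "\<dots> = - \<kappa> x (bracket s y)"
    using bracket_anticommute[of s x] by (simp add: form_minus form_invariant)
  also have "\<dots> = - \<psi> s * \<kappa> x y" using root_spaceD[OF assms(2,3)] by (simp add: form_simps)
  finally have "(\<phi> s + \<psi> s) * \<kappa> x y = 0" by (simp add: algebra_simps)
  then show ?thesis using assms(4) by simp
qed

lemma form_pairing_root_spaces:
  assumes "x \<noteq> 0"
  obtains \<psi> y where "\<psi> \<in> dual H" "y \<in> root_space H \<psi>" "\<kappa> x y \<noteq> 0"
proof -
  have "\<exists>\<psi>\<in>dual H. \<exists>y\<in>root_space H \<psi>. \<kappa> x y \<noteq> 0"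
  proof (rule ccontr)
    assume *: "\<not> ?thesis"
    have "\<kappa> x y = 0" if "y \<in> span (\<Union>\<phi>\<in>dual H. root_space H \<phi>)" for y
      using that by (induction rule: span_induct_alt) (use * in \<open>auto simp: form_simps form_zero\<close>)
    then show False using form_nondegenerate[of x] root_spaces_span assms by auto
  qed
  then show ?thesis using that by blast
qed

lemma dualD:
  assumes "\<phi> \<in> dual H"
  shows "s \<in> H \<Longrightarrow> t \<in> H \<Longrightarrow> \<phi> (s + t) = \<phi> s + \<phi> t" "t \<in> H \<Longrightarrow> \<phi> (c *\<^sub>C t) = c * \<phi> t"
    "t \<notin> H \<Longrightarrow> \<phi> t = 0" "\<phi> 0 = 0"
proof -
  show "\<phi> 0 = 0"
  proof -
    have "\<phi> (0 *\<^sub>C 0) = 0 * \<phi> 0"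
      using assms subspace_0[OF subspace_H] unfolding dual_def by blast
    then show ?thesis by simp
  qed
qed (use assms in \<open>auto simp: dual_def\<close>)

lemma rootsD:
  assumes "\<phi> \<in> roots H"
  shows "\<phi> \<in> dual H" "\<exists>t\<in>H. \<phi> t \<noteq> 0" "\<exists>x\<in>root_space H \<phi>. x \<noteq> 0"
proof -
  show d: "\<phi> \<in> dual H" using assms by (simp add: roots_def)
  show "\<exists>t\<in>H. \<phi> t \<noteq> 0"
  proof -
    have "\<phi> \<noteq> (\<lambda>_. 0)" using assms by (simp add: roots_def)
    then obtain t where "\<phi> t \<noteq> 0" by blast
    then show ?thesis using dualD(3)[OF d, of t] by blast
  qed
  show "\<exists>x\<in>root_space H \<phi>. x \<noteq> 0"
    using assms subspace_0[OF subspace_root_space, of \<phi>] by (auto simp: roots_def)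
qed

end

text \<open>A nondegenerate invariant form does not exclude a centre, and \<open>[x, y]\<close> can be central for \<open>x\<close> and
  \<open>y\<close> in opposite root spaces: this happens in the oscillator algebra, the Heisenberg algebra extended
  by a derivation.\<close>

locale semisimple_with_cartan = lie_algebra_with_cartan scale bracket H \<kappa>
  for scale :: "complex \<Rightarrow> 'g::ab_group_add \<Rightarrow> 'g" (infixr "*\<^sub>C" 75) and bracket H \<kappa> +
  assumes centerless: "(\<And>y. bracket x y = 0) \<Longrightarrow> x = 0"
begin

lemma form_nondegenerate_on_H:
  assumes z: "z \<in> H" "\<And>t. t \<in> H \<Longrightarrow> \<kappa> t z = 0"
  shows "z = 0"
proof (rule ccontr)
  assume "z \<noteq> 0"
  then obtain \<psi> y where y: "\<psi> \<in> dual H" "y \<in> root_space H \<psi>" "\<kappa> z y \<noteq> 0"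
    by (rule form_pairing_root_spaces)
  have "z \<in> root_space H (\<lambda>_. 0)" using z(1) root_space_zero_eq[of "\<lambda>_. 0"] by simp
  then have "\<psi> s = 0" if "s \<in> H" for s
    using form_orthogonal[of z "\<lambda>_. 0" y \<psi> s] y that by auto
  then have "y \<in> H" using y(2) root_space_zero_eq by blast
  then show False using z(2) y(3) form_symmetric by metis
qed

lemma bracket_opposite:
  assumes "x \<in> root_space H \<phi>" "y \<in> root_space H (\<lambda>s. - \<phi> s)"
  shows "bracket x y \<in> H" and "t \<in> H \<Longrightarrow> \<kappa> t (bracket x y) = \<phi> t * \<kappa> x y"
proof -
  have "bracket x y \<in> root_space H (\<lambda>_. 0)"
    by (rule bracket_root_space[OF assms]) simp
  then show "bracket x y \<in> H" using root_space_zero_eq[of "\<lambda>_. 0"] by simp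
  show "\<kappa> t (bracket x y) = \<phi> t * \<kappa> x y" if "t \<in> H"
    using root_spaceD[OF assms(1) that] by (simp add: form_invariant[symmetric] form_simps)
qed

text \<open>By invariance \<open>\<kappa>(t, [x, y]) = \<phi>(t) \<kappa>(x, y)\<close>, so \<open>[x, y]\<close> is \<open>\<kappa>(x, y)\<close> times an element of \<open>H\<close>
  that depends on \<open>\<phi>\<close> only.\<close>

lemma bracket_opposite_proportional:
  assumes "x \<in> root_space H \<phi>" "y \<in> root_space H (\<lambda>s. - \<phi> s)"
    and "x' \<in> root_space H \<phi>" "y' \<in> root_space H (\<lambda>s. - \<phi> s)"
  shows "\<kappa> x y *\<^sub>C bracket x' y' = \<kappa> x' y' *\<^sub>C bracket x y"
proof -
  let ?z = "\<kappa> x y *\<^sub>C bracket x' y' + (- \<kappa> x' y') *\<^sub>C bracket x y"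
  have "?z = 0"
  proof (rule form_nondegenerate_on_H)
    show "?z \<in> H"
      using bracket_opposite(1)[OF assms(1,2)] bracket_opposite(1)[OF assms(3,4)]
      by (intro subspace_add[OF subspace_H] subspace_scale[OF subspace_H])
    show "\<kappa> t ?z = 0" if "t \<in> H" for t
      using bracket_opposite(2)[OF assms(1,2) that] bracket_opposite(2)[OF assms(3,4) that]
      by (simp only: form_simps) simp
  qed
  then show ?thesis by simp
qed

lemma opposite_pairing:
  assumes "x \<in> root_space H \<phi>" "x \<noteq> 0"
  obtains y where "y \<in> root_space H (\<lambda>s. - \<phi> s)" "\<kappa> x y \<noteq> 0"
proof -
  obtain \<psi> y where y: "\<psi> \<in> dual H" "y \<in> root_space H \<psi>" "\<kappa> x y \<noteq> 0"
    by (rule form_pairing_root_spaces[OF assms(2)])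
  have "\<psi> s = - \<phi> s" if "s \<in> H" for s
  proof -
    have "\<phi> s + \<psi> s = 0" using form_orthogonal[OF assms(1) y(2) that] y(3) by blast
    then show ?thesis by (simp add: add_eq_0_iff)
  qed
  then have "root_space H \<psi> = root_space H (\<lambda>s. - \<phi> s)" by (rule root_space_cong)
  with y that show ?thesis by simp
qed

lemma bracket_funpow_root_space:
  assumes x: "x \<in> root_space H \<phi>" and v: "v \<in> root_space H \<psi>"
  shows "(bracket x ^^ n) v \<in> root_space H (\<lambda>t. \<psi> t + of_nat n * \<phi> t)"
proof (induction n)
  case (Suc n)
  have "bracket x ((bracket x ^^ n) v) \<in> root_space H (\<lambda>t. \<psi> t + of_nat (Suc n) * \<phi> t)"
    by (rule bracket_root_space[OF x Suc]) (simp add: algebra_simps)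
  then show ?case by simp
qed (use v in simp)

lemma root_string_vanishes:
  assumes x: "x \<in> root_space H \<phi>" and v: "v \<in> root_space H \<psi>" and s: "s \<in> H" "\<phi> s \<noteq> 0"
  shows "\<exists>n. (bracket x ^^ n) v = 0"
proof (rule weight_sequence_vanishes[OF linear_bracket])
  show "bracket s ((bracket x ^^ n) v) = (\<psi> s + of_nat n * \<phi> s) *\<^sub>C (bracket x ^^ n) v" for n
    by (rule root_spaceD[OF bracket_funpow_root_space[OF x v] s(1)])
  show "inj (\<lambda>n. \<psi> s + of_nat n * \<phi> s)" using s(2) by (auto simp: inj_def)
qed

text \<open>Otherwise \<open>x\<close>, \<open>y\<close> and \<open>t = [x, y]\<close> span a Heisenberg algebra.  If \<open>t\<close> acts on a weight vector by
  a scalar \<open>c \<noteq> 0\<close>, take \<open>w \<noteq> 0\<close> at the end of its \<open>x\<close>-string; then \<open>[x, y\<^sup>k\<^sup>+\<^sup>1 w] = (k + 1) c y\<^sup>k w\<close>, so the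
  \<open>y\<close>-string of \<open>w\<close> never ends.  Hence \<open>t\<close> is central, so zero, although \<open>\<kappa>(s, t) \<noteq> 0\<close>.\<close>

lemma root_nonzero_on_bracket:
  assumes \<phi>: "s \<in> H" "\<phi> s \<noteq> 0"
    and x: "x \<in> root_space H \<phi>" and y: "y \<in> root_space H (\<lambda>s. - \<phi> s)" and xy: "\<kappa> x y \<noteq> 0"
  shows "\<phi> (bracket x y) \<noteq> 0"
proof
  define t where "t = bracket x y"
  assume "\<phi> (bracket x y) = 0"
  then have \<phi>t: "\<phi> t = 0" by (simp add: t_def)
  have t: "t \<in> H" unfolding t_def by (rule bracket_opposite[OF x y])
  have tx: "bracket t x = 0" "bracket t y = 0"
    using root_spaceD[OF x t] root_spaceD[OF y t] \<phi>t by simp_all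
  have \<psi>t: "\<psi> t = 0" if v: "v \<in> root_space H \<psi>" "v \<noteq> 0" for \<psi> v
  proof (rule ccontr)
    assume c: "\<psi> t \<noteq> 0"
    obtain n where n: "(bracket x ^^ n) v \<noteq> 0" "(bracket x ^^ Suc n) v = 0"
      using least_vanishing[OF root_string_vanishes[OF x v(1) \<phi>] v(2)] .
    define w where "w = (bracket x ^^ n) v"
    have tX: "bracket t ((bracket z ^^ m) u) = \<psi> t *\<^sub>C (bracket z ^^ m) u"
      if "bracket t z = 0" "bracket t u = \<psi> t *\<^sub>C u" for z u m
      by (induction m) (use that bracket_derivation[of t z] in \<open>auto simp: bracket_simps\<close>)
    have tw: "bracket t w = \<psi> t *\<^sub>C w"
      unfolding w_def by (rule tX[OF tx(1) root_spaceD[OF v(1) t]])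
    have xw: "bracket x w = 0" using n by (simp add: w_def)
    obtain \<chi> where \<chi>: "w \<in> root_space H \<chi>"
      using bracket_funpow_root_space[OF x v(1), of n] unfolding w_def by blast
    have "w \<noteq> 0" using n(1) by (simp add: w_def)
    moreover have "\<exists>m. (bracket y ^^ m) w = 0"
      using root_string_vanishes[OF y \<chi> \<phi>(1)] \<phi>(2) by simp
    ultimately obtain m where m: "(bracket y ^^ m) w \<noteq> 0" "(bracket y ^^ Suc m) w = 0"
      using least_vanishing by blast
    have "bracket x ((bracket y ^^ Suc k) w) = (of_nat (Suc k) * \<psi> t) *\<^sub>C (bracket y ^^ k) w" for k
    proof (induction k)
      case 0
      show ?case using bracket_derivation[of x y w] xw tw by (simp add: t_def bracket_simps)
    next
      case (Suc k)
      let ?u = "(bracket y ^^ Suc k) w"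
      have "bracket x (bracket y ?u) = bracket t ?u + bracket y (bracket x ?u)"
        using bracket_derivation[of x y ?u] by (simp add: t_def)
      also have "\<dots> = \<psi> t *\<^sub>C ?u + (of_nat (Suc k) * \<psi> t) *\<^sub>C ?u"
        unfolding tX[OF tx(2) tw] Suc by (simp add: bracket_simps)
      also have "\<dots> = (of_nat (Suc (Suc k)) * \<psi> t) *\<^sub>C ?u"
        by (simp only: scale_left_distrib[symmetric]) (simp add: algebra_simps)
      finally show ?case by simp
    qed
    from this[of m] have "(of_nat (Suc m) * \<psi> t) *\<^sub>C (bracket y ^^ m) w = 0"
      using m(2) by (simp add: bracket_simps del: of_nat_Suc)
    then show False using m(1) c by (simp del: of_nat_Suc)
  qed
  have central: "bracket t v = 0" if "v \<in> span (\<Union>\<phi>\<in>dual H. root_space H \<phi>)" for v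
    using that
  proof (induction rule: span_induct_alt)
    case (step c u v)
    then obtain \<psi> where u: "u \<in> root_space H \<psi>" by blast
    have "bracket t u = 0"
      using root_spaceD[OF u t] \<psi>t[OF u] by (cases "u = 0") (simp_all add: bracket_simps)
    with step show ?case by (simp add: bracket_simps)
  qed (simp add: bracket_simps)
  have "t = 0" by (rule centerless, rule central) (simp only: root_spaces_span UNIV_I)
  then have "\<phi> s * \<kappa> x y = 0"
    using bracket_opposite(2)[OF x y \<phi>(1)] by (simp add: t_def form_zero)
  then show False using \<phi>(2) xy by simp
qed

text \<open>Any element normalized by \<open>\<phi>(t) = 2\<close> on the line spanned by the brackets of the two opposite root
  spaces is the coroot; in particular the description defining \<open>coroot\<close> denotes.\<close>

theorem root_sl2_triple:
  assumes \<phi>: "\<phi> \<in> roots H" and x: "x \<in> root_space H \<phi>" "x \<noteq> 0"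
  obtains y where "y \<in> root_space H (\<lambda>s. - \<phi> s)" "sl2_triple x (coroot H \<phi>) y"
proof -
  note \<phi>' = rootsD[OF \<phi>]
  obtain s where s: "s \<in> H" "\<phi> s \<noteq> 0" using \<phi>' by blast
  obtain y0 where y0: "y0 \<in> root_space H (\<lambda>s. - \<phi> s)" "\<kappa> x y0 \<noteq> 0"
    using opposite_pairing[OF x] .
  define a where "a = 2 / \<phi> (bracket x y0)"
  have nz: "\<phi> (bracket x y0) \<noteq> 0" by (rule root_nonzero_on_bracket[OF s x(1) y0])
  define y where "y = a *\<^sub>C y0"
  define t where "t = bracket x y"
  have y: "y \<in> root_space H (\<lambda>s. - \<phi> s)"
    unfolding y_def by (rule subspace_scale[OF subspace_root_space y0(1)])
  have xy: "\<kappa> x y \<noteq> 0" using y0(2) nz by (simp add: y_def a_def form_simps)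
  have t: "t \<in> H" unfolding t_def by (rule bracket_opposite[OF x(1) y])
  have \<phi>t: "\<phi> t = 2"
  proof -
    have "t = a *\<^sub>C bracket x y0" by (simp add: t_def y_def bracket_simps)
    then show ?thesis using dualD(2)[OF \<phi>'(1) bracket_opposite(1)[OF x(1) y0(1)], of a] nz
      by (simp add: a_def)
  qed
  let ?S = "{bracket x y | x y. x \<in> root_space H \<phi> \<and> y \<in> root_space H (\<lambda>s. - \<phi> s)}"
  have "?S \<subseteq> span {t}"
  proof clarify
    fix x' y' assume "x' \<in> root_space H \<phi>" "y' \<in> root_space H (\<lambda>s. - \<phi> s)"
    from bracket_opposite_proportional[OF x(1) y this]
    have "bracket x' y' = (\<kappa> x' y' / \<kappa> x y) *\<^sub>C t"
      unfolding t_def using xy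
      by (metis (no_types) divide_inverse mult.commute scale_scale scale_one left_inverse)
    then show "bracket x' y' \<in> span {t}" by (auto intro: span_scale span_base)
  qed
  then have span_S: "span ?S \<subseteq> span {t}" by (rule span_minimal) (rule subspace_span)
  have "coroot H \<phi> = t"
    unfolding coroot_def
  proof (rule the_equality)
    show "t \<in> span ?S \<and> \<phi> t = 2" using x(1) y \<phi>t by (auto simp: t_def intro!: span_base)
    fix t' assume t': "t' \<in> span ?S \<and> \<phi> t' = 2"
    then have "t' \<in> span {t}" using span_S by blast
    then obtain c where c: "t' = c *\<^sub>C t" by (auto simp: span_singleton)
    then have "c = 1" using t' \<phi>t dualD(2)[OF \<phi>'(1) t, of c] by simp
    then show "t' = t" using c by simp
  qed
  then have "sl2_triple x (coroot H \<phi>) y"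
    using root_spaceD[OF x(1) t] root_spaceD[OF y t] \<phi>t by (simp add: sl2_triple_def t_def)
  with y show ?thesis by (rule that)
qed

lemma coroot_in_H: "\<phi> \<in> roots H \<Longrightarrow> coroot H \<phi> \<in> H"
  and root_coroot: "\<phi> \<in> roots H \<Longrightarrow> \<phi> (coroot H \<phi>) = 2"
proof -
  assume \<phi>: "\<phi> \<in> roots H"
  obtain x where x: "x \<in> root_space H \<phi>" "x \<noteq> 0" using rootsD[OF \<phi>] by blast
  obtain y where y: "y \<in> root_space H (\<lambda>s. - \<phi> s)" "sl2_triple x (coroot H \<phi>) y"
    using root_sl2_triple[OF \<phi> x] .
  show H: "coroot H \<phi> \<in> H"
    using bracket_opposite(1)[OF x(1) y(1)] y(2) by (simp add: sl2_triple_def)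
  have "\<phi> (coroot H \<phi>) *\<^sub>C x = 2 *\<^sub>C x"
    using root_spaceD[OF x(1) H] y(2) by (simp add: sl2_triple_def)
  then show "\<phi> (coroot H \<phi>) = 2" using x(2) by simp
qed

lemma bracket_opposite_coroot:
  assumes \<phi>: "\<phi> \<in> roots H" and x: "x \<in> root_space H \<phi>" and y: "y \<in> root_space H (\<lambda>s. - \<phi> s)"
  shows "\<exists>c. bracket x y = c *\<^sub>C coroot H \<phi>"
proof (cases "x = 0")
  case True
  then show ?thesis by (intro exI[of _ 0]) (simp add: bracket_simps)
next
  case False
  then obtain y0 where y0: "y0 \<in> root_space H (\<lambda>s. - \<phi> s)" "sl2_triple x (coroot H \<phi>) y0"
    using root_sl2_triple[OF \<phi> x] by blast
  then have b: "bracket x y0 = coroot H \<phi>" by (simp add: sl2_triple_def)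
  have "\<kappa> x y0 \<noteq> 0"
  proof
    assume "\<kappa> x y0 = 0"
    then have "bracket x y0 = 0"
      using bracket_opposite[OF x y0(1)] by (intro form_nondegenerate_on_H) auto
    then show False using b root_coroot[OF \<phi>] dualD(4)[OF rootsD(1)[OF \<phi>]] by simp
  qed
  moreover have "\<kappa> x y0 *\<^sub>C bracket x y = \<kappa> x y *\<^sub>C coroot H \<phi>"
    using bracket_opposite_proportional[OF x y0(1) x y] b by simp
  ultimately have "bracket x y = (\<kappa> x y / \<kappa> x y0) *\<^sub>C coroot H \<phi>"
    by (metis (no_types) divide_inverse mult.commute scale_scale scale_one left_inverse)
  then show ?thesis ..
qed

text \<open>Subtracting a multiple of \<open>x\<close> from \<open>z\<close> makes its bracket with \<open>y\<close> vanish, but \<open>ad y\<close> is injective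
  on vectors of weight 2.\<close>

theorem root_space_one_dimensional:
  assumes \<phi>: "\<phi> \<in> roots H" and x: "x \<in> root_space H \<phi>" "x \<noteq> 0" and z: "z \<in> root_space H \<phi>"
  shows "\<exists>c. z = c *\<^sub>C x"
proof -
  obtain y where y: "y \<in> root_space H (\<lambda>s. - \<phi> s)" "sl2_triple x (coroot H \<phi>) y"
    using root_sl2_triple[OF \<phi> x] .
  interpret S: sl2_module scale "bracket x" "bracket (coroot H \<phi>)" "bracket y"
    by (rule sl2_triple_module[OF y(2)])
  obtain c where c: "bracket z y = c *\<^sub>C coroot H \<phi>"
    using bracket_opposite_coroot[OF \<phi> z y(1)] ..
  have w: "z - c *\<^sub>C x \<in> root_space H \<phi>"
    by (intro subspace_diff[OF subspace_root_space] subspace_scale[OF subspace_root_space] x z)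
  have "bracket (z - c *\<^sub>C x) y = 0"
    using c y(2) by (simp add: bracket_simps sl2_triple_def)
  then have "bracket y (z - c *\<^sub>C x) = 0" using bracket_anticommute[of y "z - c *\<^sub>C x"] by simp
  then have "z - c *\<^sub>C x = 0"
    using S.EF_injective[of "z - c *\<^sub>C x" 2] root_spaceD[OF w coroot_in_H[OF \<phi>]] root_coroot[OF \<phi>]
    by (simp add: bracket_simps)
  then show ?thesis by auto
qed

text \<open>The operator \<open>ad x ad y\<close> is injective on vectors of positive weight.  On the root space of \<open>2 \<phi>\<close> it
  is zero, since \<open>ad y\<close> maps into the line of \<open>x\<close>; larger multiples are lowered to smaller ones.\<close>

theorem root_multiples:
  assumes \<phi>: "\<phi> \<in> roots H" and n: "2 \<le> n"
  shows "root_space H (\<lambda>t. of_nat n * \<phi> t) = {0}"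
proof -
  obtain x where x: "x \<in> root_space H \<phi>" "x \<noteq> 0" using rootsD[OF \<phi>] by blast
  obtain y where y: "y \<in> root_space H (\<lambda>s. - \<phi> s)" "sl2_triple x (coroot H \<phi>) y"
    using root_sl2_triple[OF \<phi> x] .
  interpret S: sl2_module scale "bracket x" "bracket (coroot H \<phi>)" "bracket y"
    by (rule sl2_triple_module[OF y(2)])
  have "z = 0" if "z \<in> root_space H (\<lambda>t. of_nat n * \<phi> t)" for z
    using n that
  proof (induction n arbitrary: z rule: dec_induct)
    case base
    have weight: "bracket (coroot H \<phi>) z = of_nat 4 *\<^sub>C z"
      using root_spaceD[OF base coroot_in_H[OF \<phi>]] root_coroot[OF \<phi>] by simp
    have "bracket y z \<in> root_space H \<phi>"
      by (rule bracket_root_space[OF y(1) base]) simp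
    then obtain c where "bracket y z = c *\<^sub>C x"
      using root_space_one_dimensional[OF \<phi> x] by blast
    then have "bracket x (bracket y z) = 0" by (simp add: bracket_simps)
    then show ?case using S.EF_injective[OF weight] by simp
  next
    case (step n)
    have weight: "bracket (coroot H \<phi>) z = of_nat (2 * Suc n) *\<^sub>C z"
      using root_spaceD[OF step.prems coroot_in_H[OF \<phi>]] root_coroot[OF \<phi>]
      by (simp add: algebra_simps)
    have "bracket y z \<in> root_space H (\<lambda>t. of_nat n * \<phi> t)"
      by (rule bracket_root_space[OF y(1) step.prems]) (simp add: algebra_simps)
    then have "bracket y z = 0" by (rule step.IH)
    then have "bracket x (bracket y z) = 0" by (simp add: bracket_simps)
    then show ?case using S.EF_injective[OF weight] by simp
  qed
  then show ?thesis using subspace_0[OF subspace_root_space] by blast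
qed

text \<open>The nonzero vector is \<open>(ad y)\<^sup>m v\<close> or \<open>(ad x)\<^sup>-\<^sup>m v\<close>, depending on the sign of \<open>m\<close>.\<close>

theorem weight_reflection:
  assumes \<alpha>: "\<alpha> \<in> roots H" and v: "v \<in> root_space H \<psi>" "v \<noteq> 0"
    and m: "\<psi> (coroot H \<alpha>) = of_int m"
  shows "\<exists>w\<in>root_space H (\<lambda>t. \<psi> t - of_int m * \<alpha> t). w \<noteq> 0"
proof -
  obtain x where x: "x \<in> root_space H \<alpha>" "x \<noteq> 0" using rootsD[OF \<alpha>] by blast
  obtain y where y: "y \<in> root_space H (\<lambda>s. - \<alpha> s)" "sl2_triple x (coroot H \<alpha>) y"
    using root_sl2_triple[OF \<alpha> x] .
  interpret S: sl2_module scale "bracket x" "bracket (coroot H \<alpha>)" "bracket y"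
    by (rule sl2_triple_module[OF y(2)])
  have weight: "bracket (coroot H \<alpha>) v = of_int m *\<^sub>C v"
    using root_spaceD[OF v(1) coroot_in_H[OF \<alpha>]] m by simp
  show ?thesis
  proof (cases "0 \<le> m")
    case True
    have "(bracket y ^^ nat m) v \<in> root_space H (\<lambda>t. \<psi> t - of_int m * \<alpha> t)"
      using bracket_funpow_root_space[OF y(1) v(1), of "nat m"] True by simp
    moreover have "(bracket y ^^ nat m) v \<noteq> 0"
      using S.F_pow_injective[of v "nat m" "nat m"] weight True v(2) by auto
    ultimately show ?thesis by blast
  next
    case False
    have "(bracket x ^^ nat (- m)) v \<in> root_space H (\<lambda>t. \<psi> t - of_int m * \<alpha> t)"
      using bracket_funpow_root_space[OF x(1) v(1), of "nat (- m)"] False by simp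
    moreover have "(bracket x ^^ nat (- m)) v \<noteq> 0"
      using sl2_module.F_pow_injective[OF S.swapped, of v "nat (- m)" "nat (- m)"] weight False v(2)
      by auto
    ultimately show ?thesis by blast
  qed
qed

lemma root_neg:
  assumes \<phi>: "\<phi> \<in> roots H" shows "(\<lambda>t. - \<phi> t) \<in> roots H"
proof -
  obtain x where x: "x \<in> root_space H \<phi>" "x \<noteq> 0" using rootsD[OF \<phi>] by blast
  obtain y where y: "y \<in> root_space H (\<lambda>s. - \<phi> s)" "\<kappa> x y \<noteq> 0"
    using opposite_pairing[OF x] .
  have "y \<noteq> 0" using y(2) form_zero by auto
  then show ?thesis
    using y(1) \<phi> unfolding roots_def dual_def by (auto simp: fun_eq_iff)
qed

theorem root_reflection:
  assumes \<alpha>: "\<alpha> \<in> roots H" and \<phi>: "\<phi> \<in> roots H" and m: "\<phi> (coroot H \<alpha>) = of_int m"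
  shows "(\<lambda>t. \<phi> t - of_int m * \<alpha> t) \<in> roots H"
proof -
  obtain v where v: "v \<in> root_space H \<phi>" "v \<noteq> 0" using rootsD[OF \<phi>] by blast
  have "(\<lambda>t. \<phi> t - of_int m * \<alpha> t) \<in> dual H"
    using rootsD(1)[OF \<alpha>] rootsD(1)[OF \<phi>] unfolding dual_def by (auto simp: algebra_simps)
  moreover have "(\<lambda>t. \<phi> t - of_int m * \<alpha> t) \<noteq> (\<lambda>_. 0)"
  proof
    assume "(\<lambda>t. \<phi> t - of_int m * \<alpha> t) = (\<lambda>_. 0)"
    then have eq: "\<phi> t = of_int m * \<alpha> t" for t by (simp add: fun_eq_iff)
    have "(of_int m :: complex) = of_int m * 2"
      using m eq[of "coroot H \<alpha>"] root_coroot[OF \<alpha>] by simp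
    then have "\<phi> t = 0" for t using eq[of t] by simp
    then show False using rootsD(2)[OF \<phi>] by blast
  qed
  ultimately show ?thesis
    using weight_reflection[OF \<alpha> v m] unfolding roots_def by blast
qed

text \<open>If \<open>\<beta> - \<alpha>\<close> is no weight, then \<open>v\<close> is a lowest weight vector for the triple of \<open>\<alpha>\<close>; weight zero
  means that it spans a trivial module.\<close>

lemma coroot_nonpos_if_difference_not_weight:
  assumes \<alpha>: "\<alpha> \<in> roots H" and diff: "root_space H (\<lambda>t. \<beta> t - \<alpha> t) = {0}"
    and x: "x \<in> root_space H \<alpha>" "x \<noteq> 0" and v: "v \<in> root_space H \<beta>" "v \<noteq> 0"
  obtains n where "\<beta> (coroot H \<alpha>) = - of_nat n" "n = 0 \<Longrightarrow> bracket x v = 0"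
proof -
  obtain y where y: "y \<in> root_space H (\<lambda>s. - \<alpha> s)" "sl2_triple x (coroot H \<alpha>) y"
    using root_sl2_triple[OF \<alpha> x] .
  interpret S: sl2_module scale "bracket x" "bracket (coroot H \<alpha>)" "bracket y"
    by (rule sl2_triple_module[OF y(2)])
  interpret S': sl2_module scale "bracket y" "\<lambda>v. - bracket (coroot H \<alpha>) v" "bracket x"
    by (rule S.swapped)
  have "bracket y v \<in> root_space H (\<lambda>t. \<beta> t - \<alpha> t)"
    by (rule bracket_root_space[OF y(1) v(1)]) simp
  then have "bracket y v = 0" using diff by blast
  moreover have "- bracket (coroot H \<alpha>) v = (- \<beta> (coroot H \<alpha>)) *\<^sub>C v"
    using root_spaceD[OF v(1) coroot_in_H[OF \<alpha>]] by simp
  ultimately obtain l where l: "- \<beta> (coroot H \<alpha>) = of_nat l" "(bracket x ^^ Suc l) v = 0"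
    using S'.highest_weight_natural[OF v(2)] by blast
  have "\<beta> (coroot H \<alpha>) = - of_nat l" using l(1) by (metis minus_minus)
  then show ?thesis using l(2) by (intro that[of l]) auto
qed

lemma coroot_zero_symmetric:
  assumes \<alpha>: "\<alpha> \<in> roots H" and \<beta>: "\<beta> \<in> roots H"
    and diff: "root_space H (\<lambda>t. \<beta> t - \<alpha> t) = {0}" "root_space H (\<lambda>t. \<alpha> t - \<beta> t) = {0}"
    and zero: "\<beta> (coroot H \<alpha>) = 0"
  shows "\<alpha> (coroot H \<beta>) = 0"
proof -
  obtain x where x: "x \<in> root_space H \<alpha>" "x \<noteq> 0" using rootsD[OF \<alpha>] by blast
  obtain v where v: "v \<in> root_space H \<beta>" "v \<noteq> 0" using rootsD[OF \<beta>] by blast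
  obtain n where "\<beta> (coroot H \<alpha>) = - of_nat n" "n = 0 \<Longrightarrow> bracket x v = 0"
    by (rule coroot_nonpos_if_difference_not_weight[OF \<alpha> diff(1) x v]) blast
  then have xv: "bracket x v = 0" using zero by simp
  obtain y where y: "y \<in> root_space H (\<lambda>s. - \<beta> s)" "sl2_triple v (coroot H \<beta>) y"
    using root_sl2_triple[OF \<beta> v] .
  have "bracket y x \<in> root_space H (\<lambda>t. \<alpha> t - \<beta> t)"
    by (rule bracket_root_space[OF y(1) x(1)]) simp
  then have yx: "bracket y x = 0" using diff(2) by blast
  have "bracket (bracket v y) x = 0"
    using bracket_derivation[of v y x] yx xv bracket_anticommute[of v x] by (simp add: bracket_simps)
  then have "\<alpha> (coroot H \<beta>) *\<^sub>C x = 0"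
    using root_spaceD[OF x(1) coroot_in_H[OF \<beta>]] y(2) by (simp add: sl2_triple_def)
  then show ?thesis using x(2) by simp
qed

end

section \<open>Coordinates for the Cartan matrix of type D\<close>

locale D_cartan = semisimple_with_cartan scale bracket H \<kappa>
  for scale :: "complex \<Rightarrow> 'g::ab_group_add \<Rightarrow> 'g" (infixr "*\<^sub>C" 75) and bracket H \<kappa> +
  fixes r :: nat and \<alpha> :: "nat \<Rightarrow> 'g \<Rightarrow> complex"
  assumes r: "4 \<le> r" and simple: "simple_roots H r \<alpha>" and labelled: "D_labelled H r \<alpha>"
begin

text \<open>As a label of a node, the index 1 must not be rewritten to a successor.\<close>

declare One_nat_def [simp del]

lemma simple_root: "i \<in> {1..r} \<Longrightarrow> \<alpha> i \<in> roots H"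
  using simple by (simp add: simple_roots_def)

lemma simple_combination_unique:
  assumes "\<And>t. (\<Sum>i = 1..r. c i * \<alpha> i t) = (\<Sum>i = 1..r. d i * \<alpha> i t)" "i \<in> {1..r}"
  shows "c i = d i"
proof -
  have unique: "\<forall>i\<in>{1..r}. c i = 0" if "(\<lambda>t. \<Sum>i = 1..r. c i * \<alpha> i t) = (\<lambda>_. 0)" for c
    using simple that unfolding simple_roots_def by blast
  have "(\<lambda>t. \<Sum>i = 1..r. (c i - d i) * \<alpha> i t) = (\<lambda>_. 0)"
    using assms(1) by (simp add: fun_eq_iff left_diff_distrib sum_subtractf)
  from unique[OF this] show ?thesis using assms(2) by auto
qed

lemma simple_root_as_combination:
  assumes "i \<in> {1..r}" shows "\<alpha> i t = (\<Sum>k = 1..r. (if k = i then 1 else 0) * \<alpha> k t)"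
proof -
  have "(\<Sum>k = 1..r. (if k = i then 1 else 0) * \<alpha> k t) = (\<Sum>k\<in>{i}. \<alpha> k t)"
    by (rule sum.mono_neutral_cong_right) (use assms in auto)
  then show ?thesis by simp
qed

lemma root_cases:
  assumes "\<phi> \<in> roots H"
  obtains c :: "nat \<Rightarrow> nat" where "\<And>t. \<phi> t = (\<Sum>i = 1..r. of_nat (c i) * \<alpha> i t)"
  | c :: "nat \<Rightarrow> nat" where "\<And>t. - \<phi> t = (\<Sum>i = 1..r. of_nat (c i) * \<alpha> i t)"
proof -
  have "nonneg_combination r \<alpha> \<phi> \<or> nonneg_combination r \<alpha> (\<lambda>t. - \<phi> t)"
    using assms simple by (simp add: simple_roots_def)
  then show ?thesis
    unfolding nonneg_combination_def fun_eq_iff using that by blast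
qed

lemma difference_not_weight:
  assumes ij: "i \<in> {1..r}" "j \<in> {1..r}" "i \<noteq> j"
  shows "root_space H (\<lambda>t. \<alpha> j t - \<alpha> i t) = {0}"
proof (rule ccontr)
  let ?\<phi> = "\<lambda>t. \<alpha> j t - \<alpha> i t"
  assume nz: "root_space H ?\<phi> \<noteq> {0}"
  define d where "d k = (if k = j then 1 else 0) - (if k = i then 1 else (0::complex))" for k
  have d: "?\<phi> t = (\<Sum>k = 1..r. d k * \<alpha> k t)" for t
    unfolding d_def left_diff_distrib sum_subtractf
    using simple_root_as_combination[OF ij(1), of t] simple_root_as_combination[OF ij(2), of t] by simp
  have "?\<phi> \<in> dual H"
    using rootsD(1)[OF simple_root[OF ij(1)]] rootsD(1)[OF simple_root[OF ij(2)]]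
    unfolding dual_def by (auto simp: algebra_simps)
  moreover have "?\<phi> \<noteq> (\<lambda>_. 0)"
  proof
    assume "?\<phi> = (\<lambda>_. 0)"
    then have "\<And>t. (\<Sum>k = 1..r. d k * \<alpha> k t) = (\<Sum>k = 1..r. 0 * \<alpha> k t)"
      by (simp only: d[symmetric] fun_eq_iff) simp
    from simple_combination_unique[OF this ij(1)] ij(3) show False by (simp add: d_def)
  qed
  ultimately have "?\<phi> \<in> roots H" using nz by (simp add: roots_def)
  then show False
  proof (cases rule: root_cases)
    case (1 c)
    have "d i = of_nat (c i)"
      by (rule simple_combination_unique[OF _ ij(1)]) (simp only: 1[symmetric] d)
    then have "of_nat (c i + 1) = d i + 1" by simp
    also have "d i + 1 = 0" using ij(3) by (simp add: d_def)
    finally have "of_nat (c i + 1) = (0::complex)" .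
    then show False by (simp only: of_nat_eq_0_iff)
  next
    case (2 c)
    have "- d j = of_nat (c j)"
      by (rule simple_combination_unique[OF _ ij(2)]) (simp only: 2[symmetric] d mult_minus_left sum_negf)
    then have "of_nat (c j + 1) = - d j + 1" by simp
    also have "- d j + 1 = 0" using ij(3) by (simp add: d_def)
    finally have "of_nat (c j + 1) = (0::complex)" .
    then show False by (simp only: of_nat_eq_0_iff)
  qed
qed

abbreviation hc :: "nat \<Rightarrow> 'g" where "hc i \<equiv> coroot H (\<alpha> i)"

text \<open>The labelling prescribes only the products \<open>a\<^sub>i\<^sub>j a\<^sub>j\<^sub>i\<close>.  As both factors are nonpositive integers,
  product 1 leaves only \<open>-1\<close> for both, and product 0 gives 0 for both, because the two entries vanish
  together.\<close>

theorem cartan_matrix: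
  assumes ij: "i \<in> {1..r}" "j \<in> {1..r}"
  shows "\<alpha> i (hc j) = (if i = j then 2 else if D_edge i j \<or> D_edge j i then - 1 else 0)"
proof (cases "i = j")
  case True
  then show ?thesis using root_coroot[OF simple_root[OF ij(1)]] by simp
next
  case False
  note diff = difference_not_weight[OF ij False] difference_not_weight[OF ij(2,1) False[symmetric]]
  have entry: "\<exists>n. \<alpha> l (hc m) = - of_nat n"
    if lm: "l \<in> {1..r}" "m \<in> {1..r}" "l \<noteq> m" for l m
  proof -
    obtain x where x: "x \<in> root_space H (\<alpha> m)" "x \<noteq> 0"
      using rootsD[OF simple_root[OF lm(2)]] by blast
    obtain v where v: "v \<in> root_space H (\<alpha> l)" "v \<noteq> 0"
      using rootsD[OF simple_root[OF lm(1)]] by blast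
    show ?thesis
      by (rule coroot_nonpos_if_difference_not_weight[OF simple_root[OF lm(2)]
            difference_not_weight[OF lm(2,1) lm(3)[symmetric]] x v]) blast
  qed
  obtain a where a: "\<alpha> i (hc j) = - of_nat a" using entry[OF ij False] ..
  obtain b where b: "\<alpha> j (hc i) = - of_nat b" using entry[OF ij(2,1) False[symmetric]] ..
  have prod: "(of_nat (a * b) :: complex) = (if D_edge i j \<or> D_edge j i then 1 else 0)"
  proof -
    have "\<alpha> i (hc j) * \<alpha> j (hc i) = (if D_edge i j \<or> D_edge j i then 1 else 0)"
      using labelled ij False unfolding D_labelled_def cartan_integer_def by blast
    then show ?thesis by (simp only: a b of_nat_mult minus_mult_minus)
  qed
  show ?thesis
  proof (cases "D_edge i j \<or> D_edge j i")
    case True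
    then have "(of_nat (a * b) :: complex) = of_nat 1" using prod by simp
    then have "a * b = 1" by (simp only: of_nat_eq_iff)
    then have "a = 1" by simp
    then show ?thesis using a True False by simp
  next
    case no: False
    then have "(of_nat (a * b) :: complex) = of_nat 0" using prod by simp
    then have "a * b = 0" by (simp only: of_nat_eq_iff)
    then have "a = 0 \<or> b = 0" by simp
    then have "\<alpha> i (hc j) = 0"
      using a b coroot_zero_symmetric[OF simple_root[OF ij(1)] simple_root[OF ij(2)] diff] by auto
    then show ?thesis using no False by simp
  qed
qed

text \<open>The usual orthogonal coordinates: \<open>\<alpha>\<^sub>1 = \<delta>\<^sub>1 + \<delta>\<^sub>2\<close>, \<open>\<alpha>\<^sub>2 = \<delta>\<^sub>2 - \<delta>\<^sub>1\<close> and
  \<open>\<alpha>\<^sub>i = \<delta>\<^sub>i - \<delta>\<^sub>i\<^sub>-\<^sub>1\<close> for \<open>i \<ge> 3\<close>.  The same formulas in the coroots give the elements \<open>u i\<close> of \<open>H\<close>,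
  which turn out to be the dual basis.\<close>

definition \<delta> :: "nat \<Rightarrow> 'g \<Rightarrow> complex" where
  "\<delta> i t = (if i = 1 then (\<alpha> 1 t - \<alpha> 2 t) / 2 else (\<alpha> 1 t + \<alpha> 2 t) / 2 + (\<Sum>j = 3..i. \<alpha> j t))"

definition u :: "nat \<Rightarrow> 'g" where
  "u i = (if i = 1 then (1 / 2) *\<^sub>C (hc 1 - hc 2) else (1 / 2) *\<^sub>C (hc 1 + hc 2) + (\<Sum>j = 3..i. hc j))"

lemma \<delta>_rec: "\<delta> 1 t = (\<alpha> 1 t - \<alpha> 2 t) / 2" "\<delta> 2 t = (\<alpha> 1 t + \<alpha> 2 t) / 2"
  "2 \<le> i \<Longrightarrow> \<delta> (Suc i) t = \<delta> i t + \<alpha> (Suc i) t"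
  by (simp_all add: \<delta>_def numeral_3_eq_3)

lemma u_rec: "u 1 = (1 / 2) *\<^sub>C (hc 1 - hc 2)" "u 2 = (1 / 2) *\<^sub>C (hc 1 + hc 2)"
  "2 \<le> i \<Longrightarrow> u (Suc i) = u i + hc (Suc i)"
  by (simp_all add: u_def numeral_3_eq_3 add.assoc)

text \<open>The nodes 1 and 2 are the two ends of the fork in the diagram; the others form a chain.\<close>

lemma index_cases:
  assumes "i \<in> {1..r}"
  obtains "i = 1" | "i = 2" | j where "i = Suc j" "2 \<le> j" "j \<in> {1..r}"
proof (cases "i \<le> 2")
  case True
  then show ?thesis using assms that by fastforce
next
  case False
  then show ?thesis using assms that(3)[of "i - 1"] by auto
qed

lemma index_induct [consumes 1, case_names one two step]:
  assumes "i \<in> {1..r}" "P 1" "P 2" "\<And>i. 2 \<le> i \<Longrightarrow> i \<in> {1..r} \<Longrightarrow> Suc i \<in> {1..r} \<Longrightarrow> P i \<Longrightarrow> P (Suc i)"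
  shows "P i"
  using assms(1)
proof (induction i rule: less_induct)
  case (less i)
  from less.prems show ?case
  proof (cases rule: index_cases)
    case (3 j)
    then show ?thesis using less assms(4)[of j] by auto
  qed (use assms in auto)
qed

lemma in_index: "1 \<in> {1..r}" "2 \<in> {1..r}" "3 \<in> {1..r}"
  using r by auto

lemma hc_in_H: "i \<in> {1..r} \<Longrightarrow> hc i \<in> H"
  by (rule coroot_in_H[OF simple_root])

lemma u_in_H: "i \<in> {1..r} \<Longrightarrow> u i \<in> H"
proof (induction rule: index_induct)
  case one
  show ?case unfolding u_rec
    by (intro subspace_scale[OF subspace_H] subspace_diff[OF subspace_H] hc_in_H in_index)
next
  case two
  show ?case unfolding u_rec
    by (intro subspace_scale[OF subspace_H] subspace_add[OF subspace_H] hc_in_H in_index)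
next
  case (step i)
  then show ?case by (simp add: u_rec subspace_add[OF subspace_H] hc_in_H)
qed

lemma hc_u: "hc 1 = u 1 + u 2" "hc 2 = u 2 - u 1" "2 \<le> i \<Longrightarrow> hc (Suc i) = u (Suc i) - u i"
proof -
  have half: "(1 / 2) *\<^sub>C x + (1 / 2) *\<^sub>C x = x" for x
    by (simp add: scale_left_distrib[symmetric])
  have "u 1 + u 2 = (1 / 2) *\<^sub>C hc 1 + (1 / 2) *\<^sub>C hc 1"
    unfolding u_rec by (simp only: scale_right_distrib scale_right_diff_distrib) simp
  then show "hc 1 = u 1 + u 2" by (simp only: half)
  have "u 2 - u 1 = (1 / 2) *\<^sub>C hc 2 + (1 / 2) *\<^sub>C hc 2"
    unfolding u_rec by (simp only: scale_right_distrib scale_right_diff_distrib) simp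
  then show "hc 2 = u 2 - u 1" by (simp only: half)
  show "2 \<le> i \<Longrightarrow> hc (Suc i) = u (Suc i) - u i" by (simp add: u_rec)
qed

lemma \<alpha>_\<delta>: "\<alpha> 1 t = \<delta> 1 t + \<delta> 2 t" "\<alpha> 2 t = \<delta> 2 t - \<delta> 1 t"
  "2 \<le> i \<Longrightarrow> \<alpha> (Suc i) t = \<delta> (Suc i) t - \<delta> i t"
  by (simp_all add: \<delta>_rec diff_divide_distrib add_divide_distrib)

lemma \<alpha>_linear: "i \<in> {1..r} \<Longrightarrow> s \<in> H \<Longrightarrow> t \<in> H \<Longrightarrow> \<alpha> i (s + t) = \<alpha> i s + \<alpha> i t"
  "i \<in> {1..r} \<Longrightarrow> t \<in> H \<Longrightarrow> \<alpha> i (c *\<^sub>C t) = c * \<alpha> i t"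
  "i \<in> {1..r} \<Longrightarrow> t \<notin> H \<Longrightarrow> \<alpha> i t = 0"
  using rootsD(1)[OF simple_root, of i] dualD by blast+

lemma \<delta>_dual: "i \<in> {1..r} \<Longrightarrow> \<delta> i \<in> dual H"
proof (induction rule: index_induct)
  case (step i)
  then show ?case
    using rootsD(1)[OF simple_root[OF step(3)]] unfolding dual_def
    by (simp add: \<delta>_rec algebra_simps)
qed (use \<alpha>_linear[OF in_index(1)] \<alpha>_linear[OF in_index(2)] in
    \<open>simp_all add: dual_def \<delta>_rec algebra_simps diff_divide_distrib add_divide_distrib\<close>)

lemma dual_diff: "\<phi> \<in> dual H \<Longrightarrow> s \<in> H \<Longrightarrow> t \<in> H \<Longrightarrow> \<phi> (s - t) = \<phi> s - \<phi> t"
  using dualD(1)[of \<phi> "s - t" t] subspace_diff[OF subspace_H] by (simp add: algebra_simps)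

lemma dual_sum: "\<phi> \<in> dual H \<Longrightarrow> (\<And>i. i \<in> I \<Longrightarrow> f i \<in> H) \<Longrightarrow> \<phi> (\<Sum>i\<in>I. f i) = (\<Sum>i\<in>I. \<phi> (f i))"
  by (induction I rule: infinite_finite_induct)
    (simp_all add: dualD subspace_sum[OF subspace_H])

lemma dual_combination:
  assumes \<phi>: "\<phi> \<in> dual H"
  shows "\<phi> (\<Sum>i = 1..r. c i *\<^sub>C u i) = (\<Sum>i = 1..r. c i * \<phi> (u i))"
proof -
  have "\<phi> (\<Sum>i = 1..r. c i *\<^sub>C u i) = (\<Sum>i = 1..r. \<phi> (c i *\<^sub>C u i))"
    by (rule dual_sum[OF \<phi> subspace_scale[OF subspace_H u_in_H]])
  also have "\<dots> = (\<Sum>i = 1..r. c i * \<phi> (u i))"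
    by (rule sum.cong[OF refl dualD(2)[OF \<phi> u_in_H]])
  finally show ?thesis .
qed

lemma \<delta>_coroot:
  assumes i: "i \<in> {1..r}" and j: "j \<in> {1..r}"
  shows "\<delta> i (hc j) =
    (if j = 1 then (if i = 1 \<or> i = 2 then 1 else 0)
     else if j = 2 then (if i = 2 then 1 else if i = 1 then - 1 else 0)
     else (if i = j then 1 else if Suc i = j then - 1 else 0))"
  using i
proof (induction rule: index_induct)
  case one
  show ?case
    using cartan_matrix[OF in_index(1) j] cartan_matrix[OF in_index(2) j] j
    by (auto simp: \<delta>_rec D_edge_def)
next
  case two
  show ?case
    using cartan_matrix[OF in_index(1) j] cartan_matrix[OF in_index(2) j] j
    by (auto simp: \<delta>_rec D_edge_def)
next
  case (step i)
  then show ?case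
    using cartan_matrix[OF step(3) j] j by (auto simp: \<delta>_rec D_edge_def)
qed

theorem \<delta>_u:
  assumes j: "j \<in> {1..r}" and i: "i \<in> {1..r}"
  shows "\<delta> i (u j) = (if i = j then 1 else 0)"
  using j
proof (induction rule: index_induct)
  case one
  note H = hc_in_H[OF in_index(1)] hc_in_H[OF in_index(2)]
  show ?case
    using \<delta>_coroot[OF i in_index(1)] \<delta>_coroot[OF i in_index(2)]
    by (auto simp: u_rec dualD(2)[OF \<delta>_dual[OF i] subspace_diff[OF subspace_H H]]
        dual_diff[OF \<delta>_dual[OF i] H])
next
  case two
  note H = hc_in_H[OF in_index(1)] hc_in_H[OF in_index(2)]
  show ?case
    using \<delta>_coroot[OF i in_index(1)] \<delta>_coroot[OF i in_index(2)]
    by (auto simp: u_rec dualD(2)[OF \<delta>_dual[OF i] subspace_add[OF subspace_H H]]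
        dualD(1)[OF \<delta>_dual[OF i] H])
next
  case (step j)
  then show ?case
    using \<delta>_coroot[OF i step(3)]
    by (auto simp: u_rec dualD(1)[OF \<delta>_dual[OF i] u_in_H[OF step(2)] hc_in_H[OF step(3)]])
qed

lemma \<alpha>_zero_if_\<delta>_zero:
  assumes "\<And>i. i \<in> {1..r} \<Longrightarrow> \<delta> i t = 0" "i \<in> {1..r}" shows "\<alpha> i t = 0"
  using assms(2)
proof (cases rule: index_cases)
  case (3 j)
  then show ?thesis using assms \<alpha>_\<delta>(3)[of j t] by simp
qed (use assms(1) in_index \<alpha>_\<delta> in auto)

text \<open>All roots vanish on such an element, which is therefore central.\<close>

lemma H_trivial:
  assumes t: "t \<in> H" and zero: "\<And>i. i \<in> {1..r} \<Longrightarrow> \<alpha> i t = 0"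
  shows "t = 0"
proof -
  have root0: "\<phi> t = 0" if "\<phi> \<in> roots H" for \<phi>
  proof -
    have sum0: "(\<Sum>i = 1..r. of_nat (c i) * \<alpha> i t) = 0" for c :: "nat \<Rightarrow> nat"
      by (rule sum.neutral) (use zero in auto)
    from that show ?thesis
    proof (cases rule: root_cases)
      case (2 c)
      then have "- \<phi> t = 0" by (simp only: sum0)
      then show ?thesis by simp
    qed (simp only: sum0)
  qed
  have central: "bracket t v = 0" if "v \<in> span (\<Union>\<phi>\<in>dual H. root_space H \<phi>)" for v
    using that
  proof (induction rule: span_induct_alt)
    case (step c x v)
    then obtain \<psi> where \<psi>: "\<psi> \<in> dual H" "x \<in> root_space H \<psi>" by blast
    have "bracket t x = 0"
    proof (cases "\<psi> \<in> roots H")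
      case True
      then show ?thesis using root_spaceD[OF \<psi>(2) t] root0 by simp
    next
      case False
      then have "\<psi> = (\<lambda>_. 0) \<or> x = 0" using \<psi> by (auto simp: roots_def)
      then show ?thesis using root_spaceD[OF \<psi>(2) t] by auto
    qed
    then show ?case using step by (simp add: bracket_simps)
  qed (simp add: bracket_simps)
  show ?thesis by (rule centerless, rule central) (simp only: root_spaces_span UNIV_I)
qed

theorem H_expansion:
  assumes t: "t \<in> H" shows "t = (\<Sum>i = 1..r. \<delta> i t *\<^sub>C u i)"
proof -
  let ?s = "\<Sum>i = 1..r. \<delta> i t *\<^sub>C u i"
  have uH: "\<delta> i t *\<^sub>C u i \<in> H" if "i \<in> {1..r}" for i
    by (rule subspace_scale[OF subspace_H u_in_H[OF that]])
  have s: "?s \<in> H" by (rule subspace_sum[OF subspace_H uH])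
  have "\<delta> j (t - ?s) = 0" if j: "j \<in> {1..r}" for j
  proof -
    have "\<delta> j ?s = (\<Sum>i = 1..r. \<delta> i t * \<delta> j (u i))"
      by (rule dual_combination[OF \<delta>_dual[OF j]])
    also have "\<dots> = (\<Sum>i\<in>{j}. \<delta> i t)"
      by (rule sum.mono_neutral_cong_right) (use j in \<open>auto simp: \<delta>_u\<close>)
    finally show ?thesis by (simp add: dual_diff[OF \<delta>_dual[OF j] t s])
  qed
  then have "\<alpha> j (t - ?s) = 0" if "j \<in> {1..r}" for j using \<alpha>_zero_if_\<delta>_zero that by blast
  then have "t - ?s = 0" using H_trivial subspace_diff[OF subspace_H t s] by blast
  then show ?thesis by simp
qed

lemma dual_eqI:
  assumes "\<phi> \<in> dual H" "\<psi> \<in> dual H" "\<And>i. i \<in> {1..r} \<Longrightarrow> \<phi> (u i) = \<psi> (u i)"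
  shows "\<phi> = \<psi>"
proof
  fix t
  show "\<phi> t = \<psi> t"
  proof (cases "t \<in> H")
    case True
    have "\<phi> (\<Sum>i = 1..r. \<delta> i t *\<^sub>C u i) = \<psi> (\<Sum>i = 1..r. \<delta> i t *\<^sub>C u i)"
      unfolding dual_combination[OF assms(1)] dual_combination[OF assms(2)]
      by (rule sum.cong) (use assms(3) in auto)
    then show ?thesis using H_expansion[OF True] by simp
  qed (simp add: dualD(3)[OF assms(1)] dualD(3)[OF assms(2)])
qed

section \<open>The roots\<close>

text \<open>Negative indices stand for the negatives of the coordinates, so that the weights of the vector
  representation of \<open>so\<^sub>2\<^sub>r\<close> are the \<open>\<epsilon> s\<close> with \<open>s \<in> J\<close>.\<close>

definition \<epsilon> :: "int \<Rightarrow> 'g \<Rightarrow> complex" where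
  "\<epsilon> s t = of_int (sgn s) * \<delta> (nat \<bar>s\<bar>) t"

definition J :: "int set" where "J = {s. s \<noteq> 0 \<and> \<bar>s\<bar> \<le> int r}"

lemma J_cases:
  assumes "s \<in> J"
  obtains n where "n \<in> {1..r}" "s = int n" | n where "n \<in> {1..r}" "s = - int n"
proof (cases "0 < s")
  case True
  then show ?thesis using assms that(1)[of "nat s"] by (auto simp: J_def)
next
  case False
  then show ?thesis using assms that(2)[of "nat (- s)"] by (auto simp: J_def)
qed

lemma uminus_in_J: "s \<in> J \<Longrightarrow> - s \<in> J"
  by (simp add: J_def)

lemma finite_J: "finite J"
proof (rule finite_subset)
  show "J \<subseteq> {- int r..int r}" by (auto simp: J_def)
qed simp

lemma \<epsilon>_simps: "0 < n \<Longrightarrow> \<epsilon> (int n) t = \<delta> n t" "0 < n \<Longrightarrow> \<epsilon> (- int n) t = - \<delta> n t"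
  and \<epsilon>_minus: "\<epsilon> (- s) t = - \<epsilon> s t"
  by (simp_all add: \<epsilon>_def sgn_if)

lemma \<epsilon>_dual: assumes "s \<in> J" shows "\<epsilon> s \<in> dual H"
proof -
  have "nat \<bar>s\<bar> \<in> {1..r}" using assms by (auto simp: J_def)
  from \<delta>_dual[OF this] show ?thesis unfolding dual_def \<epsilon>_def by (simp add: algebra_simps)
qed

lemma \<epsilon>_u:
  assumes "s \<in> J" "j \<in> {1..r}"
  shows "\<epsilon> s (u j) = (if s = int j then 1 else if s = - int j then - 1 else 0)"
  using assms(1) by (cases rule: J_cases) (use assms(2) in \<open>auto simp: \<epsilon>_simps \<delta>_u\<close>)

text \<open>The action of the simple reflection of \<open>\<alpha> i\<close> on signed indices, and below the value of \<open>\<epsilon> s\<close> on the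
  coroot of \<open>\<alpha> i\<close>; compare \<open>\<epsilon>_reflect\<close> and \<open>\<epsilon>_coroot\<close>.\<close>

definition swap :: "nat \<Rightarrow> int \<Rightarrow> int" where
  "swap i s = (if i = 1
     then (if s = 1 then - 2 else if s = 2 then - 1 else if s = - 1 then 2 else if s = - 2 then 1 else s)
     else (if s = int i - 1 then int i else if s = int i then int i - 1
       else if s = 1 - int i then - int i else if s = - int i then 1 - int i else s))"

definition pairing :: "nat \<Rightarrow> int \<Rightarrow> int" where
  "pairing i s = (if i = 1
     then (if s = 1 \<or> s = 2 then 1 else if s = - 1 \<or> s = - 2 then - 1 else 0)
     else (if s = int i \<or> s = 1 - int i then 1 else if s = - int i \<or> s = int i - 1 then - 1 else 0))"

lemma swap_in_J: "i \<in> {1..r} \<Longrightarrow> s \<in> J \<Longrightarrow> swap i s \<in> J"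
  using r by (auto simp: swap_def J_def split: if_splits)

lemma swap_swap: "i \<in> {1..r} \<Longrightarrow> s \<in> J \<Longrightarrow> swap i (swap i s) = s"
  by (auto simp: swap_def J_def split: if_splits)

lemma swap_minus: "i \<in> {1..r} \<Longrightarrow> s \<in> J \<Longrightarrow> swap i (- s) = - swap i s"
  by (auto simp: swap_def J_def split: if_splits)

lemma \<epsilon>_coroot:
  assumes "s \<in> J" "i \<in> {1..r}"
  shows "\<epsilon> s (hc i) = of_int (pairing i s)"
  using assms(1)
proof (cases rule: J_cases)
  case (1 n)
  then show ?thesis using \<delta>_coroot[OF 1(1) assms(2)] assms(2)
    by (auto simp: \<epsilon>_simps pairing_def)
next
  case (2 n)
  then show ?thesis using \<delta>_coroot[OF 2(1) assms(2)] assms(2)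
    by (auto simp: \<epsilon>_simps pairing_def)
qed

lemma \<epsilon>_numerals: "\<epsilon> 1 t = \<delta> 1 t" "\<epsilon> 2 t = \<delta> 2 t" "\<epsilon> (- 1) t = - \<delta> 1 t" "\<epsilon> (- 2) t = - \<delta> 2 t"
  by (simp_all add: \<epsilon>_def One_nat_def)

lemma \<epsilon>_reflect:
  assumes "s \<in> J" "i \<in> {1..r}"
  shows "\<epsilon> s t - of_int (pairing i s) * \<alpha> i t = \<epsilon> (swap i s) t"
  using assms(2)
proof (cases rule: index_cases)
  case 1
  then show ?thesis by (auto simp: pairing_def swap_def \<alpha>_\<delta> \<epsilon>_numerals)
next
  case 2
  then show ?thesis by (auto simp: pairing_def swap_def \<alpha>_\<delta> \<epsilon>_numerals)
next
  case (3 j)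
  then have j: "0 < j" "i \<noteq> 1" "int i - 1 = int j" "1 - int i = - int j" by auto
  have "\<epsilon> (int (Suc j)) t = \<delta> (Suc j) t" "\<epsilon> (- int (Suc j)) t = - \<delta> (Suc j) t"
    "\<epsilon> (int j) t = \<delta> j t" "\<epsilon> (- int j) t = - \<delta> j t"
    using j by (simp_all only: \<epsilon>_simps zero_less_Suc)
  then show ?thesis
    using 3 j unfolding pairing_def swap_def j
    by (auto simp: \<alpha>_\<delta> simp del: of_nat_Suc)
qed

definition wt :: "int \<Rightarrow> int \<Rightarrow> 'g \<Rightarrow> complex" where
  "wt s t x = \<epsilon> s x + \<epsilon> t x"

definition admissible :: "int \<Rightarrow> int \<Rightarrow> bool" where
  "admissible s t \<longleftrightarrow> s \<in> J \<and> t \<in> J \<and> s \<noteq> t \<and> s \<noteq> - t"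

lemma wt_commute: "wt s t = wt t s"
  by (rule ext) (simp add: wt_def)

lemma wt_dual: "s \<in> J \<Longrightarrow> t \<in> J \<Longrightarrow> wt s t \<in> dual H"
  using \<epsilon>_dual[of s] \<epsilon>_dual[of t] unfolding dual_def wt_def by (simp add: algebra_simps)

lemma wt_coroot: "s \<in> J \<Longrightarrow> t \<in> J \<Longrightarrow> i \<in> {1..r} \<Longrightarrow>
    wt s t (hc i) = of_int (pairing i s + pairing i t)"
  by (simp add: wt_def \<epsilon>_coroot)

lemma wt_reflect: "s \<in> J \<Longrightarrow> t \<in> J \<Longrightarrow> i \<in> {1..r} \<Longrightarrow>
    wt s t x - of_int (pairing i s + pairing i t) * \<alpha> i x = wt (swap i s) (swap i t) x"
  by (simp add: wt_def \<epsilon>_reflect[symmetric] algebra_simps)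

lemma admissible_swap: "admissible s t \<Longrightarrow> i \<in> {1..r} \<Longrightarrow> admissible (swap i s) (swap i t)"
  unfolding admissible_def using swap_in_J swap_swap swap_minus by metis

lemma simple_root_eq: "\<alpha> 1 = wt 1 2" "\<alpha> 2 = wt (- 1) 2"
  "2 \<le> j \<Longrightarrow> \<alpha> (Suc j) = wt (- int j) (int (Suc j))"
  by (auto simp: fun_eq_iff wt_def \<alpha>_\<delta> \<epsilon>_simps \<epsilon>_numerals simp del: of_nat_Suc)

lemma simple_root_wt:
  assumes "i \<in> {1..r}" shows "\<exists>s t. admissible s t \<and> \<alpha> i = wt s t"
  using assms
proof (cases rule: index_cases)
  case 1
  then show ?thesis
    using r by (intro exI[of _ 1] exI[of _ 2]) (simp add: simple_root_eq admissible_def J_def)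
next
  case 2
  then show ?thesis
    using r by (intro exI[of _ "- 1"] exI[of _ 2]) (simp add: simple_root_eq admissible_def J_def)
next
  case (3 j)
  then show ?thesis
    using assms by (intro exI[of _ "- int j"] exI[of _ "int (Suc j)"])
      (auto simp: simple_root_eq admissible_def J_def)
qed

lemma \<alpha>_u:
  assumes "j \<in> {1..r}"
  shows "\<alpha> 1 (u j) = (if j = 1 \<or> j = 2 then 1 else 0)"
    and "\<alpha> 2 (u j) = (if j = 2 then 1 else if j = 1 then - 1 else 0)"
    and "2 \<le> l \<Longrightarrow> Suc l \<le> r \<Longrightarrow> \<alpha> (Suc l) (u j) = (if j = Suc l then 1 else if j = l then - 1 else 0)"
proof -
  show "\<alpha> 1 (u j) = (if j = 1 \<or> j = 2 then 1 else 0)"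
    "\<alpha> 2 (u j) = (if j = 2 then 1 else if j = 1 then - 1 else 0)"
    using \<delta>_u[OF assms in_index(1)] \<delta>_u[OF assms in_index(2)] by (auto simp: \<alpha>_\<delta>)
  assume l: "2 \<le> l" "Suc l \<le> r"
  then have "l \<in> {1..r}" "Suc l \<in> {1..r}" by auto
  then show "\<alpha> (Suc l) (u j) = (if j = Suc l then 1 else if j = l then - 1 else 0)"
    using \<delta>_u[OF assms, of l] \<delta>_u[OF assms, of "Suc l"] l(1) by (auto simp: \<alpha>_\<delta>)
qed

text \<open>The coefficients are extended by zero, so that the formula also covers the last node \<open>j = r\<close>.\<close>

lemma coordinates_of_combination:
  fixes c :: "nat \<Rightarrow> nat"
  defines "e k \<equiv> if k \<in> {1..r} then int (c k) else 0"
  assumes j: "j \<in> {1..r}"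
  shows "(\<Sum>k = 1..r. of_nat (c k) * \<alpha> k (u j)) =
    of_int (if j = 1 then e 1 - e 2 else if j = 2 then e 1 + e 2 - e 3 else e j - e (Suc j))"
proof -
  define ind where "ind l k = (if k = l then 1 else 0 :: complex)" for l k :: nat
  have pick: "(\<Sum>k = 1..r. of_nat (c k) * ind l k) = of_int (e l)" for l
  proof -
    have "(\<Sum>k = 1..r. of_nat (c k) * ind l k) = (\<Sum>k\<in>{1..r} \<inter> {l}. of_nat (c k))"
      by (rule sum.mono_neutral_cong_right) (auto simp: ind_def)
    then show ?thesis by (cases "l \<in> {1..r}") (auto simp: e_def)
  qed
  have sum: "(\<Sum>k = 1..r. of_nat (c k) * \<alpha> k (u j)) = (\<Sum>k = 1..r. of_nat (c k) * f k)"
    if "\<And>k. k \<in> {1..r} \<Longrightarrow> \<alpha> k (u j) = f k" for f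
    using that by (intro sum.cong) simp_all
  show ?thesis
    using j
  proof (cases rule: index_cases)
    case 1
    have "(\<Sum>k = 1..r. of_nat (c k) * \<alpha> k (u j)) = (\<Sum>k = 1..r. of_nat (c k) * (ind 1 k - ind 2 k))"
    proof (rule sum)
      fix k assume k: "k \<in> {1..r}"
      then show "\<alpha> k (u j) = ind 1 k - ind 2 k"
        by (cases rule: index_cases) (use 1 k r in \<open>simp_all add: \<alpha>_u ind_def\<close>)
    qed
    then show ?thesis using 1 by (simp add: right_diff_distrib sum_subtractf pick)
  next
    case 2
    have "(\<Sum>k = 1..r. of_nat (c k) * \<alpha> k (u j)) = (\<Sum>k = 1..r. of_nat (c k) * (ind 1 k + ind 2 k - ind 3 k))"
    proof (rule sum)
      fix k assume k: "k \<in> {1..r}"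
      then show "\<alpha> k (u j) = ind 1 k + ind 2 k - ind 3 k"
        by (cases rule: index_cases) (use 2 k r in \<open>auto simp: \<alpha>_u ind_def\<close>)
    qed
    then show ?thesis using 2 by (simp add: right_diff_distrib distrib_left sum_subtractf sum.distrib pick)
  next
    case (3 l)
    have "(\<Sum>k = 1..r. of_nat (c k) * \<alpha> k (u j)) = (\<Sum>k = 1..r. of_nat (c k) * (ind j k - ind (Suc j) k))"
    proof (rule sum)
      fix k assume k: "k \<in> {1..r}"
      then show "\<alpha> k (u j) = ind j k - ind (Suc j) k"
        by (cases rule: index_cases) (use 3 k r j in \<open>auto simp: \<alpha>_u ind_def\<close>)
    qed
    then show ?thesis using 3 by (simp add: right_diff_distrib sum_subtractf pick)
  qed
qed

text \<open>In coordinates \<open>X j\<close> the values on the simple coroots are \<open>X 1 + X 2\<close>, \<open>X 2 - X 1\<close> and the differences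
  \<open>X (j + 1) - X j\<close>.  If all of them were nonpositive, then \<open>X r \<le> \<dots> \<le> X 2 \<le> - |X 1|\<close>.  But \<open>X r = c r \<ge> 0\<close>,
  so all coordinates, and then all coefficients, would be zero.\<close>

theorem positive_coroot_exists:
  fixes c :: "nat \<Rightarrow> nat"
  assumes \<phi>: "\<phi> \<in> roots H" and c: "\<And>t. \<phi> t = (\<Sum>k = 1..r. of_nat (c k) * \<alpha> k t)"
  shows "\<exists>i\<in>{1..r}. \<exists>m\<ge>1. \<phi> (hc i) = of_int m"
proof (rule ccontr)
  assume neg: "\<not> ?thesis"
  define e where "e k = (if k \<in> {1..r} then int (c k) else 0)" for k
  define X where "X j = (if j = 1 then e 1 - e 2 else if j = 2 then e 1 + e 2 - e 3 else e j - e (Suc j))" for j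
  have \<phi>u: "\<phi> (u j) = of_int (X j)" if "j \<in> {1..r}" for j
    unfolding c X_def e_def by (rule coordinates_of_combination[OF that])
  note d = rootsD(1)[OF \<phi>]
  have le: "N \<le> 0" if "i \<in> {1..r}" "\<phi> (hc i) = of_int N" for i N
  proof (rule ccontr)
    assume "\<not> N \<le> 0"
    then have "1 \<le> N" by simp
    then show False using neg that by blast
  qed
  note uH = u_in_H[OF in_index(1)] u_in_H[OF in_index(2)]
  have "X 1 + X 2 \<le> 0"
    by (rule le[OF in_index(1)])
      (simp add: hc_u dualD(1)[OF d uH] \<phi>u[OF in_index(1)] \<phi>u[OF in_index(2)])
  moreover have "X 2 - X 1 \<le> 0"
    by (rule le[OF in_index(2)])
      (simp add: hc_u dual_diff[OF d uH(2,1)] \<phi>u[OF in_index(1)] \<phi>u[OF in_index(2)])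
  moreover have mono: "X (Suc j) - X j \<le> 0" if "2 \<le> j" "Suc j \<le> r" for j
  proof (rule le)
    have j: "j \<in> {1..r}" "Suc j \<in> {1..r}" using that by auto
    then show "Suc j \<in> {1..r}" by simp
    show "\<phi> (hc (Suc j)) = of_int (X (Suc j) - X j)"
      using that(1) by (simp add: hc_u dual_diff[OF d u_in_H[OF j(2)] u_in_H[OF j(1)]] \<phi>u[OF j(1)] \<phi>u[OF j(2)])
  qed
  moreover have "X r \<le> X j" if "2 \<le> j" "j \<le> r" for j
    using that(2,1) by (induction rule: inc_induct) (use mono in force)+
  moreover have "0 \<le> X r" using r by (simp add: X_def e_def)
  moreover have "X j \<le> X 2" if "2 \<le> j" "j \<le> r" for j
    using that by (induction rule: dec_induct) (use mono in force)+
  ultimately have X2: "X j = 0" if "2 \<le> j" "j \<le> r" for j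
    using that r by (smt (verit) order_refl)
  then have X1: "X 1 = 0" using \<open>X 1 + X 2 \<le> 0\<close> \<open>X 2 - X 1 \<le> 0\<close> r by simp
  have "e j = 0" if "3 \<le> j" "j \<le> r" for j
    using that(2,1)
  proof (induction rule: inc_induct)
    case base
    then show ?case using X2[of r] by (simp add: X_def e_def)
  next
    case (step n)
    then show ?case using X2[of n] by (simp add: X_def)
  qed
  moreover have "e 1 = e 2" using X1 by (simp add: X_def)
  moreover have "e 1 + e 2 = e 3" using X2[of 2] r by (simp add: X_def)
  ultimately have "e 1 = 0" "e 2 = 0" using r by auto
  have "e k = 0" if k: "k \<in> {1..r}" for k
  proof -
    consider "k = 1" | "k = 2" | "3 \<le> k" using k by fastforce
    then show ?thesis by cases (use \<open>e 1 = 0\<close> \<open>e 2 = 0\<close> \<open>\<And>j. 3 \<le> j \<Longrightarrow> j \<le> r \<Longrightarrow> e j = 0\<close> k in auto)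
  qed
  then have "c k = 0" if "k \<in> {1..r}" for k using that unfolding e_def by fastforce
  then have "\<phi> t = 0" for t unfolding c by (intro sum.neutral) simp
  then show False using rootsD(2)[OF \<phi>] by blast
qed

lemma root_multiple_of_simple:
  assumes \<phi>: "\<phi> \<in> roots H" and i: "i \<in> {1..r}" and eq: "\<And>t. \<phi> t = of_nat n * \<alpha> i t"
  shows "\<phi> = \<alpha> i"
proof -
  have "\<phi> = (\<lambda>t. of_nat n * \<alpha> i t)" using eq by (simp add: fun_eq_iff)
  then have sp: "root_space H (\<lambda>t. of_nat n * \<alpha> i t) \<noteq> {0}" using rootsD(3)[OF \<phi>] by auto
  have "n \<noteq> 0" using eq rootsD(2)[OF \<phi>] by auto
  moreover have "\<not> 2 \<le> n" using root_multiples[OF simple_root[OF i]] sp by blast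
  ultimately have "n = 1" by simp
  then show ?thesis using eq by (simp add: fun_eq_iff)
qed

text \<open>Descent by height.  Reflecting \<open>\<phi>\<close> in a simple root on whose coroot it is positive lowers the height,
  and the reflected root is still positive unless \<open>\<phi>\<close> is a multiple of that simple root.  The set of
  all \<open>wt s t\<close> is closed under reflections.\<close>

theorem positive_root_wt:
  fixes c :: "nat \<Rightarrow> nat"
  assumes "\<phi> \<in> roots H" and "\<And>t. \<phi> t = (\<Sum>k = 1..r. of_nat (c k) * \<alpha> k t)"
  shows "\<exists>s t. admissible s t \<and> \<phi> = wt s t"
  using assms
proof (induction "\<Sum>k = 1..r. c k" arbitrary: \<phi> c rule: less_induct)
  case less
  obtain i m where i: "i \<in> {1..r}" and m: "m \<ge> 1" "\<phi> (hc i) = of_int m"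
    using positive_coroot_exists[OF less.prems] by blast
  show ?case
  proof (cases "\<exists>k\<in>{1..r}. k \<noteq> i \<and> c k \<noteq> 0")
    case False
    have "\<phi> t = of_nat (c i) * \<alpha> i t" for t
    proof -
      have "\<phi> t = (\<Sum>k\<in>{i}. of_nat (c k) * \<alpha> k t)"
        unfolding less.prems(2) by (rule sum.mono_neutral_right) (use i False in auto)
      then show ?thesis by simp
    qed
    then have "\<phi> = \<alpha> i" by (rule root_multiple_of_simple[OF less.prems(1) i])
    then show ?thesis using simple_root_wt[OF i] by simp
  next
    case True
    then obtain k where k: "k \<in> {1..r}" "k \<noteq> i" "c k \<noteq> 0" by blast
    define \<psi> where "\<psi> t = \<phi> t - of_int m * \<alpha> i t" for t
    define d where "d l = of_nat (c l) - (if l = i then of_int m else (0::complex))" for l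
    have \<psi>_root: "\<psi> \<in> roots H"
      unfolding \<psi>_def by (rule root_reflection[OF simple_root[OF i] less.prems(1) m(2)])
    have \<psi>d: "\<psi> t = (\<Sum>l = 1..r. d l * \<alpha> l t)" for t
    proof -
      have "(\<Sum>l = 1..r. (if l = i then of_int m else 0) * \<alpha> l t) = (\<Sum>l\<in>{i}. of_int m * \<alpha> l t)"
        by (rule sum.mono_neutral_cong_right) (use i in auto)
      then show ?thesis
        unfolding d_def left_diff_distrib sum_subtractf \<psi>_def less.prems(2) by simp
    qed
    from \<psi>_root have "\<exists>s t. admissible s t \<and> \<psi> = wt s t"
    proof (cases rule: root_cases)
      case (1 c')
      have d_eq: "d l = of_nat (c' l)" if "l \<in> {1..r}" for l
        by (rule simple_combination_unique[OF _ that]) (simp only: \<psi>d[symmetric] 1)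
      have c'i: "c' i < c i"
      proof -
        have "(of_nat (c i) :: complex) - of_int m = of_nat (c' i)" using d_eq[OF i] by (simp add: d_def)
        then have "(of_int (int (c i) - m) :: complex) = of_int (int (c' i))" by simp
        then show ?thesis using m(1) by (simp only: of_int_eq_iff)
      qed
      have c'l: "c' l = c l" if "l \<in> {1..r}" "l \<noteq> i" for l
        using d_eq[OF that(1)] that(2) by (simp add: d_def)
      have "(\<Sum>k = 1..r. c' k) < (\<Sum>k = 1..r. c k)"
      proof (rule sum_strict_mono_ex1)
        show "\<forall>x\<in>{1..r}. c' x \<le> c x" using c'l c'i by (metis less_imp_le order_refl)
        show "\<exists>a\<in>{1..r}. c' a < c a" using c'i i by blast
      qed simp
      then show ?thesis using less.hyps[OF _ \<psi>_root 1] by blast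
    next
      case (2 c')
      \<comment> \<open>The reflection changes only the coefficient at \<open>i\<close>, so the one at \<open>k\<close> is still positive.\<close>
      have "- d k = of_nat (c' k)"
        by (rule simple_combination_unique[OF _ k(1)]) (simp only: 2[symmetric] \<psi>d mult_minus_left sum_negf)
      then have "(of_nat (c k + c' k) :: complex) = of_nat (c k) - d k" by simp
      also have "\<dots> = 0" using k(2) by (simp add: d_def)
      finally have "c k + c' k = 0" by (simp only: of_nat_eq_0_iff)
      then show ?thesis using k(3) by simp
    qed
    then obtain s t where st: "admissible s t" "\<psi> = wt s t" by blast
    have st_J: "s \<in> J" "t \<in> J" using st(1) by (auto simp: admissible_def)
    have "of_int (pairing i s + pairing i t) = \<psi> (hc i)" unfolding st(2) by (rule wt_coroot[OF st_J i, symmetric])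
    also have "\<dots> = of_int (- m)" using m(2) root_coroot[OF simple_root[OF i]] by (simp add: \<psi>_def)
    finally have p: "pairing i s + pairing i t = - m" by (simp only: of_int_eq_iff)
    have "\<phi> x = wt (swap i s) (swap i t) x" for x
      using wt_reflect[OF st_J i, of x] unfolding p st(2)[symmetric] by (simp add: \<psi>_def)
    then show ?thesis using admissible_swap[OF st(1) i] by blast
  qed
qed

theorem root_wt:
  assumes \<phi>: "\<phi> \<in> roots H"
  shows "\<exists>s t. admissible s t \<and> \<phi> = wt s t"
  using \<phi>
proof (cases rule: root_cases)
  case (1 c)
  then show ?thesis using positive_root_wt[OF \<phi>] by blast
next
  case (2 c)
  then obtain s t where st: "admissible s t" "(\<lambda>x. - \<phi> x) = wt s t"
    using positive_root_wt[OF root_neg[OF \<phi>], of c] by blast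
  have "\<phi> x = wt (- s) (- t) x" for x
  proof -
    have "\<phi> x = - wt s t x" using fun_cong[OF st(2), of x] by (metis minus_minus)
    then show ?thesis by (simp add: wt_def \<epsilon>_minus)
  qed
  moreover have "admissible (- s) (- t)"
    using st(1) uminus_in_J by (auto simp: admissible_def)
  ultimately show ?thesis by blast
qed

lemma wt_root_swap:
  assumes "wt s t \<in> roots H" "s \<in> J" "t \<in> J" "i \<in> {1..r}" "swap i s = s'" "swap i t = t'"
  shows "wt s' t' \<in> roots H"
proof -
  have "(\<lambda>x. wt s t x - of_int (pairing i s + pairing i t) * \<alpha> i x) \<in> roots H"
    by (rule root_reflection[OF simple_root[OF assms(4)] assms(1) wt_coroot[OF assms(2-4)]])
  then show ?thesis unfolding wt_reflect[OF assms(2-4)] assms(5,6) .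
qed

lemma wt_root_minus:
  assumes "wt s t \<in> roots H" shows "wt (- s) (- t) \<in> roots H"
proof -
  have "wt (- s) (- t) = (\<lambda>x. - wt s t x)" by (rule ext) (simp add: wt_def \<epsilon>_minus)
  then show ?thesis using root_neg[OF assms] by simp
qed

text \<open>From the simple root \<open>\<alpha> (s + 1)\<close>, the reflections in \<open>\<alpha> i\<close> with \<open>i > s + 1\<close> move the second index up
  step by step.\<close>

lemma wt_root_opposite_signs:
  assumes "1 \<le> s" "s < t" "t \<le> r" shows "wt (- int s) (int t) \<in> roots H"
proof -
  have "Suc s \<le> t" using assms(2) by simp
  then show ?thesis using assms(3)
  proof (induction rule: dec_induct)
    case base
    have "\<alpha> (Suc s) \<in> roots H" using base by (intro simple_root) simp
    then show ?case using simple_root_eq(2) simple_root_eq(3)[of s] assms(1)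
      by (cases "s = 1") (auto simp: numeral_2_eq_2 One_nat_def)
  next
    case (step n)
    then have "wt (- int s) (int n) \<in> roots H" by simp
    then show ?case
      by (rule wt_root_swap[where i = "Suc n"]) (use step assms in \<open>auto simp: J_def swap_def\<close>)
  qed
qed

lemma wt_root_one:
  assumes "2 \<le> t" "t \<le> r" shows "wt 1 (int t) \<in> roots H"
  using assms
proof (induction rule: dec_induct)
  case base
  show ?case using simple_root[OF in_index(1)] by (simp add: simple_root_eq)
next
  case (step n)
  then have "wt 1 (int n) \<in> roots H" by simp
  then show ?case
    by (rule wt_root_swap[where i = "Suc n"]) (use step in \<open>auto simp: J_def swap_def\<close>)
qed

text \<open>From \<open>\<alpha> 1 = wt 1 2\<close>, first the second index is moved up to \<open>t\<close> and then the first one up to \<open>s\<close>.\<close>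

lemma wt_root_positive:
  assumes "1 \<le> s" "s < t" "t \<le> r" shows "wt (int s) (int t) \<in> roots H"
  using assms
proof (induction rule: dec_induct)
  case base
  then show ?case using wt_root_one[of t] by simp
next
  case (step n)
  then have "wt (int n) (int t) \<in> roots H" by simp
  then show ?case
    by (rule wt_root_swap[where i = "Suc n"]) (use step in \<open>auto simp: J_def swap_def\<close>)
qed

theorem wt_root:
  assumes "admissible s t" shows "wt s t \<in> roots H"
proof -
  have main: "wt s t \<in> roots H" if st: "s \<in> J" "t \<in> J" "\<bar>s\<bar> < \<bar>t\<bar>" for s t
    using st(1)
  proof (cases rule: J_cases)
    case s: (1 n)
    from st(2) show ?thesis
    proof (cases rule: J_cases)
      case (1 m)
      then show ?thesis using wt_root_positive[of n m] s st(3) by simp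
    next
      case (2 m)
      then show ?thesis using wt_root_minus[OF wt_root_opposite_signs[of n m]] s st(3) by simp
    qed
  next
    case s: (2 n)
    from st(2) show ?thesis
    proof (cases rule: J_cases)
      case (1 m)
      then show ?thesis using wt_root_opposite_signs[of n m] s st(3) by simp
    next
      case (2 m)
      then show ?thesis using wt_root_minus[OF wt_root_positive[of n m]] s st(3) by simp
    qed
  qed
  have "\<bar>s\<bar> < \<bar>t\<bar> \<or> \<bar>t\<bar> < \<bar>s\<bar>" using assms by (auto simp: admissible_def)
  then show ?thesis using main[of s t] main[of t s] assms wt_commute[of s t] by (auto simp: admissible_def)
qed

lemma wt_contains:
  assumes "s \<in> J" "s' \<in> J" "t' \<in> J" "wt s' t' (u (nat \<bar>s\<bar>)) = of_int (sgn s)"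
  shows "s = s' \<or> s = t'"
  using assms(1)
proof (cases rule: J_cases)
  case (1 n)
  then show ?thesis using assms(4) \<epsilon>_u[OF assms(2) 1(1)] \<epsilon>_u[OF assms(3) 1(1)]
    by (auto simp: wt_def split: if_splits)
next
  case (2 n)
  then show ?thesis using assms(4) \<epsilon>_u[OF assms(2) 2(1)] \<epsilon>_u[OF assms(3) 2(1)]
    by (auto simp: wt_def split: if_splits)
qed

lemma wt_eval:
  assumes "admissible s t" shows "wt s t (u (nat \<bar>s\<bar>)) = of_int (sgn s)"
proof -
  have st: "s \<in> J" "t \<in> J" "s \<noteq> t" "s \<noteq> - t" using assms by (auto simp: admissible_def)
  from st(1) show ?thesis
  proof (cases rule: J_cases)
    case (1 n)
    then show ?thesis using \<epsilon>_u[OF st(1) 1(1)] \<epsilon>_u[OF st(2) 1(1)] st by (auto simp: wt_def)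
  next
    case (2 n)
    then show ?thesis using \<epsilon>_u[OF st(1) 2(1)] \<epsilon>_u[OF st(2) 2(1)] st by (auto simp: wt_def)
  qed
qed

lemma wt_injective:
  assumes "admissible s t" "s' \<in> J" "t' \<in> J" "wt s t = wt s' t'"
  shows "{s, t} = {s', t'}"
proof -
  have st: "s \<in> J" "t \<in> J" "s \<noteq> t" using assms by (auto simp: admissible_def)
  have "s = s' \<or> s = t'"
    using wt_contains[OF st(1) assms(2,3)] wt_eval[OF assms(1)] assms(4) by simp
  moreover have "admissible t s" using assms(1) by (auto simp: admissible_def)
  then have "t = s' \<or> t = t'"
    using wt_contains[OF st(2) assms(2,3)] wt_eval[of t s] assms(4) wt_commute[of s t] by simp
  ultimately show ?thesis using st(3) by auto
qed

section \<open>A weight basis indexed by pairs\<close>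

text \<open>Two-element subsets of \<open>J\<close>, written in increasing order.\<close>

definition pairs :: "(int \<times> int) set" where
  "pairs = {(s, t). s \<in> J \<and> t \<in> J \<and> s < t}"

definition weight_of :: "int \<times> int \<Rightarrow> 'g \<Rightarrow> complex" where
  "weight_of p = wt (fst p) (snd p)"

text \<open>The pairs \<open>(-i, i)\<close> have weight zero and index the basis \<open>u i\<close> of \<open>H\<close>.\<close>

definition basis_vector :: "int \<times> int \<Rightarrow> 'g" where
  "basis_vector p = (if fst p = - snd p then u (nat (snd p))
     else SOME x. x \<in> root_space H (weight_of p) \<and> x \<noteq> 0)"

lemma finite_pairs: "finite pairs"
proof (rule finite_subset)
  show "pairs \<subseteq> J \<times> J" by (auto simp: pairs_def)
qed (simp add: finite_J)

lemma opposite_pair: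
  assumes "p \<in> pairs" "fst p = - snd p"
  shows "nat (snd p) \<in> {1..r}" "p = (- int (nat (snd p)), int (nat (snd p)))" "weight_of p = (\<lambda>_. 0)"
  using assms by (auto simp: pairs_def J_def weight_of_def wt_def \<epsilon>_minus fun_eq_iff)

lemma other_pair:
  assumes "p \<in> pairs" "fst p \<noteq> - snd p"
  shows "admissible (fst p) (snd p)" "weight_of p \<in> roots H"
    "basis_vector p \<in> root_space H (weight_of p)" "basis_vector p \<noteq> 0"
proof -
  show adm: "admissible (fst p) (snd p)" using assms by (auto simp: pairs_def admissible_def)
  then show root: "weight_of p \<in> roots H" unfolding weight_of_def by (rule wt_root)
  have "\<exists>x. x \<in> root_space H (weight_of p) \<and> x \<noteq> 0" using rootsD(3)[OF root] by blast
  from someI_ex[OF this] show "basis_vector p \<in> root_space H (weight_of p)" "basis_vector p \<noteq> 0"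
    using assms(2) by (simp_all add: basis_vector_def)
qed

lemma basis_vector_weight:
  assumes "p \<in> pairs" shows "basis_vector p \<in> root_space H (weight_of p)"
proof (cases "fst p = - snd p")
  case True
  then show ?thesis
    using opposite_pair[OF assms True] u_in_H root_space_zero_eq[of "\<lambda>_. 0"]
    by (simp add: basis_vector_def)
qed (rule other_pair[OF assms])

text \<open>A relation splits into one relation for each weight.  A nonzero weight belongs to only one pair; the
  part of weight zero is a relation between the \<open>u i\<close>.\<close>

theorem basis_vectors_independent: "indep_family pairs basis_vector"
  unfolding indep_family_def
proof (intro allI impI ballI)
  fix a p assume sum0: "(\<Sum>p\<in>pairs. a p *\<^sub>C basis_vector p) = 0" and p: "p \<in> pairs"
  define v where "v \<psi> = (\<Sum>p\<in>{p\<in>pairs. weight_of p = \<psi>}. a p *\<^sub>C basis_vector p)" for \<psi>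
  have v_weight: "v \<psi> \<in> root_space H \<psi>" for \<psi>
    unfolding v_def
    by (intro subspace_sum[OF subspace_root_space] subspace_scale[OF subspace_root_space])
      (auto dest: basis_vector_weight)
  have v0: "\<forall>\<psi>\<in>weight_of ` pairs. v \<psi> = 0"
  proof (rule weight_vectors_sum_zero[where T = bracket and S = H and w = "\<lambda>\<psi>. \<psi>"])
    show "(\<Sum>\<psi>\<in>weight_of ` pairs. v \<psi>) = 0"
      using sum0 sum.image_gen[OF finite_pairs, of "\<lambda>p. a p *\<^sub>C basis_vector p" weight_of]
      by (simp add: v_def)
    show "\<exists>s\<in>H. \<phi> s \<noteq> \<psi> s"
      if "\<phi> \<in> weight_of ` pairs" "\<psi> \<in> weight_of ` pairs" "\<phi> \<noteq> \<psi>" for \<phi> \<psi>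
    proof (rule ccontr)
      assume *: "\<not> ?thesis"
      have "\<phi> \<in> dual H" "\<psi> \<in> dual H" using that wt_dual by (auto simp: weight_of_def pairs_def)
      then have "\<phi> = \<psi>" using * u_in_H by (intro dual_eqI) auto
      with that(3) show False ..
    qed
    show "bracket s (v \<psi>) = \<psi> s *\<^sub>C v \<psi>" if "s \<in> H" for \<psi> s
      by (rule root_spaceD[OF v_weight that])
  qed (use linear_bracket finite_pairs in auto)
  show "a p = 0"
  proof (cases "fst p = - snd p")
    case True
    note op = opposite_pair[OF p True]
    let ?Z = "(\<lambda>i. (- int i, int i)) ` {1..r}"
    have Z: "{q\<in>pairs. weight_of q = (\<lambda>_. 0)} = ?Z"
    proof (intro equalityI subsetI)
      fix q assume q: "q \<in> {q\<in>pairs. weight_of q = (\<lambda>_. 0)}"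
      have "fst q = - snd q"
      proof (rule ccontr)
        assume "fst q \<noteq> - snd q"
        then have "weight_of q \<in> roots H" using other_pair(2) q by blast
        then show False using q rootsD(2) by fastforce
      qed
      then show "q \<in> ?Z" using opposite_pair[of q] q by blast
    next
      fix q assume "q \<in> ?Z"
      then obtain i where i: "i \<in> {1..r}" "q = (- int i, int i)" by blast
      then have "q \<in> pairs" by (auto simp: pairs_def J_def)
      then show "q \<in> {q\<in>pairs. weight_of q = (\<lambda>_. 0)}" using opposite_pair(3)[of q] i by simp
    qed
    have "v (weight_of p) = 0" using v0 p by blast
    then have "0 = v (\<lambda>_. 0)" unfolding op(3) ..
    also have "\<dots> = (\<Sum>i = 1..r. a (- int i, int i) *\<^sub>C u i)"
      unfolding v_def Z by (subst sum.reindex) (auto simp: inj_on_def basis_vector_def)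
    finally have s0: "(\<Sum>i = 1..r. a (- int i, int i) *\<^sub>C u i) = 0" ..
    let ?j = "nat (snd p)"
    have "0 = \<delta> ?j (\<Sum>i = 1..r. a (- int i, int i) *\<^sub>C u i)"
      unfolding s0 using dualD(4)[OF \<delta>_dual[OF op(1)]] by simp
    also have "\<dots> = (\<Sum>i = 1..r. a (- int i, int i) * \<delta> ?j (u i))"
      by (rule dual_combination[OF \<delta>_dual[OF op(1)]])
    also have "\<dots> = (\<Sum>i\<in>{?j}. a (- int i, int i))"
      by (rule sum.mono_neutral_cong_right) (use op(1) in \<open>auto simp: \<delta>_u[OF _ op(1)]\<close>)
    finally show ?thesis using op(2) by simp
  next
    case False
    note op = other_pair[OF p False]
    have "{q\<in>pairs. weight_of q = weight_of p} = {p}"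
    proof (intro equalityI subsetI)
      fix q assume "q \<in> {q\<in>pairs. weight_of q = weight_of p}"
      then have q: "q \<in> pairs" "weight_of p = weight_of q" by auto
      have "{fst p, snd p} = {fst q, snd q}"
        using q by (intro wt_injective[OF op(1)]) (auto simp: pairs_def weight_of_def)
      then have "fst q = fst p \<and> snd q = snd p"
        using p q(1) by (auto simp: pairs_def doubleton_eq_iff)
      then show "q \<in> {p}" by (simp add: prod_eq_iff)
    qed (use p in auto)
    then have "v (weight_of p) = a p *\<^sub>C basis_vector p" by (simp add: v_def)
    then show ?thesis using v0 p op(4) by simp
  qed
qed

theorem basis_vectors_span: "span (basis_vector ` pairs) = UNIV"
proof -
  let ?S = "span (basis_vector ` pairs)"
  have u_S: "u i \<in> ?S" if "i \<in> {1..r}" for i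
  proof -
    have "(- int i, int i) \<in> pairs" using that by (auto simp: pairs_def J_def)
    moreover have "basis_vector (- int i, int i) = u i" by (simp add: basis_vector_def)
    ultimately show ?thesis by (metis imageI span_base)
  qed
  have H_S: "H \<subseteq> ?S"
  proof
    fix t assume "t \<in> H"
    then have t: "t = (\<Sum>i = 1..r. \<delta> i t *\<^sub>C u i)" by (rule H_expansion)
    show "t \<in> ?S" by (subst t) (intro span_sum span_scale u_S)
  qed
  have "root_space H \<phi> \<subseteq> ?S" if \<phi>: "\<phi> \<in> dual H" for \<phi>
  proof (cases "\<phi> \<in> roots H")
    case True
    obtain s t where st: "admissible s t" "\<phi> = wt s t" using root_wt[OF True] by blast
    have "\<exists>p\<in>pairs. fst p \<noteq> - snd p \<and> weight_of p = \<phi>"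
    proof (cases "s < t")
      case True
      then show ?thesis using st
        by (intro bexI[of _ "(s, t)"]) (auto simp: weight_of_def pairs_def admissible_def)
    next
      case False
      then show ?thesis using st wt_commute[of s t]
        by (intro bexI[of _ "(t, s)"]) (auto simp: weight_of_def pairs_def admissible_def)
    qed
    then obtain p where p: "p \<in> pairs" "fst p \<noteq> - snd p" "weight_of p = \<phi>" by blast
    show ?thesis
    proof
      fix z assume "z \<in> root_space H \<phi>"
      then obtain c where "z = c *\<^sub>C basis_vector p"
        using root_space_one_dimensional[OF True] other_pair(3,4)[OF p(1,2)] p(3) by blast
      then show "z \<in> ?S" using p(1) by (auto intro: span_scale span_base)
    qed
  next
    case False
    then consider "\<phi> = (\<lambda>_. 0)" | "root_space H \<phi> = {0}" using \<phi> by (auto simp: roots_def)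
    then show ?thesis
    proof cases
      case 1
      then show ?thesis using H_S root_space_zero_eq[of \<phi>] by simp
    qed (simp add: span_zero)
  qed
  then have "span (\<Union>\<phi>\<in>dual H. root_space H \<phi>) \<subseteq> ?S"
    by (intro span_minimal subspace_span) blast
  then show ?thesis using root_spaces_span by auto
qed

theorem dim_weight_space_D:
  assumes "h \<in> H"
  shows "dim {v. bracket h v = \<mu> *\<^sub>C v} = card {p\<in>pairs. weight_of p h = \<mu>}"
  by (rule dim_eigenspace[OF linear_bracket finite_pairs basis_vectors_independent basis_vectors_span])
    (rule root_spaceD[OF basis_vector_weight assms])

end

section \<open>Counting pairs\<close>

lemma card_odd_interval:
  fixes m c :: nat
  shows "card {j. odd j \<and> j \<le> 2 * c - 1 \<and> m \<le> j} = c - m div 2"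
proof -
  have "{j. odd j \<and> j \<le> 2 * c - 1 \<and> m \<le> j} = (\<lambda>i. 2 * i + 1) ` {m div 2..<c}"
  proof (intro equalityI subsetI)
    fix j assume j: "j \<in> {j. odd j \<and> j \<le> 2 * c - 1 \<and> m \<le> j}"
    then have "j = 2 * (j div 2) + 1" "j div 2 \<in> {m div 2..<c}"
      by (auto elim!: oddE intro: div_le_mono)
    then show "j \<in> (\<lambda>i. 2 * i + 1) ` {m div 2..<c}" by (rule image_eqI)
  qed auto
  then show ?thesis by (simp add: card_image inj_on_def)
qed

text \<open>The left-hand side counts the ordered pairs \<open>(z, z')\<close> in \<open>{-c, \<dots>, c}\<close> with sum \<open>m\<close>; the last
  summand is the pair with equal members, and half of the rest are the unordered pairs.\<close>

lemma card_square_antidiagonal: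
  fixes m c :: nat
  shows "card {z::int. \<bar>z\<bar> \<le> int c \<and> \<bar>int m - z\<bar> \<le> int c} =
    2 * card {j. odd j \<and> j \<le> 2 * c - 1 \<and> m \<le> j} + of_bool (even m \<and> m \<le> 2 * c)"
proof -
  have "{z::int. \<bar>z\<bar> \<le> int c \<and> \<bar>int m - z\<bar> \<le> int c} = {int m - int c..int c}" by auto
  then have "card {z::int. \<bar>z\<bar> \<le> int c \<and> \<bar>int m - z\<bar> \<le> int c} = 2 * c + 1 - m"
    by (simp add: nat_diff_distrib')
  also have "\<dots> = 2 * (c - m div 2) + of_bool (even m \<and> m \<le> 2 * c)"
    by (cases "even m") (auto elim!: evenE oddE)
  finally show ?thesis by (simp only: card_odd_interval)
qed

text \<open>The condition \<open>m - z \<le> a\<close> reads \<open>m \<le> z + a\<close>, and the other bound on \<open>m - z\<close> holds automatically.\<close>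

lemma card_rectangle_antidiagonal:
  fixes m a b :: nat
  assumes "b \<le> a"
  shows "card {z::int. \<bar>z\<bar> \<le> int b \<and> \<bar>int m - z\<bar> \<le> int a} = card {j\<in>{a - b..a + b}. m \<le> j}"
proof (rule bij_betw_same_card[of "\<lambda>z. nat (z + int a)"], rule bij_betw_byWitness[where f' = "\<lambda>j. int j - int a"])
qed (use assms in auto)

text \<open>Ordered pairs with a given sum can be counted from the multiplicities of the values alone; removing
  the diagonal and halving gives the unordered pairs.  Since the multiplicity function is the sum of
  the indicator functions of \<open>{-a, \<dots>, a}\<close> and \<open>{-b, \<dots>, b}\<close>, the count of ordered pairs has four parts.\<close>

lemma card_pairs_by_multiplicity:
  fixes J :: "int set" and Y :: "int \<Rightarrow> int" and a b m :: nat
  assumes J: "finite J" and ba: "b \<le> a"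
    and mult: "\<And>z. card {s\<in>J. Y s = z} = of_bool (\<bar>z\<bar> \<le> int a) + of_bool (\<bar>z\<bar> \<le> int b)"
  shows "card {(s, t). s \<in> J \<and> t \<in> J \<and> s < t \<and> Y s + Y t = int m} =
    card {j. odd j \<and> j \<le> 2 * a - 1 \<and> m \<le> j} + card {j. odd j \<and> j \<le> 2 * b - 1 \<and> m \<le> j} +
    card {j\<in>{a - b..a + b}. m \<le> j}"
proof -
  define M where "M z = (of_bool (\<bar>z\<bar> \<le> int a) + of_bool (\<bar>z\<bar> \<le> int b) :: nat)" for z
  define f where "f c d = card {z::int. \<bar>z\<bar> \<le> int c \<and> \<bar>int m - z\<bar> \<le> int d}" for c d
  let ?A = "{(s, t). s \<in> J \<and> t \<in> J \<and> s < t \<and> Y s + Y t = int m}"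
  let ?S = "{(s, t). s \<in> J \<and> t \<in> J \<and> Y s + Y t = int m}"
  let ?D = "{s\<in>J. 2 * Y s = int m}"
  have fin: "finite ?S" "finite ?A" "finite ?D"
    by (rule finite_subset[of _ "J \<times> J"], use J in auto)+
  have Y_bound: "Y s \<in> {- int a..int a}" if "s \<in> J" for s
  proof -
    have "{t\<in>J. Y t = Y s} \<noteq> {}" using that by auto
    then have "card {t\<in>J. Y t = Y s} \<noteq> 0" using J by simp
    then show ?thesis unfolding mult using ba by (auto split: if_splits simp: of_bool_def)
  qed
  have "?S = ?A \<union> prod.swap ` ?A \<union> (\<lambda>s. (s, s)) ` ?D"
  proof (intro equalityI subsetI)
    fix p assume p: "p \<in> ?S"
    obtain s t where st: "p = (s, t)" by (cases p)
    consider "s < t" | "t < s" | "s = t" by fastforce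
    then show "p \<in> ?A \<union> prod.swap ` ?A \<union> (\<lambda>s. (s, s)) ` ?D"
    proof cases
      case 2
      then have "p = prod.swap (t, s)" "(t, s) \<in> ?A" using p st by auto
      then show ?thesis by blast
    qed (use p st in auto)
  qed auto
  moreover have "?A \<inter> prod.swap ` ?A = {}" "(?A \<union> prod.swap ` ?A) \<inter> (\<lambda>s. (s, s)) ` ?D = {}" by auto
  ultimately have "card ?S = card ?A + card (prod.swap ` ?A) + card ((\<lambda>s. (s, s)) ` ?D)"
    using fin by (simp add: card_Un_disjoint)
  then have SA: "card ?S = 2 * card ?A + card ?D"
    by (simp add: card_image inj_on_def)
  have D: "card ?D = of_bool (even m \<and> m \<le> 2 * a) + of_bool (even m \<and> m \<le> 2 * b)"
  proof (cases "even m")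
    case True
    then obtain q where q: "m = 2 * q" by blast
    then have "?D = {s\<in>J. Y s = int q}" by auto
    then show ?thesis using q by (simp add: mult)
  next
    case False
    then have "?D = {}" by (auto, presburger)
    then show ?thesis using False by (simp add: card_eq_0_iff)
  qed
  have "?S = Sigma J (\<lambda>s. {t\<in>J. Y t = int m - Y s})" by auto
  then have "card ?S = (\<Sum>s\<in>J. M (int m - Y s))"
    using J by (simp add: card_SigmaI mult M_def)
  also have "\<dots> = (\<Sum>z\<in>{- int a..int a}. \<Sum>s\<in>{s\<in>J. Y s = z}. M (int m - Y s))"
    using J Y_bound by (intro sum.group[symmetric]) auto
  also have "\<dots> = (\<Sum>z\<in>{- int a..int a}. M z * M (int m - z))"
    by (rule sum.cong) (simp_all add: mult M_def)
  also have "\<dots> = (\<Sum>z\<in>{- int a..int a}.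
      of_bool (\<bar>z\<bar> \<le> int a \<and> \<bar>int m - z\<bar> \<le> int a) + of_bool (\<bar>z\<bar> \<le> int a \<and> \<bar>int m - z\<bar> \<le> int b) +
      of_bool (\<bar>z\<bar> \<le> int b \<and> \<bar>int m - z\<bar> \<le> int a) + of_bool (\<bar>z\<bar> \<le> int b \<and> \<bar>int m - z\<bar> \<le> int b))"
    by (rule sum.cong) (auto simp: M_def)
  also have "\<dots> = f a a + f a b + f b a + f b b"
  proof -
    have "(\<Sum>z\<in>{- int a..int a}. of_bool (\<bar>z\<bar> \<le> int c \<and> \<bar>int m - z\<bar> \<le> int d)) = f c d" if "c \<le> a" for c d
    proof -
      have "{- int a..int a} \<inter> {z. \<bar>z\<bar> \<le> int c \<and> \<bar>int m - z\<bar> \<le> int d}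
          = {z. \<bar>z\<bar> \<le> int c \<and> \<bar>int m - z\<bar> \<le> int d}" using that by auto
      then show ?thesis by (simp add: sum_of_bool_eq f_def)
    qed
    then show ?thesis using ba by (simp only: sum.distrib order_refl)
  qed
  also have "f a b = f b a"
    unfolding f_def
    by (rule bij_betw_same_card[of "\<lambda>z. int m - z"], rule bij_betw_byWitness[where f' = "\<lambda>z. int m - z"]) auto
  finally have "card ?S = f a a + f b a + f b a + f b b" .
  then show ?thesis
    using SA D card_square_antidiagonal[of a m] card_square_antidiagonal[of b m]
      card_rectangle_antidiagonal[OF ba, of m]
    unfolding f_def by simp
qed

text \<open>Half the value of \<open>\<epsilon> s\<close> on \<open>h\<close> (see \<open>\<epsilon>_half_weight\<close>).  Up to the index \<open>2 k + 1\<close> the weighted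
  diagram alternates between 0 and 2, so the values \<open>0, 1, 1, 2, 2, \<dots>, k, k\<close> occur; from then on they
  increase by one.\<close>

definition half_weight :: "nat \<Rightarrow> int \<Rightarrow> int" where
  "half_weight k s = (if 0 < s then (if s \<le> 2 * int k + 1 then s div 2 else s - 1 - int k)
     else - (if - s \<le> 2 * int k + 1 then (- s) div 2 else - s - 1 - int k))"

lemma half_weight_minus: "s \<noteq> 0 \<Longrightarrow> half_weight k (- s) = - half_weight k s"
  by (simp add: half_weight_def)

lemma half_weight_multiplicity:
  fixes r k :: nat
  assumes "k < r div 2"
  shows "card {s. s \<noteq> 0 \<and> \<bar>s\<bar> \<le> int r \<and> half_weight k s = z} =
    of_bool (\<bar>z\<bar> \<le> int (r - k - 1)) + of_bool (\<bar>z\<bar> \<le> int k)"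
proof -
  have rk: "2 * int k + 2 \<le> int r" using assms by linarith
  then have a: "int (r - k - 1) = int r - int k - 1" by simp
  have pos: "card {s. s \<noteq> 0 \<and> \<bar>s\<bar> \<le> int r \<and> half_weight k s = z} =
      of_bool (z \<le> int r - int k - 1) + of_bool (z \<le> int k)" if z: "0 < z" for z
  proof -
    consider "z \<le> int k" | "int k < z" "z \<le> int r - int k - 1" | "int r - int k - 1 < z" by linarith
    then show ?thesis
    proof cases
      case 1
      have "{s. s \<noteq> 0 \<and> \<bar>s\<bar> \<le> int r \<and> half_weight k s = z} = {2 * z, 2 * z + 1}"
        using z 1 rk by (auto simp: half_weight_def split: if_splits)
      then show ?thesis using 1 rk by simp
    next
      case 2
      have "{s. s \<noteq> 0 \<and> \<bar>s\<bar> \<le> int r \<and> half_weight k s = z} = {z + 1 + int k}"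
        using z 2 rk by (auto simp: half_weight_def split: if_splits)
      then show ?thesis using 2 by simp
    next
      case 3
      have "{s. s \<noteq> 0 \<and> \<bar>s\<bar> \<le> int r \<and> half_weight k s = z} = {}"
        using z 3 rk by (auto simp: half_weight_def split: if_splits)
      then have "card {s. s \<noteq> 0 \<and> \<bar>s\<bar> \<le> int r \<and> half_weight k s = z} = 0" by (simp only: card.empty)
      then show ?thesis using 3 rk by simp
    qed
  qed
  consider "0 < z" | "z = 0" | "z < 0" by linarith
  then show ?thesis
  proof cases
    case 1
    then show ?thesis using pos a by simp
  next
    case 2
    have "{s. s \<noteq> 0 \<and> \<bar>s\<bar> \<le> int r \<and> half_weight k s = z} = {1, - 1}"
      using 2 rk by (auto simp: half_weight_def split: if_splits)
    then show ?thesis using 2 by simp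
  next
    case 3
    have "card {s. s \<noteq> 0 \<and> \<bar>s\<bar> \<le> int r \<and> half_weight k s = z}
        = card {s. s \<noteq> 0 \<and> \<bar>s\<bar> \<le> int r \<and> half_weight k s = - z}"
      by (rule bij_betw_same_card[of uminus], rule bij_betw_byWitness[where f' = uminus])
        (auto simp: half_weight_minus)
    then show ?thesis using pos[of "- z"] 3 a by simp
  qed
qed

context D_cartan
begin

lemma \<epsilon>_half_weight:
  assumes simple_values: "\<And>i. i \<in> {1..r} \<Longrightarrow> \<alpha> i h = (if \<exists>m. 0 < m \<and> m \<le> k \<and> i = 2 * m + 1 then 0 else 2)"
    and s: "s \<in> J"
  shows "\<epsilon> s h = of_int (2 * half_weight k s)"
proof -
  have \<delta>: "\<delta> i h = of_int (2 * half_weight k (int i))" if "i \<in> {1..r}" for i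
    using that
  proof (induction rule: index_induct)
    case one
    show ?case using simple_values[OF in_index(1)] simple_values[OF in_index(2)]
      by (auto simp: \<delta>_rec half_weight_def split: if_splits)
  next
    case two
    show ?case using simple_values[OF in_index(1)] simple_values[OF in_index(2)]
      by (auto simp: \<delta>_rec half_weight_def split: if_splits)
  next
    case (step i)
    have \<alpha>: "\<alpha> (Suc i) h = of_int (if odd (Suc i) \<and> Suc i \<le> 2 * k + 1 then 0 else 2)"
    proof -
      have "(\<exists>m. 0 < m \<and> m \<le> k \<and> Suc i = 2 * m + 1) \<longleftrightarrow> odd (Suc i) \<and> Suc i \<le> 2 * k + 1"
        using step(1) by (auto elim!: oddE)
      then show ?thesis unfolding simple_values[OF step(3)] by simp
    qed
    have "2 * half_weight k (int (Suc i))
        = 2 * half_weight k (int i) + (if odd (Suc i) \<and> Suc i \<le> 2 * k + 1 then 0 else 2)"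
      using step(1) unfolding half_weight_def by (auto, presburger+)
    then show ?case using step by (simp only: \<delta>_rec \<alpha> of_int_add)
  qed
  from s show ?thesis
  proof (cases rule: J_cases)
    case (1 n)
    then show ?thesis using \<delta>[OF 1(1)] by (simp add: \<epsilon>_simps)
  next
    case (2 n)
    then show ?thesis using \<delta>[OF 2(1)] by (simp add: \<epsilon>_simps half_weight_minus)
  qed
qed

text \<open>The pairs with \<open>half_weight\<close> sum \<open>m\<close> index a basis of the eigenspace of \<open>ad h\<close> for \<open>2 m\<close>, so their
  number is the number of entries of the partition that are at least \<open>m\<close>.\<close>

theorem weight_partition_D:
  assumes k: "k < r div 2" and nil: "ad_nilpotent e" and triple: "sl2_triple e h f" and h: "h \<in> H"
    and simple_values: "\<And>i. i \<in> {1..r} \<Longrightarrow> \<alpha> i h = (if \<exists>m. 0 < m \<and> m \<le> k \<and> i = 2 * m + 1 then 0 else 2)"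
  shows "is_weight_partition e W \<longleftrightarrow> W = weights_D_a r k"
proof -
  have weight: "weight_of (s, t) h = of_int (2 * (half_weight k s + half_weight k t))"
    if "s \<in> J" "t \<in> J" for s t
    using \<epsilon>_half_weight[OF simple_values that(1)] \<epsilon>_half_weight[OF simple_values that(2)]
    by (simp add: weight_of_def wt_def)
  define T where "T = mset_set {j. odd j \<and> j \<le> 2 * r - 2 * k - 3} +
      mset_set {j. odd j \<and> j \<le> 2 * k - 1} + mset_set {r - 2 * k - 1..r - 1}"
  have W: "weights_D_a r k = image_mset of_nat T" by (simp add: weights_D_a_def T_def)
  show ?thesis
    unfolding W
  proof (rule weight_partition_from_weight_multiplicities[OF nil triple H_diag[OF h]])
    fix v l assume v: "v \<noteq> 0" "bracket h v = of_nat l *\<^sub>C v"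
    then have "dim {v. bracket h v = of_nat l *\<^sub>C v} \<noteq> 0" by auto
    then have "{p\<in>pairs. weight_of p h = of_nat l} \<noteq> {}"
      unfolding dim_weight_space_D[OF h] by (metis card.empty)
    then obtain s t where st: "(s, t) \<in> pairs" "weight_of (s, t) h = of_nat l" by auto
    then have "of_int (2 * (half_weight k s + half_weight k t)) = (of_int (int l) :: complex)"
      using weight by (simp add: pairs_def)
    then have "2 * (half_weight k s + half_weight k t) = int l" by (simp only: of_int_eq_iff)
    then show "even l" by presburger
  next
    fix m
    let ?a = "r - k - 1"
    have eqs: "2 * r - 2 * k - 3 = 2 * ?a - 1" "r - 2 * k - 1 = ?a - k" "r - 1 = ?a + k"
      using k by auto
    have "{p\<in>pairs. weight_of p h = of_nat (2 * m)}
        = {(s, t). s \<in> J \<and> t \<in> J \<and> s < t \<and> half_weight k s + half_weight k t = int m}"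
    proof -
      have "weight_of (s, t) h = of_nat (2 * m) \<longleftrightarrow> half_weight k s + half_weight k t = int m"
        if "s \<in> J" "t \<in> J" for s t
      proof -
        have "weight_of (s, t) h = of_nat (2 * m) \<longleftrightarrow>
            (of_int (2 * (half_weight k s + half_weight k t)) :: complex) = of_int (int (2 * m))"
          unfolding weight[OF that] by simp
        then show ?thesis by (simp only: of_int_eq_iff) presburger
      qed
      then show ?thesis by (auto simp: pairs_def)
    qed
    then have "dim {v. bracket h v = of_nat (2 * m) *\<^sub>C v} =
        card {(s, t). s \<in> J \<and> t \<in> J \<and> s < t \<and> half_weight k s + half_weight k t = int m}"
      unfolding dim_weight_space_D[OF h] by (rule arg_cong)
    also have "\<dots> = card {j. odd j \<and> j \<le> 2 * ?a - 1 \<and> m \<le> j} + card {j. odd j \<and> j \<le> 2 * k - 1 \<and> m \<le> j} +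
        card {j\<in>{?a - k..?a + k}. m \<le> j}"
      by (rule card_pairs_by_multiplicity[OF finite_J])
        (use k half_weight_multiplicity[OF k] in \<open>simp_all add: J_def conj_assoc\<close>)
    also have "\<dots> = size {#x \<in># T. m \<le> x#}"
    proof -
      have "finite {j. odd j \<and> j \<le> c}" for c :: nat by (rule finite_subset[of _ "{..c}"]) auto
      then show ?thesis unfolding T_def eqs by (simp add: conj_assoc)
    qed
    finally show "dim {v. bracket h v = of_nat (2 * m) *\<^sub>C v} = size {#x \<in># T. m \<le> x#}" .
  qed
qed

end

theorem theorem1p1:
  fixes scale :: "complex \<Rightarrow> 'g::ab_group_add \<Rightarrow> 'g"
    and bracket :: "'g \<Rightarrow> 'g \<Rightarrow> 'g"
    and r k :: nat and e :: 'g and W :: "rat multiset"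
  assumes "4 \<le> r" and "k < r div 2"
    and "complex_simple_lie_algebra scale bracket"
    and "complex_lie_algebra.of_type_D scale bracket r"
    and "complex_lie_algebra.nilpotent_of_type_D_a scale bracket r k e"
  shows "complex_lie_algebra.is_weight_partition scale bracket e W \<longleftrightarrow> W = weights_D_a r k"
proof -
  interpret complex_simple_lie_algebra scale bracket by fact
  obtain h f H \<alpha> where nil: "ad_nilpotent e" and triple: "sl2_triple e h f"
    and H: "cartan_subalgebra H" "h \<in> H" and simple: "simple_roots H r \<alpha>" "D_labelled H r \<alpha>"
    and simple_values: "\<And>i. i \<in> {1..r} \<Longrightarrow> \<alpha> i h = (if \<exists>m. 0 < m \<and> m \<le> k \<and> i = 2 * m + 1 then 0 else 2)"
    using assms(5) unfolding nilpotent_of_type_D_a_def by blast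
  have diag: "ad_diagonalizable h" using H by (simp add: cartan_subalgebra_def)
  \<comment> \<open>The node 1 has weight 2, so \<open>h\<close> and with it \<open>e\<close> is nonzero.\<close>
  have "\<alpha> 1 h = 2" using simple_values[of 1] assms(1) by auto
  moreover have "\<alpha> 1 \<in> dual H" using simple(1) assms(1) by (simp add: simple_roots_def roots_def)
  then have "\<alpha> 1 (scale 0 h) = 0 * \<alpha> 1 h" using H(2) by (simp only: dual_def mem_Collect_eq)
  ultimately have "h \<noteq> 0" by auto
  then have e: "e \<noteq> 0" using triple by (auto simp: sl2_triple_def bracket_simps)
  obtain \<kappa> where \<kappa>: "nondegenerate_form \<kappa>"
    using nondegenerate_form_exists[OF no_proper_ideals triple diag e] by blast
  define Z where "Z = {x. \<forall>y. bracket x y = 0}"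
  have "lie_ideal Z"
    unfolding lie_ideal_def
  proof (intro conjI allI ballI)
    show "subspace Z" by (rule subspaceI) (auto simp: Z_def bracket_simps)
    show "bracket x y \<in> Z" if "y \<in> Z" for x y
      using that bracket_anticommute[of y x] by (simp add: Z_def bracket_simps)
  qed
  then have "Z = {0}" using no_proper_ideals[of Z] nonabelian by (auto simp: Z_def)
  then interpret D_cartan scale bracket H \<kappa> r \<alpha>
    by unfold_locales (use H \<kappa> simple assms(1) in \<open>auto simp: Z_def\<close>)
  show ?thesis by (rule weight_partition_D[OF assms(2) nil triple H(2) simple_values])
qed

end
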